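(* Let $d\ge 1$ be an integer, $\alpha=2$, $0<\beta\le 1$, $\gamma\ge 0$, $V>0$, and let $N=(N_t)_{t\ge0}$ be the empirical measure process of the $(d,2,\beta,\gamma)$-branching particle system. If $d<2/\beta+\gamma$, then for each bounded Borel set $A\subset\mathbb{R}^d$, $$P\bigl[\text{there exists }\tau_A<\infty\text{ such that }N_t(A)=0\text{ for all }t\ge\tau_A\bigr]=1.$$
   Context: The $(d,\alpha,\beta,\gamma)$-branching particle system: particles move independently in $\mathbb{R}^d$ according to the standard spherically symmetric $\alpha$-stable Lévy process (characteristic function $e^{-t|z|^\alpha}$; Brownian motion for $\alpha=2$); each lifetime is exponential with parameter $V$; at death a particle is replaced, at its location, by a random number of offspring with generating function $s+\frac{1}{1+\beta}(1-s)^{1+\beta}$, $0<s<1$; motions, lifetimes and branchings are independent; the initial configuration $N_0$ is a Poisson random measure with intensity $\mu_\gamma(dx)=\frac{1}{1+|x|^\gamma}dx$. $N_t(A)$ is the number of particles in the Borel set $A$ at time $t$. *)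

theory Defs
  imports "HOL-Probability.Probability" "HOL-Library.Extended_Nat"
begin

text \<open>A random measure is a map from the sample space to measures. It takes the value
  infinity almost surely on sets of infinite intensity, and on sets of finite intensity
  it has the Poisson law (including the degenerate law at 0, as \<open>0 ^ 0 = 1\<close>).\<close>

definition (in prob_space) poisson_random_measure ::
    "('a \<Rightarrow> 'b measure) \<Rightarrow> 'b measure \<Rightarrow> bool" where
  "poisson_random_measure N \<mu> \<longleftrightarrow>
     (\<forall>A\<in>sets \<mu>. emeasure \<mu> A < \<infinity> \<longrightarrow>
        (\<forall>k::nat. prob {\<omega>\<in>space M. emeasure (N \<omega>) A = of_nat k}
                = exp (- measure \<mu> A) * measure \<mu> A ^ k / fact k)) \<and>
     (\<forall>A\<in>sets \<mu>. emeasure \<mu> A = \<infinity> \<longrightarrow> (AE \<omega> in M. emeasure (N \<omega>) A = \<infinity>)) \<and>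
     (\<forall>A::nat \<Rightarrow> 'b set. range A \<subseteq> sets \<mu> \<and> disjoint_family A \<longrightarrow>
        indep_vars (\<lambda>_. borel) (\<lambda>j \<omega>. emeasure (N \<omega>) (A j)) UNIV)"

text \<open>At the origin \<open>0 powr 0 = 0\<close> in HOL, so for \<open>\<gamma> = 0\<close> the density below is 1 instead
  of 1/2 at that single point, which does not affect the measure.\<close>

definition initial_intensity :: "real \<Rightarrow> 'b::euclidean_space measure" where
  "initial_intensity \<gamma> = density lborel (\<lambda>x. ennreal (1 / (1 + norm x powr \<gamma>)))"

definition cadlag :: "(real \<Rightarrow> 'b::topological_space) \<Rightarrow> bool" where
  "cadlag f \<longleftrightarrow> (\<forall>t\<ge>0. (f \<longlongrightarrow> f t) (at_right t)) \<and> (\<forall>t>0. \<exists>l. (f \<longlongrightarrow> l) (at_left t))"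

text \<open>The process is started at 0, and time is the half-line of nonnegative reals.
  For \<open>\<alpha> = 2\<close> it is Brownian motion (with covariance matrix \<open>2 t\<close> times the identity at
  time \<open>t\<close>), whose paths are understood to be continuous. In the condition on increments,
  finitely many times \<open>ts 0 \<le> \<dots> \<le> ts n\<close> are covered by sequences that are eventually
  constant.\<close>

definition (in prob_space) stable_process ::
    "real \<Rightarrow> (real \<Rightarrow> 'a \<Rightarrow> 'b::euclidean_space) \<Rightarrow> bool" where
  "stable_process \<alpha> Y \<longleftrightarrow>
     (\<forall>t\<ge>0. Y t \<in> borel_measurable M) \<and>
     (AE \<omega> in M. Y 0 \<omega> = 0) \<and>
     (\<forall>ts::nat \<Rightarrow> real. 0 \<le> ts 0 \<and> incseq ts \<longrightarrow>
        indep_vars (\<lambda>_. borel) (\<lambda>k \<omega>. Y (ts (Suc k)) \<omega> - Y (ts k) \<omega>) UNIV) \<and>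
     (\<forall>s t z. 0 \<le> s \<and> s \<le> t \<longrightarrow>
        (\<integral>\<omega>. cis (z \<bullet> (Y t \<omega> - Y s \<omega>)) \<partial>M)
          = complex_of_real (exp (- (t - s) * norm z powr \<alpha>))) \<and>
     (AE \<omega> in M. cadlag (\<lambda>t. Y t \<omega>)) \<and>
     (\<alpha> = 2 \<longrightarrow> (AE \<omega> in M. continuous_on {0..} (\<lambda>t. Y t \<omega>)))"

text \<open>Particles are labelled in the Ulam--Harris fashion by the index \<open>i\<close> of the initial
  ancestor and a list \<open>u\<close> of sibling numbers, most recent generation first: \<open>(i, k # u)\<close> is
  child number \<open>k\<close> of \<open>(i, u)\<close>. Every label carries a lifetime \<open>T i u\<close>, an offspring number
  \<open>K i u\<close> and a displacement process \<open>Y i u\<close>, run from the particle's birth; only labels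
  satisfying \<open>exists_label\<close> correspond to actual particles. The initial ancestors are the
  indices below \<open>n\<close>, which may be infinite, and \<open>X i\<close> are their positions.\<close>

fun exists_label ::
    "('w \<Rightarrow> enat) \<Rightarrow> (nat \<Rightarrow> nat list \<Rightarrow> 'w \<Rightarrow> nat) \<Rightarrow> nat \<Rightarrow> nat list \<Rightarrow> 'w \<Rightarrow> bool" where
  "exists_label n K i [] \<omega> \<longleftrightarrow> enat i < n \<omega>"
| "exists_label n K i (k # u) \<omega> \<longleftrightarrow> exists_label n K i u \<omega> \<and> k < K i u \<omega>"

fun birth_time :: "(nat \<Rightarrow> nat list \<Rightarrow> 'w \<Rightarrow> real) \<Rightarrow> nat \<Rightarrow> nat list \<Rightarrow> 'w \<Rightarrow> real" where
  "birth_time T i [] \<omega> = 0"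
| "birth_time T i (k # u) \<omega> = birth_time T i u \<omega> + T i u \<omega>"

fun birth_place ::
    "(nat \<Rightarrow> 'w \<Rightarrow> 'b::euclidean_space) \<Rightarrow> (nat \<Rightarrow> nat list \<Rightarrow> 'w \<Rightarrow> real) \<Rightarrow>
     (nat \<Rightarrow> nat list \<Rightarrow> real \<Rightarrow> 'w \<Rightarrow> 'b) \<Rightarrow> nat \<Rightarrow> nat list \<Rightarrow> 'w \<Rightarrow> 'b" where
  "birth_place X T Y i [] \<omega> = X i \<omega>"
| "birth_place X T Y i (k # u) \<omega> = birth_place X T Y i u \<omega> + Y i u (T i u \<omega>) \<omega>"

definition alive ::
    "('w \<Rightarrow> enat) \<Rightarrow> (nat \<Rightarrow> nat list \<Rightarrow> 'w \<Rightarrow> real) \<Rightarrow> (nat \<Rightarrow> nat list \<Rightarrow> 'w \<Rightarrow> nat) \<Rightarrow>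
     real \<Rightarrow> 'w \<Rightarrow> (nat \<times> nat list) set" where
  "alive n T K t \<omega> = {(i, u). exists_label n K i u \<omega> \<and>
     birth_time T i u \<omega> \<le> t \<and> t < birth_time T i u \<omega> + T i u \<omega>}"

definition particle_position ::
    "(nat \<Rightarrow> 'w \<Rightarrow> 'b::euclidean_space) \<Rightarrow> (nat \<Rightarrow> nat list \<Rightarrow> 'w \<Rightarrow> real) \<Rightarrow>
     (nat \<Rightarrow> nat list \<Rightarrow> real \<Rightarrow> 'w \<Rightarrow> 'b) \<Rightarrow> real \<Rightarrow> 'w \<Rightarrow> nat \<times> nat list \<Rightarrow> 'b" where
  "particle_position X T Y t \<omega> = (\<lambda>(i, u).
     birth_place X T Y i u \<omega> + Y i u (t - birth_time T i u \<omega>) \<omega>)"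

text \<open>The sum of the unit point masses at the particles alive at time \<open>t\<close>.\<close>

definition empirical_measure ::
    "('w \<Rightarrow> enat) \<Rightarrow> (nat \<Rightarrow> 'w \<Rightarrow> 'b::euclidean_space) \<Rightarrow>
     (nat \<Rightarrow> nat list \<Rightarrow> 'w \<Rightarrow> real) \<Rightarrow> (nat \<Rightarrow> nat list \<Rightarrow> 'w \<Rightarrow> nat) \<Rightarrow>
     (nat \<Rightarrow> nat list \<Rightarrow> real \<Rightarrow> 'w \<Rightarrow> 'b) \<Rightarrow> real \<Rightarrow> 'w \<Rightarrow> 'b measure" where
  "empirical_measure n X T K Y t \<omega> =
     distr (count_space (alive n T K t \<omega>)) borel (particle_position X T Y t \<omega>)"

definition initial_configuration ::
    "('w \<Rightarrow> enat) \<Rightarrow> (nat \<Rightarrow> 'w \<Rightarrow> 'b::euclidean_space) \<Rightarrow> 'w \<Rightarrow> 'b measure" where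
  "initial_configuration n X \<omega> =
     distr (count_space {i. enat i < n \<omega>}) borel (\<lambda>i. X i \<omega>)"

lemma emeasure_empirical_measure:
  assumes "A \<in> sets borel"
  shows "emeasure (empirical_measure n X T K Y t \<omega>) A =
    emeasure (count_space UNIV) {l \<in> alive n T K t \<omega>. particle_position X T Y t \<omega> l \<in> A}"
proof -
  let ?S = "alive n T K t \<omega>" and ?p = "particle_position X T Y t \<omega>"
  have "emeasure (empirical_measure n X T K Y t \<omega>) A
      = emeasure (count_space ?S) (?p -` A \<inter> space (count_space ?S))"
    unfolding empirical_measure_def using assms by (intro emeasure_distr) simp_all
  also have "?p -` A \<inter> space (count_space ?S) = {l \<in> ?S. ?p l \<in> A}"
    by auto
  also have "emeasure (count_space ?S) {l \<in> ?S. ?p l \<in> A}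
      = emeasure (count_space UNIV) {l \<in> ?S. ?p l \<in> A}"
    by (cases "finite {l \<in> ?S. ?p l \<in> A}") (auto simp: emeasure_count_space)
  finally show ?thesis .
qed

datatype randomness_source =
  Initial | Lifetime nat "nat list" | Offspring nat "nat list" | Motion nat "nat list"

primrec source_algebra ::
    "'w measure \<Rightarrow> ('w \<Rightarrow> enat) \<Rightarrow> (nat \<Rightarrow> 'w \<Rightarrow> 'b::euclidean_space) \<Rightarrow>
     (nat \<Rightarrow> nat list \<Rightarrow> 'w \<Rightarrow> real) \<Rightarrow> (nat \<Rightarrow> nat list \<Rightarrow> 'w \<Rightarrow> nat) \<Rightarrow>
     (nat \<Rightarrow> nat list \<Rightarrow> real \<Rightarrow> 'w \<Rightarrow> 'b) \<Rightarrow> randomness_source \<Rightarrow> 'w measure" where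
  "source_algebra M n X T K Y Initial =
     vimage_algebra (space M) (\<lambda>\<omega>. (n \<omega>, \<lambda>i. X i \<omega>)) (count_space UNIV \<Otimes>\<^sub>M (\<Pi>\<^sub>M i\<in>UNIV. borel))"
| "source_algebra M n X T K Y (Lifetime i u) = vimage_algebra (space M) (T i u) borel"
| "source_algebra M n X T K Y (Offspring i u) = vimage_algebra (space M) (K i u) (count_space UNIV)"
| "source_algebra M n X T K Y (Motion i u) =
     vimage_algebra (space M) (\<lambda>\<omega>. \<lambda>t\<in>{0..}. Y i u t \<omega>) (\<Pi>\<^sub>M t\<in>{0..}. borel)"

text \<open>The dimension is that of the Euclidean space \<open>'b\<close>. The offspring law is prescribed
  by its generating function.\<close>

locale branching_particle_system = prob_space M
  for M :: "'w measure"
    and \<alpha> \<beta> \<gamma> V :: real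
    and n :: "'w \<Rightarrow> enat"
    and X :: "nat \<Rightarrow> 'w \<Rightarrow> 'b::euclidean_space"
    and T :: "nat \<Rightarrow> nat list \<Rightarrow> 'w \<Rightarrow> real"
    and K :: "nat \<Rightarrow> nat list \<Rightarrow> 'w \<Rightarrow> nat"
    and Y :: "nat \<Rightarrow> nat list \<Rightarrow> real \<Rightarrow> 'w \<Rightarrow> 'b" +
  assumes measurable_n: "n \<in> measurable M (count_space UNIV)"
    and measurable_X: "\<And>i. X i \<in> borel_measurable M"
    and initial: "poisson_random_measure (initial_configuration n X) (initial_intensity \<gamma>)"
    and lifetime: "\<And>i u. distributed M lborel (T i u) (\<lambda>x. ennreal (exponential_density V x))"
    and measurable_K: "\<And>i u. K i u \<in> measurable M (count_space UNIV)"
    and offspring: "\<And>i u s. 0 < s \<Longrightarrow> s < 1 \<Longrightarrow>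
          expectation (\<lambda>\<omega>. s ^ K i u \<omega>) = s + 1 / (1 + \<beta>) * (1 - s) powr (1 + \<beta>)"
    and motion: "\<And>i u. stable_process \<alpha> (Y i u)"
    and independent: "indep_sets (\<lambda>r. sets (source_algebra M n X T K Y r)) UNIV"

end

theory Submission
  imports Defs "HOL-Real_Asymp.Real_Asymp"
begin

text \<open>
  Every particle of the initial configuration founds a family, and the families are independent. A
  family is a critical Galton--Watson tree, so it dies out in finite time (\<open>extinction\<close>).
  It therefore suffices that only finitely many families ever visit a given ball of
  radius \<open>R\<close> around the origin (\<open>finitely_many_visitors\<close>): after the last death in these
  families the ball stays empty.

  The family of an ancestor at \<open>x\<close> can visit the ball only if one of its particles is displaced by at
  least \<open>(norm x - R) / d\<close> in one of the \<open>2 * d\<close> signed coordinate directions. The main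
  estimate (\<open>tree_displacement_tail_uniform\<close>) says that a family reaches displacement \<open>r\<close> in a given direction with
  probability at most a constant times \<open>r powr (- 2 / \<beta>)\<close>. The Poisson configuration
  has on average of order \<open>2 powr (k * (d - \<gamma>))\<close> points at distance about \<open>2 ^ k\<close>, so the expected number
  of visiting families is at most a constant times the sum of
  \<open>2 powr (k * (d - \<gamma> - 2 / \<beta>))\<close>, which converges because \<open>d < 2 / \<beta> + \<gamma>\<close>.

  The main estimate compares a nonlinear recursion with an explicit function. Let \<open>S\<close> and \<open>D\<close> be the maximum
  and the final value of a one-dimensional Brownian motion during an exponential lifetime, and let
  \<open>g q = q - q powr (1 + \<beta>) / (1 + \<beta>)\<close>, the probability that some child is marked if each child is marked with
  probability \<open>q\<close>. Any \<open>v \<le> 1\<close> with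
  \<open>P(S \<ge> x) + E (g (v (x - D))) \<le> v x\<close> wherever \<open>v x < 1\<close> bounds the probability of reaching \<open>x\<close>
  within \<open>m\<close> generations, by induction on \<open>m\<close> (\<open>subtree_max_tail_le\<close>). The
  function \<open>v x = (max 1 (x / a)) powr (- 2 / \<beta>)\<close> qualifies for large \<open>a\<close>
  (\<open>power_tail_supersolution\<close>): averaging over the symmetric variable \<open>D\<close> raises \<open>v\<close> by a multiple of \<open>v x / x\<^sup>2\<close>,
  while the nonlinear term lowers it by a multiple of \<open>a\<^sup>2 * v x / x\<^sup>2\<close>. What this needs to know about \<open>S\<close> and
  \<open>D\<close> are symmetry and polynomial tails of high order, which come from Levy's maximal inequality and
  Gaussian moments. The same comparison, with displacement 1 for every particle, yields
  extinction.
\<close>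

section \<open>Pairs of independent random elements\<close>

text \<open>The relation \<open>indep_var\<close> relates random elements of one common type. The pairs needed
  here live in different spaces (a lifetime and a path, an offspring number and a
  displacement, a particle and all of its descendants), so the product formula is stated for
  two arbitrary value spaces.\<close>

definition (in prob_space) indep_pair ::
    "'b measure \<Rightarrow> ('a \<Rightarrow> 'b) \<Rightarrow> 'c measure \<Rightarrow> ('a \<Rightarrow> 'c) \<Rightarrow> bool" where
  "indep_pair N1 X N2 Y \<longleftrightarrow> X \<in> measurable M N1 \<and> Y \<in> measurable M N2 \<and>
     (\<forall>A\<in>sets N1. \<forall>B\<in>sets N2. prob ((X -` A \<inter> space M) \<inter> (Y -` B \<inter> space M))
        = prob (X -` A \<inter> space M) * prob (Y -` B \<inter> space M))"

lemma (in prob_space) indep_pairD: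
  "indep_pair N1 X N2 Y \<Longrightarrow> A \<in> sets N1 \<Longrightarrow> B \<in> sets N2 \<Longrightarrow>
    prob ((X -` A \<inter> space M) \<inter> (Y -` B \<inter> space M))
      = prob (X -` A \<inter> space M) * prob (Y -` B \<inter> space M)"
  by (simp add: indep_pair_def del: vimage_Collect_eq)

lemma (in prob_space) indep_pair_of_indep_var:
  "indep_var N1 X N2 Y \<Longrightarrow> indep_pair N1 X N2 Y"
  unfolding indep_pair_def
proof (intro conjI ballI)
  assume ind: "indep_var N1 X N2 Y"
  then show "X \<in> measurable M N1" "Y \<in> measurable M N2"
    by (auto dest: indep_var_rv1 indep_var_rv2)
  fix A B assume "A \<in> sets N1" "B \<in> sets N2"
  moreover have "(\<lambda>x. (X x, Y x)) -` (A \<times> B) \<inter> space M = (X -` A \<inter> space M) \<inter> (Y -` B \<inter> space M)"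
    by auto
  ultimately show "prob ((X -` A \<inter> space M) \<inter> (Y -` B \<inter> space M))
      = prob (X -` A \<inter> space M) * prob (Y -` B \<inter> space M)"
    using indep_varD[OF ind, of A B] by simp
qed

lemma (in prob_space) indep_pair_compose:
  assumes XY: "indep_pair N1 X N2 Y" and f: "f \<in> measurable N1 L1" and h: "h \<in> measurable N2 L2"
  shows "indep_pair L1 (\<lambda>\<omega>. f (X \<omega>)) L2 (\<lambda>\<omega>. h (Y \<omega>))"
  unfolding indep_pair_def
proof (intro conjI ballI)
  have X: "X \<in> measurable M N1" and Y: "Y \<in> measurable M N2"
    using XY by (auto simp: indep_pair_def)
  show "(\<lambda>\<omega>. f (X \<omega>)) \<in> measurable M L1" "(\<lambda>\<omega>. h (Y \<omega>)) \<in> measurable M L2"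
    using X Y f h by measurable
  fix A B assume A: "A \<in> sets L1" and B: "B \<in> sets L2"
  have "(\<lambda>\<omega>. f (X \<omega>)) -` A \<inter> space M = X -` (f -` A \<inter> space N1) \<inter> space M"
    "(\<lambda>\<omega>. h (Y \<omega>)) -` B \<inter> space M = Y -` (h -` B \<inter> space N2) \<inter> space M"
    using measurable_space[OF X] measurable_space[OF Y] by auto
  then show "prob (((\<lambda>\<omega>. f (X \<omega>)) -` A \<inter> space M) \<inter> ((\<lambda>\<omega>. h (Y \<omega>)) -` B \<inter> space M))
      = prob ((\<lambda>\<omega>. f (X \<omega>)) -` A \<inter> space M) * prob ((\<lambda>\<omega>. h (Y \<omega>)) -` B \<inter> space M)"
    using XY measurable_sets[OF f A] measurable_sets[OF h B]
    by (simp add: indep_pair_def del: vimage_Int)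
qed

text \<open>This is the form in which independence is used throughout: one may integrate first over an
  independent copy of the second argument with the first one held fixed. It replaces
  conditioning on a single particle.\<close>

lemma (in prob_space) nn_integral_indep_pair:
  assumes ind: "indep_pair N1 X N2 Y" and [measurable]: "f \<in> borel_measurable (N1 \<Otimes>\<^sub>M N2)"
  shows "(\<integral>\<^sup>+\<omega>. f (X \<omega>, Y \<omega>) \<partial>M) = (\<integral>\<^sup>+\<omega>. \<integral>\<^sup>+\<omega>'. f (X \<omega>, Y \<omega>') \<partial>M \<partial>M)"
proof -
  have [measurable]: "X \<in> measurable M N1" "Y \<in> measurable M N2"
    using ind by (auto simp: indep_pair_def)
  interpret X: prob_space "distr M N1 X" by (rule prob_space_distr) simp
  interpret Y: prob_space "distr M N2 Y" by (rule prob_space_distr) simp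
  have eq: "distr M N1 X \<Otimes>\<^sub>M distr M N2 Y = distr M (N1 \<Otimes>\<^sub>M N2) (\<lambda>x. (X x, Y x))"
  proof (rule pair_measure_eqI)
    show "sigma_finite_measure (distr M N1 X)" "sigma_finite_measure (distr M N2 Y)"
      by unfold_locales
    fix A B assume "A \<in> sets (distr M N1 X)" "B \<in> sets (distr M N2 Y)"
    then have A: "A \<in> sets N1" and B: "B \<in> sets N2" by auto
    have "(\<lambda>x. (X x, Y x)) -` (A \<times> B) \<inter> space M = (X -` A \<inter> space M) \<inter> (Y -` B \<inter> space M)" by auto
    then show "emeasure (distr M N1 X) A * emeasure (distr M N2 Y) B
        = emeasure (distr M (N1 \<Otimes>\<^sub>M N2) (\<lambda>x. (X x, Y x))) (A \<times> B)"
      using A B ind by (simp add: emeasure_distr emeasure_eq_measure indep_pair_def ennreal_mult')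
  qed simp
  have "(\<integral>\<^sup>+\<omega>. f (X \<omega>, Y \<omega>) \<partial>M) = (\<integral>\<^sup>+z. f z \<partial>distr M (N1 \<Otimes>\<^sub>M N2) (\<lambda>x. (X x, Y x)))"
    by (subst nn_integral_distr) auto
  also have "\<dots> = (\<integral>\<^sup>+x. \<integral>\<^sup>+y. f (x, y) \<partial>distr M N2 Y \<partial>distr M N1 X)"
    by (subst eq[symmetric], subst Y.nn_integral_fst[symmetric]) auto
  also have "\<dots> = (\<integral>\<^sup>+\<omega>. \<integral>\<^sup>+y. f (X \<omega>, y) \<partial>distr M N2 Y \<partial>M)"
    by (subst nn_integral_distr) (auto intro!: Y.borel_measurable_nn_integral_fst)
  also have "\<dots> = (\<integral>\<^sup>+\<omega>. \<integral>\<^sup>+\<omega>'. f (X \<omega>, Y \<omega>') \<partial>M \<partial>M)"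
    by (intro nn_integral_cong, subst nn_integral_distr)
      (auto simp: measurable_space)
  finally show ?thesis .
qed

section \<open>Maximal displacement of a branching random walk\<close>

abbreviation mark_space :: "(nat \<times> real \<times> real) measure" where
  "mark_space \<equiv> count_space UNIV \<Otimes>\<^sub>M (borel \<Otimes>\<^sub>M borel)"

text \<open>A mark \<open>(k, s, d)\<close> of a label records its number of children, the largest displacement
  reached during its life and the displacement at its death. \<open>subtree_max m w z\<close> is the
  largest displacement, relative to the birth place of \<open>w\<close>, that is reached by \<open>w\<close> and its
  descendants of the next \<open>m\<close> generations. Because it depends on the marks through a
  recursion at the root, a bound for its law can be proved by induction on \<open>m\<close>.\<close>

primrec subtree_max :: "nat \<Rightarrow> nat list \<Rightarrow> (nat list \<Rightarrow> nat \<times> real \<times> real) \<Rightarrow> real" where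
  "subtree_max 0 w z = fst (snd (z w))"
| "subtree_max (Suc n) w z =
     Max (insert (fst (snd (z w)))
       ((\<lambda>k. snd (snd (z w)) + subtree_max n (k # w) z) ` {..<fst (z w)}))"

lemma le_subtree_max_Suc:
  "x \<le> subtree_max (Suc n) w z \<longleftrightarrow>
     x \<le> fst (snd (z w)) \<or> (\<exists>k<fst (z w). x - snd (snd (z w)) \<le> subtree_max n (k # w) z)"
  by (subst subtree_max.simps, subst Max_ge_iff) (auto simp: algebra_simps)

text \<open>The dependence on the marks of \<open>w\<close> and its descendants only is what makes the subtrees
  of siblings independent of each other and of their parent.\<close>

lemma subtree_max_cong:
  "(\<And>u. z (u @ w) = z' (u @ w)) \<Longrightarrow> subtree_max n w z = subtree_max n w z'"
proof (induction n arbitrary: w)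
  case 0
  from 0[of "[]"] show ?case by simp
next
  case (Suc n)
  have "z w = z' w" using Suc.prems[of "[]"] by simp
  moreover have "subtree_max n (k # w) z = subtree_max n (k # w) z'" for k
    using Suc.prems[of "_ @ [k]"] by (intro Suc.IH) simp
  ultimately show ?case by simp
qed

lemma subtree_max_mono_Suc: "subtree_max m w z \<le> subtree_max (Suc m) w z"
proof (induction m arbitrary: w)
  case 0
  show ?case by (subst le_subtree_max_Suc) simp
next
  case (Suc m)
  from le_subtree_max_Suc[THEN iffD1, OF order_refl, of m w z]
  consider "subtree_max (Suc m) w z \<le> fst (snd (z w))"
    | k where "k < fst (z w)" "subtree_max (Suc m) w z - snd (snd (z w)) \<le> subtree_max m (k # w) z"
    by blast
  then show ?case
  proof cases
    case 1 then show ?thesis by (subst le_subtree_max_Suc[where n="Suc m"]) simp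
  next
    case 2 then show ?thesis
      using Suc[of "k # w"] by (subst le_subtree_max_Suc[where n="Suc m"]) force
  qed
qed

primrec in_tree :: "(nat list \<Rightarrow> nat \<times> real \<times> real) \<Rightarrow> nat list \<Rightarrow> bool" where
  "in_tree z [] \<longleftrightarrow> True"
| "in_tree z (k # u) \<longleftrightarrow> in_tree z u \<and> k < fst (z u)"

primrec displacement :: "(nat list \<Rightarrow> nat \<times> real \<times> real) \<Rightarrow> nat list \<Rightarrow> real" where
  "displacement z [] = 0"
| "displacement z (k # u) = displacement z u + snd (snd (z u))"

text \<open>The recursion for \<open>subtree_max\<close> runs from the root downwards, whereas positions of
  particles are built by following a line of descent. Descending the label moves each step of
  the line of descent from the left summand into the recursion, so the depth \<open>m\<close> has to be
  general.\<close>

lemma displacement_le_subtree_max: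
  "in_tree z u \<Longrightarrow> displacement z u + subtree_max m u z \<le> subtree_max (length u + m) [] z"
proof (induction u arbitrary: m)
  case (Cons k u)
  have "snd (snd (z u)) + subtree_max m (k # u) z \<le> subtree_max (Suc m) u z"
    using Cons.prems by (subst le_subtree_max_Suc) auto
  then show ?case using Cons.IH[of "Suc m"] Cons.prems by (simp del: subtree_max.simps(2))
qed simp

text \<open>Every particle has finitely many children, so a tree of bounded height is finite.\<close>

lemma finite_in_tree:
  assumes "\<And>u. in_tree z u \<Longrightarrow> length u < h"
  shows "finite {u. in_tree z u}"
proof -
  have level: "finite {u. in_tree z u \<and> length u = l}" for l
  proof (induction l)
    case 0
    have "{u. in_tree z u \<and> length u = 0} \<subseteq> {[]}" by auto
    then show ?case by (rule finite_subset) simp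
  next
    case (Suc l)
    have "{u. in_tree z u \<and> length u = Suc l}
        \<subseteq> (\<Union>u\<in>{u. in_tree z u \<and> length u = l}. (\<lambda>k. k # u) ` {..<fst (z u)})"
      by (auto simp: length_Suc_conv)
    then show ?case by (rule finite_subset) (use Suc in auto)
  qed
  have "{u. in_tree z u} \<subseteq> (\<Union>l<h. {u. in_tree z u \<and> length u = l})" using assms by auto
  then show ?thesis by (rule finite_subset) (use level in auto)
qed

text \<open>The event of \<open>le_subtree_max_Suc\<close> in abstract form: it occurs both for one family of marks
  and for a pair consisting of the mark of the root and the maxima over the subtrees.\<close>

lemma sets_first_step:
  fixes s d :: "'a \<Rightarrow> real" and m :: "'a \<Rightarrow> nat"
  assumes [measurable]: "s \<in> borel_measurable N" "d \<in> borel_measurable N"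
    "m \<in> measurable N (count_space UNIV)" "\<And>k. U k \<in> borel_measurable N"
  shows "{z \<in> space N. x \<le> s z \<or> (\<exists>k<m z. x - d z \<le> U k z)} \<in> sets N"
  by measurable

lemma measurable_subtree_max:
  "range (\<lambda>u. u @ w) \<subseteq> J \<Longrightarrow> subtree_max n w \<in> borel_measurable (PiM J (\<lambda>_. mark_space))"
proof (induction n arbitrary: w)
  case 0
  have "w \<in> J" using 0 by (metis append_Nil rangeI subsetD)
  then show ?case by simp
next
  case (Suc n)
  have w[measurable]: "w \<in> J" using Suc.prems by (metis append_Nil rangeI subsetD)
  have zw: "(\<lambda>z. z w) \<in> measurable (PiM J (\<lambda>_. mark_space)) mark_space"
    by (rule measurable_component_singleton[OF w])
  have [measurable]: "(\<lambda>z. fst (snd (z w))) \<in> borel_measurable (PiM J (\<lambda>_. mark_space))"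
    "(\<lambda>z. snd (snd (z w))) \<in> borel_measurable (PiM J (\<lambda>_. mark_space))"
    "(\<lambda>z. fst (z w)) \<in> measurable (PiM J (\<lambda>_. mark_space)) (count_space UNIV)"
    by (rule measurable_compose[OF zw], measurable)+
  have [measurable]: "subtree_max n (k # w) \<in> borel_measurable (PiM J (\<lambda>_. mark_space))" for k
  proof (rule Suc.IH)
    show "range (\<lambda>u. u @ k # w) \<subseteq> J"
      using Suc.prems by (auto simp: image_subset_iff) (metis append.assoc append_Cons append_Nil)
  qed
  have "{z \<in> space (PiM J (\<lambda>_. mark_space)). x \<le> fst (snd (z w)) \<or>
      (\<exists>k<fst (z w). x - snd (snd (z w)) \<le> subtree_max n (k # w) z)}
      \<in> sets (PiM J (\<lambda>_. mark_space))" for x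
    by (rule sets_first_step) measurable
  then show ?case
    unfolding borel_measurable_iff_ge le_subtree_max_Suc by blast
qed

lemma one_minus_le_prod:
  fixes p :: "nat \<Rightarrow> real"
  assumes "\<And>k. k < (m::nat) \<Longrightarrow> p k \<le> q" "0 \<le> q" "q \<le> 1"
  shows "(1 - q) ^ m \<le> (\<Prod>k<m. 1 - p k)"
proof -
  have "(1 - q) ^ m = (\<Prod>k<m. 1 - q)" by simp
  also have "\<dots> \<le> (\<Prod>k<m. 1 - p k)"
    using assms by (intro prod_mono conjI diff_left_mono) auto
  finally show ?thesis .
qed

text \<open>The subtrees of the children are independent, and each stays below the level with
  probability at least \<open>1 - q\<close>; hence all \<open>m\<close> of them do so with probability at least
  \<open>(1 - q) ^ m\<close>.\<close>

lemma (in prob_space) prob_some_child_ge_le: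
  fixes U :: "nat \<Rightarrow> 'a \<Rightarrow> real"
  assumes ind: "indep_vars (\<lambda>_. borel) U UNIV"
    and le: "\<And>k. prob {\<omega>\<in>space M. y \<le> U k \<omega>} \<le> q" and q: "0 \<le> q" "q \<le> 1"
  shows "prob {\<omega>\<in>space M. \<exists>k<m. y \<le> U k \<omega>} \<le> 1 - (1 - q) ^ m"
proof -
  have [measurable]: "U k \<in> borel_measurable M" for k
    using ind by (auto simp: indep_vars_def)
  have p: "prob (U k -` {..<y} \<inter> space M) = 1 - prob {\<omega>\<in>space M. y \<le> U k \<omega>}" for k
    by (subst prob_compl[symmetric]) (auto intro!: arg_cong[where f=prob])
  have "(1 - q) ^ m \<le> (\<Prod>k<m. 1 - prob {\<omega>\<in>space M. y \<le> U k \<omega>})"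
    by (rule one_minus_le_prod) (use le q in auto)
  also have "\<dots> = prob {\<omega>\<in>space M. \<not> (\<exists>k<m. y \<le> U k \<omega>)}"
  proof (cases "m = 0")
    case True then show ?thesis by (simp add: prob_space)
  next
    case False
    have "prob (\<Inter>k\<in>{..<m}. U k -` {..<y} \<inter> space M) = (\<Prod>k<m. prob (U k -` {..<y} \<inter> space M))"
      by (rule indep_varsD[OF ind]) (use False in auto)
    also have "(\<Inter>k\<in>{..<m}. U k -` {..<y} \<inter> space M) = {\<omega>\<in>space M. \<not> (\<exists>k<m. y \<le> U k \<omega>)}"
      using False by (auto simp: not_le)
    finally show ?thesis by (simp add: p)
  qed
  also have "\<dots> = 1 - prob {\<omega>\<in>space M. \<exists>k<m. y \<le> U k \<omega>}"
    by (subst prob_compl[symmetric]) (auto intro!: arg_cong[where f=prob])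
  finally show ?thesis by simp
qed

text \<open>Comparison principle. Write \<open>q\<^sub>m(x)\<close> for the probability that \<open>subtree_max m\<close> is at least \<open>x\<close>.
  Looking at the root, a tree of depth \<open>m + 1\<close> reaches \<open>x\<close> only if the root does so itself, or
  if one of the subtrees of its children reaches \<open>x - D\<close>. Given the root, the second event
  has probability at most \<open>1 - (1 - q)\<^sup>K\<close> for any upper bound \<open>q\<close> of \<open>q\<^sub>m(x - D)\<close> that is
  common to the children, and averaging over the offspring
  number \<open>K\<close> turns this into \<open>g q\<close>. A function \<open>v\<close> with
  \<open>P(S \<ge> x) + E (g (v (x - D))) \<le> v x\<close> wherever the bound is not trivial therefore
  dominates \<open>q\<^sub>m\<close> for every \<open>m\<close>, by induction. The induction has to run over all labels
  \<open>w\<close> at once, since its step compares \<open>w\<close> with its children.\<close>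

theorem (in prob_space) subtree_max_tail_le:
  fixes Z :: "nat list \<Rightarrow> 'a \<Rightarrow> nat \<times> real \<times> real" and g v :: "real \<Rightarrow> real"
  assumes ind: "indep_vars (\<lambda>_. mark_space) Z UNIV"
    and own: "\<And>u. indep_pair (borel \<Otimes>\<^sub>M borel) (\<lambda>\<omega>. snd (Z u \<omega>))
                  (count_space UNIV) (\<lambda>\<omega>. fst (Z u \<omega>))"
    and gf: "\<And>u q. 0 \<le> q \<Longrightarrow> q \<le> 1 \<Longrightarrow> expectation (\<lambda>\<omega>. (1 - q) ^ fst (Z u \<omega>)) = 1 - g q"
    and g[measurable]: "g \<in> borel_measurable borel"
    and v[measurable]: "v \<in> borel_measurable borel" and v01: "\<And>x. 0 \<le> v x" "\<And>x. v x \<le> 1"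
    and super: "\<And>u x. v x < 1 \<Longrightarrow>
        prob {\<omega>\<in>space M. x \<le> fst (snd (Z u \<omega>))}
          + expectation (\<lambda>\<omega>. g (v (x - snd (snd (Z u \<omega>))))) \<le> v x"
  shows "prob {\<omega>\<in>space M. x \<le> subtree_max n w (\<lambda>u. Z u \<omega>)} \<le> v x"
proof (induction n arbitrary: w x)
  have Z[measurable]: "Z u \<in> measurable M mark_space" for u
    using ind by (auto simp: indep_vars_def)
  have g01: "0 \<le> g q \<and> g q \<le> 1" if "0 \<le> q" "q \<le> 1" for q
  proof -
    have "0 \<le> expectation (\<lambda>\<omega>. (1 - q) ^ fst (Z [] \<omega>))"
      using that by (intro Bochner_Integration.integral_nonneg) auto
    moreover have "expectation (\<lambda>\<omega>. (1 - q) ^ fst (Z [] \<omega>)) \<le> 1"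
      using that by (intro integral_le_const integrable_const_bound[where B=1])
        (auto simp: power_abs intro!: power_le_one)
    ultimately show ?thesis using gf[OF that, of "[]"] by auto
  qed
  have gi: "0 \<le> expectation (\<lambda>\<omega>. g (v (x - snd (snd (Z u \<omega>)))))" for x u
    using v01 g01 by (intro Bochner_Integration.integral_nonneg) auto
  {
    case 0
    show ?case
    proof (cases "v x < 1")
      case True
      from super[OF True, of w] gi[of x w] show ?thesis by simp
    next
      case False
      then show ?thesis using v01(2)[of x] by (intro order_trans[OF prob_le_1]) simp
    qed
  next
    case (Suc n)
    let ?S = "\<lambda>\<omega>. fst (snd (Z w \<omega>))" and ?D = "\<lambda>\<omega>. snd (snd (Z w \<omega>))" and ?K = "\<lambda>\<omega>. fst (Z w \<omega>)"
    define U where "U = (\<lambda>k \<omega>. subtree_max n (k # w) (\<lambda>u. Z u \<omega>))"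
    define B where "B = (\<lambda>k. range (\<lambda>u. u @ k # w))"
    have UB: "U k \<omega> = subtree_max n (k # w) (\<lambda>u\<in>J. Z u \<omega>)" if "B k \<subseteq> J" for k \<omega> J
      unfolding U_def using that by (intro subtree_max_cong) (auto simp: B_def)
    \<comment> \<open>The subtrees of two siblings carry disjoint sets of labels.\<close>
    have indU: "indep_vars (\<lambda>_. borel) U UNIV"
    proof -
      have "indep_vars (\<lambda>k. PiM (B k) (\<lambda>_. mark_space)) (\<lambda>k \<omega>. \<lambda>u\<in>B k. Z u \<omega>) UNIV"
        by (rule indep_vars_restrict[OF ind]) (auto simp: disjoint_family_on_def B_def)
      then have "indep_vars (\<lambda>_. borel) (\<lambda>k \<omega>. subtree_max n (k # w) (\<lambda>u\<in>B k. Z u \<omega>)) UNIV"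
        by (rule indep_vars_compose2) (auto intro!: measurable_subtree_max simp: B_def)
      also have "(\<lambda>k \<omega>. subtree_max n (k # w) (\<lambda>u\<in>B k. Z u \<omega>)) = U"
        by (intro ext UB[symmetric]) simp
      finally show ?thesis .
    qed
    have [measurable]: "U k \<in> borel_measurable M" for k
      using indU by (auto simp: indep_vars_def)
    \<comment> \<open>The mark of the root is independent of all the subtrees below it jointly.\<close>
    have indZU: "indep_pair mark_space (Z w) (PiM UNIV (\<lambda>_. borel)) (\<lambda>\<omega> k. U k \<omega>)"
    proof -
      let ?J = "\<Union>k. B k"
      have w: "w \<notin> ?J" by (auto simp: B_def)
      have "indep_var (PiM {w} (\<lambda>_. mark_space)) (\<lambda>\<omega>. \<lambda>u\<in>{w}. Z u \<omega>)
                      (PiM ?J (\<lambda>_. mark_space)) (\<lambda>\<omega>. \<lambda>u\<in>?J. Z u \<omega>)"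
        by (rule indep_var_restrict[OF ind]) (use w in auto)
      note step = indep_pair_compose[OF indep_pair_of_indep_var[OF this],
          where f="\<lambda>z. z w" and h="\<lambda>z k. subtree_max n (k # w) z"]
      have "indep_pair mark_space (\<lambda>\<omega>. (\<lambda>z. z w) (\<lambda>u\<in>{w}. Z u \<omega>))
          (PiM UNIV (\<lambda>_. borel)) (\<lambda>\<omega>. (\<lambda>z k. subtree_max n (k # w) z) (\<lambda>u\<in>?J. Z u \<omega>))"
        by (intro step measurable_PiM_single')
          (auto simp: B_def intro!: measurable_subtree_max)
      moreover have "(\<lambda>\<omega>. (\<lambda>z k. subtree_max n (k # w) z) (\<lambda>u\<in>?J. Z u \<omega>)) = (\<lambda>\<omega> k. U k \<omega>)"
        by (intro ext UB[symmetric]) auto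
      ultimately show ?thesis by simp
    qed
    show ?case
    proof (cases "v x < 1")
      case False
      then show ?thesis using v01(2)[of x] by (intro order_trans[OF prob_le_1]) simp
    next
      case True
      \<comment> \<open>\<open>Q\<close> is the event of \<open>le_subtree_max_Suc\<close> as a set of pairs: mark of the root, maxima over the subtrees.\<close>
      define Q where "Q = {z \<in> space (mark_space \<Otimes>\<^sub>M PiM UNIV (\<lambda>_. borel)).
          x \<le> fst (snd (fst z)) \<or> (\<exists>k<fst (fst z). x - snd (snd (fst z)) \<le> snd z k)}"
      have [measurable]: "Q \<in> sets (mark_space \<Otimes>\<^sub>M PiM UNIV (\<lambda>_. borel))"
        unfolding Q_def
        by (rule sets_first_step)
          ((measurable)[3], auto intro: measurable_compose[OF measurable_snd measurable_component_singleton])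
      have "ennreal (prob {\<omega>\<in>space M. x \<le> subtree_max (Suc n) w (\<lambda>u. Z u \<omega>)})
          = (\<integral>\<^sup>+\<omega>. indicator Q (Z w \<omega>, (\<lambda>k. U k \<omega>)) \<partial>M)"
      proof -
        have e1: "{\<omega>\<in>space M. x \<le> subtree_max (Suc n) w (\<lambda>u. Z u \<omega>)}
            = (\<lambda>\<omega>. (Z w \<omega>, (\<lambda>k. U k \<omega>))) -` Q \<inter> space M"
          unfolding le_subtree_max_Suc Q_def U_def by (auto simp: space_pair_measure space_PiM)
        have "(\<lambda>\<omega>. (Z w \<omega>, (\<lambda>k. U k \<omega>))) \<in> measurable M (mark_space \<Otimes>\<^sub>M PiM UNIV (\<lambda>_. borel))"
          by (intro measurable_Pair Z measurable_PiM_single') auto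
        then have "(\<lambda>\<omega>. (Z w \<omega>, (\<lambda>k. U k \<omega>))) -` Q \<inter> space M \<in> sets M"
          by (rule measurable_sets) simp
        then have "emeasure M ((\<lambda>\<omega>. (Z w \<omega>, (\<lambda>k. U k \<omega>))) -` Q \<inter> space M)
            = (\<integral>\<^sup>+\<omega>. indicator ((\<lambda>\<omega>. (Z w \<omega>, (\<lambda>k. U k \<omega>))) -` Q \<inter> space M) \<omega> \<partial>M)"
          by simp
        also have "\<dots> = (\<integral>\<^sup>+\<omega>. indicator Q (Z w \<omega>, (\<lambda>k. U k \<omega>)) \<partial>M)"
          by (intro nn_integral_cong) (auto simp: indicator_def)
        finally show ?thesis
          unfolding e1 by (simp only: emeasure_eq_measure)
      qed
      also have "\<dots> = (\<integral>\<^sup>+\<omega>. \<integral>\<^sup>+\<omega>'. indicator Q (Z w \<omega>, (\<lambda>k. U k \<omega>')) \<partial>M \<partial>M)"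
        by (rule nn_integral_indep_pair[OF indZU]) measurable
      also have "\<dots> \<le> (\<integral>\<^sup>+\<omega>. indicator {\<omega>\<in>space M. x \<le> ?S \<omega>} \<omega>
                          + ennreal (1 - (1 - v (x - ?D \<omega>)) ^ ?K \<omega>) \<partial>M)"
      proof (rule nn_integral_mono)
        fix \<omega> assume \<omega>: "\<omega> \<in> space M"
        show "(\<integral>\<^sup>+\<omega>'. indicator Q (Z w \<omega>, (\<lambda>k. U k \<omega>')) \<partial>M) \<le>
           indicator {\<omega>\<in>space M. x \<le> ?S \<omega>} \<omega> + ennreal (1 - (1 - v (x - ?D \<omega>)) ^ ?K \<omega>)"
        proof (cases "x \<le> ?S \<omega>")
          case True
          have "(\<integral>\<^sup>+\<omega>'. indicator Q (Z w \<omega>, (\<lambda>k. U k \<omega>')) \<partial>M) \<le> (\<integral>\<^sup>+\<omega>'. 1 \<partial>M)"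
            by (intro nn_integral_mono) (auto simp: indicator_def)
          also have "\<dots> = 1" by (simp add: emeasure_space_1)
          also have "1 \<le> indicator {\<omega>\<in>space M. x \<le> ?S \<omega>} \<omega> + ennreal (1 - (1 - v (x - ?D \<omega>)) ^ ?K \<omega>)"
            using \<omega> True by simp
          finally show ?thesis .
        next
          case False
          have "(\<integral>\<^sup>+\<omega>'. indicator Q (Z w \<omega>, (\<lambda>k. U k \<omega>')) \<partial>M)
              = (\<integral>\<^sup>+\<omega>'. indicator {\<omega>'\<in>space M. \<exists>k<?K \<omega>. x - ?D \<omega> \<le> U k \<omega>'} \<omega>' \<partial>M)"
            using False by (intro nn_integral_cong)
              (auto simp: indicator_def Q_def space_pair_measure space_PiM)
          also have "\<dots> = prob {\<omega>'\<in>space M. \<exists>k<?K \<omega>. x - ?D \<omega> \<le> U k \<omega>'}"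
            by (subst nn_integral_indicator) (auto simp: emeasure_eq_measure)
          also have "\<dots> \<le> ennreal (1 - (1 - v (x - ?D \<omega>)) ^ ?K \<omega>)"
            using Suc.IH v01 by (intro ennreal_leI prob_some_child_ge_le indU) (auto simp: U_def)
          finally show ?thesis by (simp add: add_increasing)
        qed
      qed
      also have "\<dots> = (\<integral>\<^sup>+\<omega>. indicator {\<omega>\<in>space M. x \<le> ?S \<omega>} \<omega> \<partial>M)
                    + (\<integral>\<^sup>+\<omega>. ennreal (1 - (1 - v (x - ?D \<omega>)) ^ ?K \<omega>) \<partial>M)"
        by (rule nn_integral_add) measurable
      also have "(\<integral>\<^sup>+\<omega>. indicator {\<omega>\<in>space M. x \<le> ?S \<omega>} \<omega> \<partial>M) = prob {\<omega>\<in>space M. x \<le> ?S \<omega>}"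
        by (subst nn_integral_indicator) (auto simp: emeasure_eq_measure)
      also have "(\<integral>\<^sup>+\<omega>. ennreal (1 - (1 - v (x - ?D \<omega>)) ^ ?K \<omega>) \<partial>M)
          = expectation (\<lambda>\<omega>. g (v (x - ?D \<omega>)))"
      proof -
        have "(\<integral>\<^sup>+\<omega>. ennreal (1 - (1 - v (x - ?D \<omega>)) ^ ?K \<omega>) \<partial>M)
            = (\<integral>\<^sup>+\<omega>. (case (snd (Z w \<omega>), ?K \<omega>) of ((s, d), k) \<Rightarrow> ennreal (1 - (1 - v (x - d)) ^ k)) \<partial>M)"
          by (intro nn_integral_cong) (simp split: prod.split)
        also have "\<dots> = (\<integral>\<^sup>+\<omega>. \<integral>\<^sup>+\<omega>'. (case (snd (Z w \<omega>), ?K \<omega>') of ((s, d), k) \<Rightarrow>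
              ennreal (1 - (1 - v (x - d)) ^ k)) \<partial>M \<partial>M)"
          by (rule nn_integral_indep_pair[OF own]) measurable
        also have "\<dots> = (\<integral>\<^sup>+\<omega>. \<integral>\<^sup>+\<omega>'. ennreal (1 - (1 - v (x - ?D \<omega>)) ^ ?K \<omega>') \<partial>M \<partial>M)"
          by (intro nn_integral_cong) (simp split: prod.split)
        also have "\<dots> = (\<integral>\<^sup>+\<omega>. ennreal (g (v (x - ?D \<omega>))) \<partial>M)"
        proof (rule nn_integral_cong)
          fix \<omega>
          let ?q = "v (x - ?D \<omega>)"
          have q: "0 \<le> ?q" "?q \<le> 1" using v01 by auto
          have i: "integrable M (\<lambda>\<omega>'. (1 - ?q) ^ ?K \<omega>')"
            using q by (intro integrable_const_bound[where B=1]) (auto simp: power_abs intro!: power_le_one)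
          have "(\<integral>\<^sup>+\<omega>'. ennreal (1 - (1 - ?q) ^ ?K \<omega>') \<partial>M) = expectation (\<lambda>\<omega>'. 1 - (1 - ?q) ^ ?K \<omega>')"
            using i q by (intro nn_integral_eq_integral) (auto intro!: power_le_one)
          also have "\<dots> = g ?q" using i gf[OF q, of w] by (simp add: prob_space)
          finally show "(\<integral>\<^sup>+\<omega>'. ennreal (1 - (1 - ?q) ^ ?K \<omega>') \<partial>M) = ennreal (g ?q)" .
        qed
        also have "\<dots> = expectation (\<lambda>\<omega>. g (v (x - ?D \<omega>)))"
          using g01 v01 by (intro nn_integral_eq_integral integrable_const_bound[where B=1]) auto
        finally show ?thesis .
      qed
      also have "ennreal (prob {\<omega>\<in>space M. x \<le> ?S \<omega>}) + ennreal (expectation (\<lambda>\<omega>. g (v (x - ?D \<omega>))))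
          = ennreal (prob {\<omega>\<in>space M. x \<le> ?S \<omega>} + expectation (\<lambda>\<omega>. g (v (x - ?D \<omega>))))"
        using gi by (subst ennreal_plus) auto
      also have "\<dots> \<le> ennreal (v x)"
        by (rule ennreal_leI) (rule super[OF True])
      finally show ?thesis using v01 by (simp add: ennreal_le_iff)
    qed
  }
qed

text \<open>Bounds for every finite depth pass to the whole tree because the maxima increase with the
  depth.\<close>

lemma (in prob_space) prob_some_depth_le:
  fixes U :: "nat \<Rightarrow> 'a \<Rightarrow> real"
  assumes [measurable]: "\<And>m. U m \<in> borel_measurable M"
    and mono: "\<And>m \<omega>. U m \<omega> \<le> U (Suc m) \<omega>"
    and le: "\<And>m. prob {\<omega>\<in>space M. x \<le> U m \<omega>} \<le> q"
  shows "prob {\<omega>\<in>space M. \<exists>m. x \<le> U m \<omega>} \<le> q"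
proof -
  let ?E = "\<lambda>m. {\<omega>\<in>space M. x \<le> U m \<omega>}"
  have "incseq ?E"
    using mono by (intro incseq_SucI) (auto intro: order_trans)
  then have "(\<lambda>m. prob (?E m)) \<longlonglongrightarrow> prob (\<Union>m. ?E m)"
    by (intro finite_Lim_measure_incseq) auto
  moreover have "(\<Union>m. ?E m) = {\<omega>\<in>space M. \<exists>m. x \<le> U m \<omega>}" by auto
  ultimately show ?thesis using le by (intro LIMSEQ_le_const2) auto
qed

section \<open>The critical offspring law\<close>

text \<open>If every child is marked independently with probability \<open>q\<close>, this is the probability that
  some child is marked: one minus the offspring generating function at \<open>1 - q\<close>.\<close>

definition some_child_prob :: "real \<Rightarrow> real \<Rightarrow> real" where
  "some_child_prob \<beta> q = q - q powr (1 + \<beta>) / (1 + \<beta>)"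

lemma some_child_prob_measurable [measurable]: "some_child_prob \<beta> \<in> borel_measurable borel"
  unfolding some_child_prob_def by measurable

lemma some_child_prob_bounds:
  assumes "0 < \<beta>" "0 \<le> q" "q \<le> 1"
  shows "0 \<le> some_child_prob \<beta> q" "some_child_prob \<beta> q \<le> q"
proof -
  have "q powr (1 + \<beta>) \<le> q powr 1"
    using assms by (intro powr_mono') auto
  then have "q powr (1 + \<beta>) \<le> q" using assms by simp
  moreover have "q powr (1 + \<beta>) / (1 + \<beta>) \<le> q powr (1 + \<beta>) / 1"
    using assms by (intro divide_left_mono) auto
  ultimately show "0 \<le> some_child_prob \<beta> q" by (simp add: some_child_prob_def)
  show "some_child_prob \<beta> q \<le> q" using assms by (simp add: some_child_prob_def)
qed

text \<open>The generating function is prescribed on the open interval. The value at \<open>q = 1\<close>, which is the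
  probability of having no children, follows by dominated convergence.\<close>

lemma (in prob_space) expectation_thinning:
  assumes [measurable]: "K \<in> measurable M (count_space UNIV)" and \<beta>: "0 < \<beta>"
    and gf: "\<And>s. 0 < s \<Longrightarrow> s < 1 \<Longrightarrow>
        expectation (\<lambda>\<omega>. s ^ K \<omega>) = s + 1 / (1 + \<beta>) * (1 - s) powr (1 + \<beta>)"
    and q: "0 \<le> q" "q \<le> 1"
  shows "expectation (\<lambda>\<omega>. (1 - q) ^ K \<omega>) = 1 - some_child_prob \<beta> q"
proof -
  consider "q = 0" | "0 < q" "q < 1" | "q = 1" using q by linarith
  then show ?thesis
  proof cases
    case 1 then show ?thesis by (simp add: some_child_prob_def prob_space)
  next
    case 2 then show ?thesis using gf[of "1 - q"] by (simp add: some_child_prob_def)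
  next
    case 3
    let ?s = "\<lambda>m::nat. 1 / (real m + 2)"
    have s0: "?s \<longlonglongrightarrow> 0" by real_asymp
    have "(\<lambda>m. expectation (\<lambda>\<omega>. ?s m ^ K \<omega>)) \<longlonglongrightarrow> expectation (\<lambda>\<omega>. (0::real) ^ K \<omega>)"
    proof (rule integral_dominated_convergence[where w="\<lambda>_. 1"])
      show "AE \<omega> in M. (\<lambda>m. ?s m ^ K \<omega>) \<longlonglongrightarrow> 0 ^ K \<omega>"
        by (intro AE_I2 tendsto_power s0)
      show "AE \<omega> in M. norm (?s m ^ K \<omega>) \<le> 1" for m
        by (intro AE_I2) (auto simp: power_abs intro!: power_le_one)
    qed auto
    moreover have "(\<lambda>m. expectation (\<lambda>\<omega>. ?s m ^ K \<omega>)) \<longlonglongrightarrow> 0 + 1 / (1 + \<beta>) * (1 - 0) powr (1 + \<beta>)"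
    proof -
      have "(\<lambda>m. ?s m + 1 / (1 + \<beta>) * (1 - ?s m) powr (1 + \<beta>)) \<longlonglongrightarrow> 0 + 1 / (1 + \<beta>) * (1 - 0) powr (1 + \<beta>)"
        by (intro tendsto_intros s0) auto
      then show ?thesis by (subst gf) auto
    qed
    ultimately have "expectation (\<lambda>\<omega>. (0::real) ^ K \<omega>) = 1 / (1 + \<beta>)"
      using LIMSEQ_unique by fastforce
    then show ?thesis using 3 by (simp add: some_child_prob_def)
  qed
qed

text \<open>A family reaches generation \<open>n + 1\<close> if one of the children of its founder has a family that
  reaches generation \<open>n\<close>; so this is the probability of reaching generation \<open>n\<close>.\<close>

primrec survival_bound :: "real \<Rightarrow> nat \<Rightarrow> real" where
  "survival_bound \<beta> 0 = 1"
| "survival_bound \<beta> (Suc n) = some_child_prob \<beta> (survival_bound \<beta> n)"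

lemma survival_bound_01:
  assumes "0 < \<beta>"
  shows "0 \<le> survival_bound \<beta> n \<and> survival_bound \<beta> n \<le> 1"
proof (induction n)
  case (Suc n)
  then show ?case using some_child_prob_bounds[OF assms, of "survival_bound \<beta> n"] by auto
qed simp

text \<open>The sequence decreases to a fixed point of \<open>some_child_prob\<close>, and 0 is the only one: this is
  where criticality of the branching enters.\<close>

lemma survival_bound_tendsto_0:
  assumes \<beta>: "0 < \<beta>"
  shows "survival_bound \<beta> \<longlonglongrightarrow> 0"
proof -
  have "decseq (survival_bound \<beta>)"
    using some_child_prob_bounds(2)[OF \<beta>] survival_bound_01[OF \<beta>] by (intro decseq_SucI) simp
  moreover have "bdd_below (range (survival_bound \<beta>))"
    using survival_bound_01[OF \<beta>] by (intro bdd_belowI[of _ 0]) auto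
  ultimately obtain L where L: "survival_bound \<beta> \<longlonglongrightarrow> L"
    using decseq_convergent[of "survival_bound \<beta>" 0] survival_bound_01[OF \<beta>] by metis
  have "0 \<le> L" using L survival_bound_01[OF \<beta>] by (intro LIMSEQ_le_const) auto
  have "(\<lambda>n. some_child_prob \<beta> (survival_bound \<beta> n)) \<longlonglongrightarrow> some_child_prob \<beta> L"
    unfolding some_child_prob_def using \<beta> \<open>0 \<le> L\<close> survival_bound_01[OF \<beta>]
    by (intro tendsto_intros L tendsto_powr') (auto)
  moreover have "(\<lambda>n. some_child_prob \<beta> (survival_bound \<beta> n)) \<longlonglongrightarrow> L"
    using LIMSEQ_Suc[OF L] by simp
  ultimately have "L = some_child_prob \<beta> L" using LIMSEQ_unique by blast
  then have "L powr (1 + \<beta>) = 0" using \<beta> by (simp add: some_child_prob_def)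
  then show ?thesis using L by simp
qed

section \<open>A power-law supersolution\<close>

text \<open>The power \<open>(x / a) powr (- p)\<close>, cut off at 1 so that it bounds probabilities trivially for
  \<open>x \<le> a\<close>.\<close>

definition power_tail :: "real \<Rightarrow> real \<Rightarrow> real \<Rightarrow> real" where
  "power_tail p a x = max 1 (x / a) powr (- p)"

lemma power_tail_measurable [measurable]: "power_tail p a \<in> borel_measurable borel"
  unfolding power_tail_def by measurable

lemma power_tail_pos: "0 < power_tail p a x"
  by (auto simp: power_tail_def max_def)

lemma power_tail_le_1: "0 \<le> p \<Longrightarrow> power_tail p a x \<le> 1"
  unfolding power_tail_def using powr_mono2'[of "- p" 1 "max 1 (x / a)"] by simp

lemma power_tail_antimono: "0 \<le> p \<Longrightarrow> 0 < a \<Longrightarrow> x \<le> y \<Longrightarrow> power_tail p a y \<le> power_tail p a x"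
  unfolding power_tail_def by (intro powr_mono2' max.mono divide_right_mono) auto

text \<open>A second-order Taylor bound. It holds on the whole half-line \<open>z \<le> 1 / 2\<close> because the second
  derivative of \<open>(1 - z) powr (- p)\<close> is largest at the right end point; the half-line is needed
  since the displacements to which it is applied are unbounded below.\<close>

lemma one_minus_powr_le_quadratic:
  fixes p z :: real
  assumes p: "0 < p" and z: "z \<le> 1 / 2"
  shows "(1 - z) powr (- p) \<le> 1 + p * z + p * (p + 1) * 2 powr (p + 2) * z\<^sup>2"
proof (cases "z = 0")
  case True then show ?thesis by simp
next
  case False
  define diff where "diff = (\<lambda>(m::nat) t. if m = 0 then (1 - t) powr (- p)
     else if m = 1 then p * (1 - t) powr (- p - 1) else p * (p + 1) * (1 - t) powr (- p - 2 :: real))"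
  have "\<exists>t. (if z < 0 then z < t \<and> t < 0 else 0 < t \<and> t < z) \<and>
      (1 - z) powr (- p) = (\<Sum>m<2. diff m 0 / fact m * (z - 0) ^ m) + diff 2 t / fact 2 * (z - 0) ^ 2"
  proof (rule Taylor[where a = "min z 0" and b = "1/2" and diff = diff])
    show "\<forall>m t. m < 2 \<and> min z 0 \<le> t \<and> t \<le> 1 / 2 \<longrightarrow> DERIV (diff m) t :> diff (Suc m) t"
    proof (intro allI impI)
      fix m t assume *: "m < (2::nat) \<and> min z 0 \<le> t \<and> t \<le> (1/2::real)"
      then consider "m = 0" | "m = 1" by linarith
      then show "DERIV (diff m) t :> diff (Suc m) t"
      proof cases
        case 1
        have "((\<lambda>t. (1 - t) powr (- p)) has_real_derivative p * (1 - t) powr (- p - 1)) (at t)"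
          using * by (auto intro!: derivative_eq_intros)
        then show ?thesis using 1 by (simp add: diff_def)
      next
        case 2
        have "((\<lambda>t. p * (1 - t) powr (- p - 1)) has_real_derivative
            p * (p + 1) * (1 - t) powr (- p - 2)) (at t)"
          using * by (auto intro!: derivative_eq_intros simp: algebra_simps)
        then show ?thesis using 2 by (simp add: diff_def)
      qed
    qed
  qed (use z False in \<open>auto simp: diff_def\<close>)
  then obtain t where t: "if z < 0 then z < t \<and> t < 0 else 0 < t \<and> t < z"
    and eq: "(1 - z) powr (- p) = 1 + p * z + p * (p + 1) * (1 - t) powr (- p - 2) / 2 * z\<^sup>2"
    by (auto simp: diff_def lessThan_nat_numeral lessThan_Suc numeral_2_eq_2)
  have t2: "t \<le> 1 / 2" using t z by (auto split: if_splits)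
  have "(1 - t) powr (- p - 2) \<le> (1 / 2) powr (- p - 2)"
    using p t2 by (intro powr_mono2') auto
  also have "\<dots> = 2 powr (p + 2)"
    by (simp add: powr_minus powr_divide[of 1 2, simplified] field_simps powr_diff powr_add)
  finally have "(1 - t) powr (- p - 2) / 2 \<le> 2 powr (p + 2)"
    by (rule order_trans[rotated]) (simp add: divide_le_eq)
  then have "p * (p + 1) * ((1 - t) powr (- p - 2) / 2) * z\<^sup>2 \<le> p * (p + 1) * 2 powr (p + 2) * z\<^sup>2"
    using p by (intro mult_right_mono mult_left_mono) auto
  then show ?thesis unfolding eq by simp
qed

text \<open>For \<open>p = 2 / \<beta>\<close> the function \<open>v = power_tail p a\<close> satisfies the hypothesis of the
  comparison principle once the scale \<open>a\<close> is large. Since \<open>D\<close> has mean 0 and finite second moment,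
  a Taylor expansion gives \<open>E (v (x - D)) \<le> v x * (1 + const / x\<^sup>2)\<close>; the event
  \<open>D \<ge> x / 2\<close>, where the expansion fails, and the event \<open>S \<ge> x\<close> cost no more than
  \<open>const * v x / x\<^sup>2\<close> by the tail assumptions. Against this, the nonlinear term of
  \<open>some_child_prob\<close> gains a multiple of \<open>(v x) powr (1 + \<beta>) = v x * a\<^sup>2 / x\<^sup>2\<close>. Both are of order
  \<open>v x / x\<^sup>2\<close>, which is the reason for the exponent \<open>2 / \<beta>\<close>, but only the gain grows with \<open>a\<close>.
  The same balance makes a multiple of \<open>x powr (- 2 / \<beta>)\<close> solve \<open>u'' = u powr (1 + \<beta>)\<close>.\<close>

lemma (in prob_space) power_tail_supersolution:
  fixes S D :: "'a \<Rightarrow> real"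
  assumes \<beta>: "0 < \<beta>" and p_def: "p = 2 / \<beta>" and c: "0 \<le> c"
    and [measurable]: "D \<in> borel_measurable M"
    and D2: "integrable M (\<lambda>\<omega>. (D \<omega>)\<^sup>2)" "expectation (\<lambda>\<omega>. (D \<omega>)\<^sup>2) \<le> c"
    and D1: "integrable M D" "expectation D = 0"
    and Dpos: "1 / 2 \<le> prob {\<omega>\<in>space M. 0 \<le> D \<omega>}"
    and Stail: "\<And>x. 0 < x \<Longrightarrow> prob {\<omega>\<in>space M. x \<le> S \<omega>} \<le> c * x powr (- p - 2)"
    and Dtail: "\<And>x. 0 < x \<Longrightarrow> prob {\<omega>\<in>space M. x \<le> D \<omega>} \<le> c * x powr (- p - 2)"
    and a: "1 \<le> a" "2 * (1 + \<beta>) * c * (p * (p + 1) * 2 powr (p + 2) + 2 powr (p + 2) + 1) \<le> a\<^sup>2"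
    and x: "power_tail p a x < 1"
  shows "prob {\<omega>\<in>space M. x \<le> S \<omega>}
     + expectation (\<lambda>\<omega>. some_child_prob \<beta> (power_tail p a (x - D \<omega>))) \<le> power_tail p a x"
proof -
  have p: "0 < p" using \<beta> p_def by simp
  let ?v = "power_tail p a"
  define C where "C = p * (p + 1) * 2 powr (p + 2)"
  have C: "0 \<le> C" using p by (simp add: C_def)
  \<comment> \<open>This makes the quadratic below nonnegative on the whole line.\<close>
  have C4: "p\<^sup>2 / 4 \<le> C"
  proof -
    have "4 = 2 powr (2::real)" by simp
    also have "\<dots> \<le> 2 powr (p + 2)" using p by (intro powr_mono) auto
    finally have "p * (p + 1) * 4 \<le> C" unfolding C_def using p by (intro mult_left_mono) auto
    moreover have "p\<^sup>2 \<le> p * (p + 1)" using p by (simp add: power2_eq_square algebra_simps)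
    moreover have "0 \<le> p * (p + 1)" using p by simp
    ultimately show ?thesis by linarith
  qed
  have xa: "a < x"
  proof (rule ccontr)
    assume "\<not> a < x"
    then have "x / a \<le> 1" using a by (simp add: divide_le_eq)
    then have "max 1 (x / a) = 1" by simp
    then show False using x by (simp add: power_tail_def)
  qed
  have x0: "1 < x" "0 < a" using xa a by auto
  have vx: "?v x = (x / a) powr (- p)"
    using xa x0 by (auto simp: power_tail_def max_def)
  have v01: "0 \<le> ?v y" "?v y \<le> 1" for y
    using power_tail_pos[of p a y] power_tail_le_1[of p a y] p by auto
  have powr_le_v: "x powr (- p) \<le> ?v x"
    unfolding vx using p x0 a by (intro powr_mono2') (auto simp: divide_le_eq)
  have pointwise: "?v (x - d) \<le> ?v x * (1 + p * (d / x) + C * (d / x)\<^sup>2) + indicator {x / 2..} d" for d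
  proof (cases "d < x / 2")
    case True
    have "?v (x - d) \<le> ((x - d) / a) powr (- p)"
      unfolding power_tail_def using True x0 p by (intro powr_mono2') auto
    also have "(x - d) / a = (x / a) * (1 - d / x)" using x0 by (simp add: field_simps)
    also have "((x / a) * (1 - d / x)) powr (- p) = ?v x * (1 - d / x) powr (- p)"
      unfolding vx using True x0 by (intro powr_mult)
    also have "\<dots> \<le> ?v x * (1 + p * (d / x) + C * (d / x)\<^sup>2)"
      unfolding C_def using True x0 p
      by (intro mult_left_mono one_minus_powr_le_quadratic v01) (auto simp: field_simps)
    finally show ?thesis using True by simp
  next
    case False
    have "0 \<le> 1 + p * z + C * z\<^sup>2" for z
    proof -
      have "0 \<le> (1 + p / 2 * z)\<^sup>2" by simp
      also have "\<dots> = 1 + p * z + p\<^sup>2 / 4 * z\<^sup>2" by (simp add: power2_eq_square algebra_simps)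
      also have "\<dots> \<le> 1 + p * z + C * z\<^sup>2" using C4 by (intro add_left_mono mult_right_mono) auto
      finally show ?thesis .
    qed
    then have "0 \<le> ?v x * (1 + p * (d / x) + C * (d / x)\<^sup>2)"
      using v01 by (intro mult_nonneg_nonneg) blast+
    then show ?thesis using False v01(2)[of "x - d"] by simp
  qed
  \<comment> \<open>The gain is kept only where \<open>D\<close> is nonnegative: there \<open>v (x - D) \<ge> v x\<close> by monotonicity.\<close>
  have gain: "some_child_prob \<beta> (?v (x - d)) \<le>
      ?v x * (1 + p * (d / x) + C * (d / x)\<^sup>2) + indicator {x / 2..} d
        - ?v x powr (1 + \<beta>) / (1 + \<beta>) * indicator {0..} d" for d
  proof -
    have "?v x powr (1 + \<beta>) / (1 + \<beta>) * indicator {0..} d \<le> ?v (x - d) powr (1 + \<beta>) / (1 + \<beta>)"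
    proof (cases "0 \<le> d")
      case True
      then have "?v x \<le> ?v (x - d)" using p x0 by (intro power_tail_antimono) auto
      then show ?thesis using True \<beta> v01
        by (auto intro!: divide_right_mono powr_mono2)
    qed (use \<beta> in auto)
    then show ?thesis unfolding some_child_prob_def using pointwise[of d] by simp
  qed
  have gain_eq: "?v x powr (1 + \<beta>) = ?v x * (a\<^sup>2 / x\<^sup>2)"
  proof -
    have "?v x powr \<beta> = (x / a) powr (- 2)"
      unfolding vx using \<beta> by (simp add: powr_powr p_def)
    also have "\<dots> = a\<^sup>2 / x\<^sup>2"
      using x0 by (simp add: powr_minus powr_numeral power_divide)
    finally show ?thesis using v01(1)[of x] by (simp add: powr_add)
  qed
  have [simp]: "integrable M (\<lambda>\<omega>. indicator {y..} (D \<omega>) :: real)" for y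
    by (intro integrable_const_bound[where B=1]) auto
  have ind: "expectation (\<lambda>\<omega>. indicator {y..} (D \<omega>)) = prob {\<omega>\<in>space M. y \<le> D \<omega>}" for y
  proof -
    have "expectation (\<lambda>\<omega>. indicator {y..} (D \<omega>)) = expectation (indicator {\<omega>\<in>space M. y \<le> D \<omega>})"
      by (intro Bochner_Integration.integral_cong) (auto simp: indicator_def)
    also have "\<dots> = prob {\<omega>\<in>space M. y \<le> D \<omega>}"
      by (subst Bochner_Integration.integral_indicator) (auto intro!: arg_cong[where f=prob])
    finally show ?thesis .
  qed
  have "expectation (\<lambda>\<omega>. some_child_prob \<beta> (?v (x - D \<omega>))) \<le>
     expectation (\<lambda>\<omega>. ?v x * (1 + p / x * D \<omega> + C / x\<^sup>2 * (D \<omega>)\<^sup>2) + indicator {x / 2..} (D \<omega>)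
        - ?v x powr (1 + \<beta>) / (1 + \<beta>) * indicator {0..} (D \<omega>))"
  proof (rule integral_mono)
    show "integrable M (\<lambda>\<omega>. some_child_prob \<beta> (?v (x - D \<omega>)))"
    proof (intro integrable_const_bound[where B=1] AE_I2)
      fix \<omega>
      show "norm (some_child_prob \<beta> (?v (x - D \<omega>))) \<le> 1"
        using some_child_prob_bounds[OF \<beta> v01, of "x - D \<omega>"] v01(2)[of "x - D \<omega>"] by simp
    qed simp
  qed (use gain D1 D2 in \<open>auto simp: power_divide\<close>)
  also have "\<dots> = ?v x * (1 + p / x * expectation D + C / x\<^sup>2 * expectation (\<lambda>\<omega>. (D \<omega>)\<^sup>2))
      + prob {\<omega>\<in>space M. x / 2 \<le> D \<omega>}
      - ?v x powr (1 + \<beta>) / (1 + \<beta>) * prob {\<omega>\<in>space M. 0 \<le> D \<omega>}"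
    using D1 D2 by (simp add: ind prob_space)
  finally have 1: "expectation (\<lambda>\<omega>. some_child_prob \<beta> (?v (x - D \<omega>))) \<le> \<dots>" .
  have 2: "?v x * (1 + p / x * expectation D + C / x\<^sup>2 * expectation (\<lambda>\<omega>. (D \<omega>)\<^sup>2))
      \<le> ?v x + ?v x / x\<^sup>2 * (C * c)"
  proof -
    have "C * expectation (\<lambda>\<omega>. (D \<omega>)\<^sup>2) \<le> C * c" using D2 C by (intro mult_left_mono) auto
    then have "?v x / x\<^sup>2 * (C * expectation (\<lambda>\<omega>. (D \<omega>)\<^sup>2)) \<le> ?v x / x\<^sup>2 * (C * c)"
      using v01(1)[of x] by (rule mult_left_mono[OF _ divide_nonneg_nonneg]) auto
    then show ?thesis using D1 by (simp add: algebra_simps)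
  qed
  have tail: "c * x powr (- p - 2) \<le> ?v x / x\<^sup>2 * c"
  proof -
    have "x powr (- p - 2) = x powr (- p) / x\<^sup>2"
      using x0 by (simp add: powr_diff powr_numeral)
    also have "\<dots> \<le> ?v x / x\<^sup>2" using powr_le_v by (intro divide_right_mono) auto
    finally show ?thesis using c by (metis mult.commute mult_left_mono)
  qed
  have 3: "prob {\<omega>\<in>space M. x / 2 \<le> D \<omega>} \<le> ?v x / x\<^sup>2 * (2 powr (p + 2) * c)"
  proof -
    have "prob {\<omega>\<in>space M. x / 2 \<le> D \<omega>} \<le> c * (x / 2) powr (- p - 2)"
      using x0 by (intro Dtail) auto
    also have "(x / 2) powr (- p - 2) = 2 powr (p + 2) * x powr (- p - 2)"
      using x0 by (simp add: powr_divide powr_diff powr_minus powr_add field_simps)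
    also have "c * (2 powr (p + 2) * x powr (- p - 2)) = 2 powr (p + 2) * (c * x powr (- p - 2))" by simp
    also have "\<dots> \<le> 2 powr (p + 2) * (?v x / x\<^sup>2 * c)" by (intro mult_left_mono tail) auto
    finally show ?thesis by (simp add: algebra_simps)
  qed
  have 4: "prob {\<omega>\<in>space M. x \<le> S \<omega>} \<le> ?v x / x\<^sup>2 * c"
    using Stail[of x] tail x0 by auto
  have 5: "?v x / x\<^sup>2 * (a\<^sup>2 / (2 * (1 + \<beta>))) \<le> ?v x powr (1 + \<beta>) / (1 + \<beta>) * prob {\<omega>\<in>space M. 0 \<le> D \<omega>}"
  proof -
    have "?v x powr (1 + \<beta>) / (1 + \<beta>) * (1 / 2) \<le> ?v x powr (1 + \<beta>) / (1 + \<beta>) * prob {\<omega>\<in>space M. 0 \<le> D \<omega>}"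
      using Dpos \<beta> by (intro mult_left_mono) auto
    moreover have "?v x / x\<^sup>2 * (a\<^sup>2 / (2 * (1 + \<beta>))) = ?v x powr (1 + \<beta>) / (1 + \<beta>) * (1 / 2)"
      unfolding gain_eq using \<beta> by (simp add: field_simps)
    ultimately show ?thesis by simp
  qed
  have 6: "?v x / x\<^sup>2 * (C * c + 2 powr (p + 2) * c + c) \<le> ?v x / x\<^sup>2 * (a\<^sup>2 / (2 * (1 + \<beta>)))"
    using a(2) \<beta> v01 unfolding C_def by (intro mult_left_mono) (auto simp: field_simps)
  show ?thesis using 1 2 3 4 5 6 by (simp add: distrib_left)
qed

section \<open>Levy's maximal inequality and symmetric laws\<close>

text \<open>Decompose according to the first index at which the partial sums exceed \<open>a\<close>. The remaining
  increment is independent of that index and nonnegative with probability at least one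
  half, in which case the final sum exceeds \<open>a\<close> as well.\<close>

lemma (in prob_space) levy_maximal_inequality:
  fixes \<xi> :: "nat \<Rightarrow> 'a \<Rightarrow> real"
  assumes ind: "indep_vars (\<lambda>_. borel) \<xi> UNIV"
    and half: "\<And>k. k \<le> N \<Longrightarrow> 1 / 2 \<le> prob {\<omega>\<in>space M. 0 \<le> (\<Sum>i\<in>{k..<N}. \<xi> i \<omega>)}"
  shows "prob {\<omega>\<in>space M. \<exists>k\<le>N. a < (\<Sum>i<k. \<xi> i \<omega>)}
    \<le> 2 * prob {\<omega>\<in>space M. a < (\<Sum>i<N. \<xi> i \<omega>)}"
proof -
  have [measurable]: "\<xi> k \<in> borel_measurable M" for k
    using ind by (auto simp: indep_vars_def)
  \<comment> \<open>\<open>A k\<close>: the level is exceeded for the first time at \<open>k\<close>; \<open>R k\<close>: the increment after \<open>k\<close> is nonnegative.\<close>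
  define A where "A k = {\<omega>\<in>space M. a < (\<Sum>i<k. \<xi> i \<omega>) \<and> (\<forall>j<k. (\<Sum>i<j. \<xi> i \<omega>) \<le> a)}" for k
  define R where "R k = {\<omega>\<in>space M. 0 \<le> (\<Sum>i\<in>{k..<N}. \<xi> i \<omega>)}" for k
  have [measurable]: "A k \<in> events" "R k \<in> events" for k
    unfolding A_def R_def by measurable
  have AR: "prob (A k \<inter> R k) = prob (A k) * prob (R k)" for k
  proof -
    let ?X = "\<lambda>\<omega>. \<lambda>i\<in>{..<k}. \<xi> i \<omega>" and ?Y = "\<lambda>\<omega>. \<lambda>i\<in>{k..<N}. \<xi> i \<omega>"
    let ?A = "{x \<in> space (PiM {..<k} (\<lambda>_. borel)). a < (\<Sum>i<k. x i) \<and> (\<forall>j<k. (\<Sum>i<j. x i) \<le> a)}"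
    let ?R = "{x \<in> space (PiM {k..<N} (\<lambda>_. borel)). (0::real) \<le> (\<Sum>i\<in>{k..<N}. x i)}"
    have "(\<lambda>x. \<Sum>i<j. x i :: real) \<in> borel_measurable (PiM {..<k} (\<lambda>_. borel))" if "j \<le> k" for j
      using that by (intro borel_measurable_sum measurable_component_singleton) auto
    then have *: "(\<lambda>x. \<Sum>i<min j k. x i :: real) \<in> borel_measurable (PiM {..<k} (\<lambda>_. borel))" for j
      by simp
    have "{x \<in> space (PiM {..<k} (\<lambda>_. borel)). a < (\<Sum>i<min k k. x i) \<and> (\<forall>j<k. (\<Sum>i<min j k. x i) \<le> a)}
        \<in> sets (PiM {..<k} (\<lambda>_. borel))"
      using * by measurable
    then have A: "?A \<in> sets (PiM {..<k} (\<lambda>_. borel))"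
      by (simp add: min_def cong: conj_cong)
    have R: "?R \<in> sets (PiM {k..<N} (\<lambda>_. borel))"
      by measurable
    have "indep_var (PiM {..<k} (\<lambda>_. borel)) ?X (PiM {k..<N} (\<lambda>_. borel)) ?Y"
      by (rule indep_var_restrict[OF ind]) auto
    then have "prob ((?X -` ?A \<inter> space M) \<inter> (?Y -` ?R \<inter> space M))
        = prob (?X -` ?A \<inter> space M) * prob (?Y -` ?R \<inter> space M)"
      using A R by (intro indep_pairD[OF indep_pair_of_indep_var])
    moreover have "?X -` ?A \<inter> space M = A k"
    proof -
      have "(\<Sum>i<j. ?X \<omega> i) = (\<Sum>i<j. \<xi> i \<omega>)" if "j \<le> k" for j \<omega>
        using that by (intro sum.cong) auto
      then show ?thesis unfolding A_def by (auto simp: space_PiM simp del: restrict_apply)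
    qed
    moreover have "?Y -` ?R \<inter> space M = R k"
      unfolding R_def by (auto simp: space_PiM)
    ultimately show ?thesis by simp
  qed
  have disj: "disjoint_family_on A {..N}"
    unfolding disjoint_family_on_def A_def by (auto, metis linorder_neqE_nat not_le)
  have un: "{\<omega>\<in>space M. \<exists>k\<le>N. a < (\<Sum>i<k. \<xi> i \<omega>)} = (\<Union>k\<in>{..N}. A k)"
  proof (intro equalityI subsetI)
    fix \<omega> assume "\<omega> \<in> {\<omega>\<in>space M. \<exists>k\<le>N. a < (\<Sum>i<k. \<xi> i \<omega>)}"
    then obtain k where \<omega>: "\<omega> \<in> space M" and k: "k \<le> N" "a < (\<Sum>i<k. \<xi> i \<omega>)" by auto
    define l where "l = (LEAST k. a < (\<Sum>i<k. \<xi> i \<omega>))"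
    have "a < (\<Sum>i<l. \<xi> i \<omega>)" unfolding l_def using k(2) by (rule LeastI)
    moreover have "(\<Sum>i<j. \<xi> i \<omega>) \<le> a" if "j < l" for j
      using not_less_Least[OF that[unfolded l_def]] by simp
    moreover have "l \<le> N" using Least_le[of "\<lambda>k. a < (\<Sum>i<k. \<xi> i \<omega>)", OF k(2)] k(1) by (simp add: l_def)
    ultimately show "\<omega> \<in> (\<Union>k\<in>{..N}. A k)" using \<omega> by (auto simp: A_def)
  qed (auto simp: A_def)
  have "prob {\<omega>\<in>space M. \<exists>k\<le>N. a < (\<Sum>i<k. \<xi> i \<omega>)} = (\<Sum>k\<le>N. prob (A k))"
    unfolding un by (rule finite_measure_finite_Union) (use disj in auto)
  also have "\<dots> \<le> (\<Sum>k\<le>N. 2 * prob (A k \<inter> R k))"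
  proof (rule sum_mono)
    fix k assume "k \<in> {..N}"
    then have "1 / 2 \<le> prob (R k)" using half[of k] by (simp add: R_def)
    then have "prob (A k) * (1 / 2) \<le> prob (A k) * prob (R k)" by (intro mult_left_mono) auto
    then show "prob (A k) \<le> 2 * prob (A k \<inter> R k)" by (simp add: AR)
  qed
  also have "\<dots> = 2 * prob (\<Union>k\<in>{..N}. A k \<inter> R k)"
    unfolding sum_distrib_left[symmetric]
    by (subst finite_measure_finite_Union) (use disj in \<open>auto simp: disjoint_family_on_def\<close>)
  also have "prob (\<Union>k\<in>{..N}. A k \<inter> R k) \<le> prob {\<omega>\<in>space M. a < (\<Sum>i<N. \<xi> i \<omega>)}"
  proof (rule finite_measure_mono)
    show "(\<Union>k\<in>{..N}. A k \<inter> R k) \<subseteq> {\<omega>\<in>space M. a < (\<Sum>i<N. \<xi> i \<omega>)}"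
    proof
      fix \<omega> assume "\<omega> \<in> (\<Union>k\<in>{..N}. A k \<inter> R k)"
      then obtain k where k: "k \<le> N" "\<omega> \<in> A k" "\<omega> \<in> R k" by auto
      have "(\<Sum>i<N. \<xi> i \<omega>) = (\<Sum>i<k. \<xi> i \<omega>) + (\<Sum>i\<in>{k..<N}. \<xi> i \<omega>)"
        using sum.atLeastLessThan_concat[of 0 k N "\<lambda>i. \<xi> i \<omega>"] k(1) by (simp add: lessThan_atLeast0)
      then show "\<omega> \<in> {\<omega>\<in>space M. a < (\<Sum>i<N. \<xi> i \<omega>)}"
        using k by (auto simp: A_def R_def)
    qed
  qed measurable
  finally show ?thesis by simp
qed

text \<open>Vanishing sine transforms mean that the characteristic function is real, so \<open>U\<close> and \<open>- U\<close>
  have the same characteristic function.\<close>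

lemma (in prob_space) symmetric_law_of_sin:
  fixes U :: "'a \<Rightarrow> real"
  assumes [measurable]: "U \<in> borel_measurable M"
    and sin0: "\<And>z. expectation (\<lambda>\<omega>. sin (z * U \<omega>)) = 0"
  shows "distr M borel (\<lambda>\<omega>. - U \<omega>) = distr M borel U"
proof (rule Levy_uniqueness)
  show "real_distribution (distr M borel (\<lambda>\<omega>. - U \<omega>))" "real_distribution (distr M borel U)"
    by (auto intro!: real_distribution_distr)
  have i: "integrable M (\<lambda>\<omega>. iexp (z * U \<omega>))" for z
    by (intro integrable_const_bound[where B=1]) auto
  have im: "Im (expectation (\<lambda>\<omega>. iexp (z * U \<omega>))) = 0" for z
  proof -
    have "Im (expectation (\<lambda>\<omega>. iexp (z * U \<omega>))) = expectation (\<lambda>\<omega>. Im (iexp (z * U \<omega>)))"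
      using integral_Im[OF i[of z]] by simp
    also have "\<dots> = expectation (\<lambda>\<omega>. sin (z * U \<omega>))" by (simp add: Im_exp)
    finally show ?thesis by (simp add: sin0)
  qed
  show "char (distr M borel (\<lambda>\<omega>. - U \<omega>)) = char (distr M borel U)"
  proof
    fix z
    have "char (distr M borel (\<lambda>\<omega>. - U \<omega>)) z = expectation (\<lambda>\<omega>. iexp (z * - U \<omega>))"
      unfolding char_def by (subst integral_distr) auto
    also have "\<dots> = expectation (\<lambda>\<omega>. cnj (iexp (z * U \<omega>)))"
      by (intro Bochner_Integration.integral_cong) (simp_all add: exp_cnj)
    also have "\<dots> = cnj (expectation (\<lambda>\<omega>. iexp (z * U \<omega>)))"
      by simp
    also have "\<dots> = expectation (\<lambda>\<omega>. iexp (z * U \<omega>))"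
      using im[of z] by (simp add: complex_eq_iff)
    also have "\<dots> = char (distr M borel U) z"
      unfolding char_def by (subst integral_distr) auto
    finally show "char (distr M borel (\<lambda>\<omega>. - U \<omega>)) z = char (distr M borel U) z" .
  qed
qed

lemma (in prob_space) symmetric_law_half:
  fixes U :: "'a \<Rightarrow> real"
  assumes [measurable]: "U \<in> borel_measurable M"
    and sym: "distr M borel (\<lambda>\<omega>. - U \<omega>) = distr M borel U"
  shows "1 / 2 \<le> prob {\<omega>\<in>space M. 0 \<le> U \<omega>}"
proof -
  have "measure (distr M borel (\<lambda>\<omega>. - U \<omega>)) {0..} = measure (distr M borel U) {0..}"
    by (simp add: sym)
  then have *: "prob {\<omega>\<in>space M. U \<omega> \<le> 0} = prob {\<omega>\<in>space M. 0 \<le> U \<omega>}"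
    by (simp add: measure_distr vimage_def Int_def conj_commute)
  have "1 = prob ({\<omega>\<in>space M. U \<omega> \<le> 0} \<union> {\<omega>\<in>space M. 0 \<le> U \<omega>})"
    by (subst prob_space[symmetric]) (auto intro!: arg_cong[where f=prob])
  also have "\<dots> \<le> prob {\<omega>\<in>space M. U \<omega> \<le> 0} + prob {\<omega>\<in>space M. 0 \<le> U \<omega>}"
    by (intro measure_Un_le) measurable
  finally show ?thesis using * by simp
qed

lemma (in prob_space) symmetric_law_mean:
  fixes U :: "'a \<Rightarrow> real"
  assumes [measurable]: "U \<in> borel_measurable M"
    and sym: "distr M borel (\<lambda>\<omega>. - U \<omega>) = distr M borel U"
  shows "expectation U = 0"
proof -
  have "expectation U = (\<integral>x. x \<partial>distr M borel U)" by (subst integral_distr) auto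
  also have "\<dots> = (\<integral>x. x \<partial>distr M borel (\<lambda>\<omega>. - U \<omega>))" by (simp add: sym)
  also have "\<dots> = - expectation U" by (subst integral_distr) auto
  finally show ?thesis by simp
qed

section \<open>Brownian motion on dyadic grids\<close>

text \<open>The projection of a \<open>d\<close>-dimensional motion to a unit direction is a motion of the same kind on
  the line, which reduces all displacement estimates to dimension one.\<close>

lemma (in prob_space) stable_process_inner:
  fixes Y :: "real \<Rightarrow> 'a \<Rightarrow> 'b::euclidean_space"
  assumes Y: "stable_process 2 Y" and e: "norm e = 1"
  shows "stable_process 2 (\<lambda>t \<omega>. e \<bullet> Y t \<omega>)"
  unfolding stable_process_def
proof (intro conjI allI impI)
  have m: "Y t \<in> borel_measurable M" if "0 \<le> t" for t
    using Y that by (auto simp: stable_process_def)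
  show "(\<lambda>\<omega>. e \<bullet> Y t \<omega>) \<in> borel_measurable M" if "0 \<le> t" for t
    using m[OF that] by measurable
  show "AE \<omega> in M. e \<bullet> Y 0 \<omega> = 0"
    using Y by (auto simp: stable_process_def)
  show "indep_vars (\<lambda>_. borel) (\<lambda>k \<omega>. e \<bullet> Y (ts (Suc k)) \<omega> - e \<bullet> Y (ts k) \<omega>) UNIV"
    if "0 \<le> ts 0 \<and> incseq ts" for ts
  proof -
    have "indep_vars (\<lambda>_. borel) (\<lambda>k \<omega>. Y (ts (Suc k)) \<omega> - Y (ts k) \<omega>) UNIV"
      using Y that by (auto simp: stable_process_def)
    from indep_vars_compose2[OF this, of "\<lambda>_ x. e \<bullet> x" "\<lambda>_. borel"] show ?thesis
      by (simp add: inner_diff_right)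
  qed
  show "(\<integral>\<omega>. cis (z \<bullet> (e \<bullet> Y t \<omega> - e \<bullet> Y s \<omega>)) \<partial>M) = complex_of_real (exp (- (t - s) * norm z powr 2))"
    if "0 \<le> s \<and> s \<le> t" for s t z :: real
  proof -
    have "(\<integral>\<omega>. cis ((z *\<^sub>R e) \<bullet> (Y t \<omega> - Y s \<omega>)) \<partial>M)
        = complex_of_real (exp (- (t - s) * norm (z *\<^sub>R e) powr 2))"
      using Y that unfolding stable_process_def by blast
    then show ?thesis using e by (simp add: inner_diff_right algebra_simps)
  qed
  show "AE \<omega> in M. cadlag (\<lambda>t. e \<bullet> Y t \<omega>)"
  proof -
    have "AE \<omega> in M. cadlag (\<lambda>t. Y t \<omega>)" using Y by (auto simp: stable_process_def)
    then show ?thesis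
    proof eventually_elim
      case (elim \<omega>)
      show ?case unfolding cadlag_def
      proof (intro conjI allI impI)
        show "((\<lambda>t. e \<bullet> Y t \<omega>) \<longlongrightarrow> e \<bullet> Y t \<omega>) (at_right t)" if "0 \<le> t" for t
          using elim that by (intro tendsto_inner tendsto_const) (auto simp: cadlag_def)
        show "\<exists>l. ((\<lambda>t. e \<bullet> Y t \<omega>) \<longlongrightarrow> l) (at_left t)" if t: "0 < t" for t
        proof -
          obtain l where "((\<lambda>t. Y t \<omega>) \<longlongrightarrow> l) (at_left t)"
            using elim t unfolding cadlag_def by blast
          then have "((\<lambda>t. e \<bullet> Y t \<omega>) \<longlongrightarrow> e \<bullet> l) (at_left t)"
            by (intro tendsto_inner tendsto_const)
          then show ?thesis by blast
        qed
      qed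
    qed
  qed
  show "AE \<omega> in M. continuous_on {0..} (\<lambda>t. e \<bullet> Y t \<omega>)"
  proof -
    have "AE \<omega> in M. continuous_on {0..} (\<lambda>t. Y t \<omega>)" using Y by (auto simp: stable_process_def)
    then show ?thesis by eventually_elim (intro continuous_intros)
  qed
qed

lemma (in prob_space) stable_process_increment_sin:
  fixes y :: "real \<Rightarrow> 'a \<Rightarrow> real"
  assumes y: "stable_process 2 y" and st: "0 \<le> s" "s \<le> t"
  shows "expectation (\<lambda>\<omega>. sin (z * (y t \<omega> - y s \<omega>))) = 0"
proof -
  have [measurable]: "y t \<in> borel_measurable M" "y s \<in> borel_measurable M"
    using y st by (auto simp: stable_process_def)
  have i: "integrable M (\<lambda>\<omega>. cis (z * (y t \<omega> - y s \<omega>)))"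
    unfolding cis_conv_exp by (intro integrable_const_bound[where B=1]) auto
  have "expectation (\<lambda>\<omega>. cis (z * (y t \<omega> - y s \<omega>))) = complex_of_real (exp (- (t - s) * norm z powr 2))"
    using y st unfolding stable_process_def inner_real_def by blast
  then have "Im (expectation (\<lambda>\<omega>. cis (z * (y t \<omega> - y s \<omega>)))) = 0" by simp
  then show ?thesis using integral_Im[OF i] by simp
qed

lemma (in prob_space) stable_process_increment_half:
  fixes y :: "real \<Rightarrow> 'a \<Rightarrow> real"
  assumes y: "stable_process 2 y" and st: "0 \<le> s" "s \<le> t"
  shows "1 / 2 \<le> prob {\<omega>\<in>space M. 0 \<le> y t \<omega> - y s \<omega>}"
proof -
  have [measurable]: "y t \<in> borel_measurable M" "y s \<in> borel_measurable M"
    using y st by (auto simp: stable_process_def)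
  show ?thesis
    by (intro symmetric_law_half symmetric_law_of_sin stable_process_increment_sin[OF y st]) measurable
qed

text \<open>The moment of order \<open>2 * k\<close> of a centred normal variable of variance 2, which is the law of the
  one-dimensional motion at time 1.\<close>

definition gauss_moment :: "nat \<Rightarrow> real" where
  "gauss_moment k = fact (2 * k) / fact k"

lemma gauss_moment_pos: "0 < gauss_moment k"
  by (simp add: gauss_moment_def)

lemma (in prob_space) brownian_moment:
  fixes y :: "real \<Rightarrow> 'a \<Rightarrow> real"
  assumes y: "stable_process 2 y" and t: "0 \<le> t"
  shows "(\<integral>\<^sup>+\<omega>. ennreal ((y t \<omega>) ^ (2 * k)) \<partial>M) = ennreal (gauss_moment k * t ^ k)"
proof -
  have [measurable]: "y t \<in> borel_measurable M"
    using y t by (auto simp: stable_process_def)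
  have y0: "AE \<omega> in M. y 0 \<omega> = 0" and my0[measurable]: "y 0 \<in> borel_measurable M"
    using y by (auto simp: stable_process_def)
  show ?thesis
  proof (cases "t = 0")
    case True
    have "(\<integral>\<^sup>+\<omega>. ennreal ((y t \<omega>) ^ (2 * k)) \<partial>M) = (\<integral>\<^sup>+\<omega>. ennreal (0 ^ (2 * k)) \<partial>M)"
      using y0 by (intro nn_integral_cong_AE) (auto simp: True)
    also have "\<dots> = ennreal (0 ^ (2 * k))" by (simp add: emeasure_space_1)
    also have "0 ^ (2 * k) = gauss_moment k * t ^ k"
      using True by (cases k) (auto simp: gauss_moment_def)
    finally show ?thesis .
  next
    case False
    then have t0: "0 < t" using t by simp
    define U where "U \<omega> = y t \<omega> / sqrt (2 * t)" for \<omega>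
    have [measurable]: "U \<in> borel_measurable M" unfolding U_def by measurable
    have "distr M borel U = std_normal_distribution"
    proof (rule Levy_uniqueness)
      show "real_distribution (distr M borel U)" by (auto intro!: real_distribution_distr)
      show "real_distribution std_normal_distribution" by (rule real_dist_normal_dist)
      show "char (distr M borel U) = char std_normal_distribution"
      proof
        fix z
        have "char (distr M borel U) z = expectation (\<lambda>\<omega>. iexp (z * U \<omega>))"
          unfolding char_def by (subst integral_distr) auto
        also have "\<dots> = expectation (\<lambda>\<omega>. cis (z / sqrt (2 * t) * (y t \<omega> - y 0 \<omega>)))"
          using y0 by (intro integral_cong_AE) (auto simp: U_def cis_conv_exp)
        also have "\<dots> = complex_of_real (exp (- (t - 0) * norm (z / sqrt (2 * t)) powr 2))"
          using y t unfolding stable_process_def inner_real_def by blast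
        also have "- (t - 0) * norm (z / sqrt (2 * t)) powr 2 = - (z\<^sup>2) / 2"
          using t0 by (simp add: powr_numeral power_divide)
        finally show "char (distr M borel U) z = char std_normal_distribution z"
          by (simp add: char_std_normal_distribution)
      qed
    qed
    then have "(\<integral>\<^sup>+\<omega>. ennreal (U \<omega> ^ (2 * k)) \<partial>M) = (\<integral>\<^sup>+x. ennreal (x ^ (2 * k)) \<partial>std_normal_distribution)"
      by (subst nn_integral_distr[symmetric, where M' = borel]) auto
    also have "\<dots> = ennreal (fact (2 * k) / (2 ^ k * fact k))"
      using std_normal_distribution_even_moments[of k]
      by (subst nn_integral_eq_integral) (auto simp: power_mult)
    finally have U: "(\<integral>\<^sup>+\<omega>. ennreal (U \<omega> ^ (2 * k)) \<partial>M) = ennreal (fact (2 * k) / (2 ^ k * fact k))" .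
    have "(\<integral>\<^sup>+\<omega>. ennreal ((y t \<omega>) ^ (2 * k)) \<partial>M) = (\<integral>\<^sup>+\<omega>. ennreal ((2 * t) ^ k) * ennreal (U \<omega> ^ (2 * k)) \<partial>M)"
      using t0 by (intro nn_integral_cong)
        (auto simp: U_def power_mult power_divide ennreal_mult[symmetric])
    also have "\<dots> = ennreal ((2 * t) ^ k) * ennreal (fact (2 * k) / (2 ^ k * fact k))"
      by (subst nn_integral_cmult) (auto simp: U)
    also have "\<dots> = ennreal ((2 * t) ^ k * (fact (2 * k) / (2 ^ k * fact k)))"
      using t0 by (simp add: ennreal_mult[symmetric] del: ennreal_mult'')
    also have "(2 * t) ^ k * (fact (2 * k) / (2 ^ k * fact k)) = gauss_moment k * t ^ k"
      by (simp add: gauss_moment_def power_mult_distrib)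
    finally show ?thesis .
  qed
qed

lemma (in prob_space) even_moment_tail:
  fixes U :: "'a \<Rightarrow> real"
  assumes [measurable]: "U \<in> borel_measurable M" and c: "0 \<le> c"
    and mom: "(\<integral>\<^sup>+\<omega>. ennreal (U \<omega> ^ (2 * k)) \<partial>M) \<le> ennreal c" and a: "0 < a"
  shows "prob {\<omega>\<in>space M. a \<le> U \<omega>} \<le> c / a ^ (2 * k)"
proof -
  have "ennreal (a ^ (2 * k) * prob {\<omega>\<in>space M. a \<le> U \<omega>})
      = (\<integral>\<^sup>+\<omega>. ennreal (a ^ (2 * k)) * indicator {\<omega>\<in>space M. a \<le> U \<omega>} \<omega> \<partial>M)"
    using a by (subst nn_integral_cmult_indicator) (auto simp: emeasure_eq_measure ennreal_mult)
  also have "\<dots> \<le> (\<integral>\<^sup>+\<omega>. ennreal (U \<omega> ^ (2 * k)) \<partial>M)"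
    using a by (intro nn_integral_mono) (auto simp: indicator_def intro!: ennreal_leI power_mono)
  also note mom
  finally show ?thesis using c a by (simp add: ennreal_le_iff field_simps)
qed

text \<open>Levy's inequality on the grid of mesh \<open>2 ^ (- m)\<close> in \<open>[0, n]\<close> gives a bound that does not
  depend on \<open>m\<close>, so it survives the passage to all dyadic times.\<close>

lemma (in prob_space) brownian_grid_maximal:
  fixes y :: "real \<Rightarrow> 'a \<Rightarrow> real"
  assumes y: "stable_process 2 y" and a: "0 < a"
  shows "prob {\<omega>\<in>space M. \<exists>j m. real j / 2 ^ m \<le> real n \<and> a < y (real j / 2 ^ m) \<omega>}
    \<le> 2 * gauss_moment r * real n ^ r / a ^ (2 * r)"
proof -
  have ym[measurable]: "y (real j / 2 ^ m) \<in> borel_measurable M" "y (real j) \<in> borel_measurable M" for j m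
    using y by (auto simp: stable_process_def)
  have y0: "AE \<omega> in M. y 0 \<omega> = 0" using y by (auto simp: stable_process_def)
  have my0[measurable]: "y 0 \<in> borel_measurable M" using y by (auto simp: stable_process_def)
  define E where "E m = {\<omega>\<in>space M. \<exists>j\<le>n * 2 ^ m. a < y (real j / 2 ^ m) \<omega>}" for m :: nat
  have [measurable]: "E m \<in> events" for m unfolding E_def by measurable
  have "incseq E"
  proof (rule incseq_SucI, rule subsetI)
    fix m \<omega> assume "\<omega> \<in> E m"
    then obtain j where "\<omega> \<in> space M" "j \<le> n * 2 ^ m" "a < y (real j / 2 ^ m) \<omega>"
      by (auto simp: E_def)
    then show "\<omega> \<in> E (Suc m)" unfolding E_def
      by (auto intro!: exI[of _ "2 * j"])
  qed
  have un: "{\<omega>\<in>space M. \<exists>j m. real j / 2 ^ m \<le> real n \<and> a < y (real j / 2 ^ m) \<omega>} = (\<Union>m. E m)"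
  proof -
    have "real j / 2 ^ m \<le> real n \<longleftrightarrow> j \<le> n * 2 ^ m" for j m
    proof -
      have "real j / 2 ^ m \<le> real n \<longleftrightarrow> real j \<le> real (n * 2 ^ m)" by (simp add: field_simps)
      then show ?thesis by (simp only: of_nat_le_iff)
    qed
    then show ?thesis unfolding E_def by auto
  qed
  have Em: "prob (E m) \<le> 2 * gauss_moment r * real n ^ r / a ^ (2 * r)" for m
  proof -
    define N where "N = n * 2 ^ m"
    define ts where "ts = (\<lambda>j::nat. real j / 2 ^ m)"
    define \<xi> where "\<xi> = (\<lambda>k \<omega>. y (ts (Suc k)) \<omega> - y (ts k) \<omega>)"
    have ts: "0 \<le> ts 0" "incseq ts"
      unfolding ts_def incseq_def by (auto intro!: divide_right_mono)
    have ind: "indep_vars (\<lambda>_. borel) \<xi> UNIV"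
      unfolding \<xi>_def using y ts unfolding stable_process_def by blast
    have tel: "(\<Sum>i\<in>{k..<l}. \<xi> i \<omega>) = y (ts l) \<omega> - y (ts k) \<omega>" if "k \<le> l" for k l \<omega>
      unfolding \<xi>_def using sum_Suc_diff'[OF that, of "\<lambda>i. y (ts i) \<omega>"] by simp
    have "prob (E m) = prob {\<omega>\<in>space M. \<exists>k\<le>N. a < (\<Sum>i<k. \<xi> i \<omega>)}"
    proof (rule measure_eq_AE)
      show "AE \<omega> in M. (\<omega> \<in> E m) = (\<omega> \<in> {\<omega>\<in>space M. \<exists>k\<le>N. a < (\<Sum>i<k. \<xi> i \<omega>)})"
        using y0 by eventually_elim
          (auto simp: E_def N_def lessThan_atLeast0 tel ts_def)
      show "{\<omega>\<in>space M. \<exists>k\<le>N. a < (\<Sum>i<k. \<xi> i \<omega>)} \<in> events"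
        unfolding \<xi>_def ts_def by measurable
    qed simp
    also have "\<dots> \<le> 2 * prob {\<omega>\<in>space M. a < (\<Sum>i<N. \<xi> i \<omega>)}"
    proof (rule levy_maximal_inequality[OF ind])
      fix k assume k: "k \<le> N"
      have "1 / 2 \<le> prob {\<omega>\<in>space M. 0 \<le> y (ts N) \<omega> - y (ts k) \<omega>}"
        using k ts by (intro stable_process_increment_half[OF y]) (auto simp: ts_def divide_right_mono)
      then show "1 / 2 \<le> prob {\<omega>\<in>space M. 0 \<le> (\<Sum>i\<in>{k..<N}. \<xi> i \<omega>)}"
        using k by (simp add: tel)
    qed
    also have "prob {\<omega>\<in>space M. a < (\<Sum>i<N. \<xi> i \<omega>)} \<le> prob {\<omega>\<in>space M. a \<le> y (real n) \<omega>}"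
    proof (rule finite_measure_mono_AE)
      show "AE \<omega> in M. \<omega> \<in> {\<omega>\<in>space M. a < (\<Sum>i<N. \<xi> i \<omega>)} \<longrightarrow> \<omega> \<in> {\<omega>\<in>space M. a \<le> y (real n) \<omega>}"
        using y0 by eventually_elim (auto simp: N_def lessThan_atLeast0 tel ts_def)
    qed measurable
    also have "prob {\<omega>\<in>space M. a \<le> y (real n) \<omega>} \<le> gauss_moment r * real n ^ r / a ^ (2 * r)"
      using gauss_moment_pos[of r] a
      by (intro even_moment_tail) (auto simp: brownian_moment[OF y])
    finally show ?thesis by simp
  qed
  have "(\<lambda>m. prob (E m)) \<longlonglongrightarrow> prob (\<Union>m. E m)"
    using \<open>incseq E\<close> by (intro finite_Lim_measure_incseq) auto
  then show ?thesis unfolding un using Em by (intro LIMSEQ_le_const2) auto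
qed

section \<open>Brownian motion up to an exponential time\<close>

definition dyadic_floor :: "nat \<Rightarrow> real \<Rightarrow> real" where
  "dyadic_floor m t = real (nat \<lfloor>2 ^ m * t\<rfloor>) / 2 ^ m"

lemma dyadic_floor_nonneg: "0 \<le> dyadic_floor m t"
  by (simp add: dyadic_floor_def)

lemma dyadic_floor_le: "0 \<le> t \<Longrightarrow> dyadic_floor m t \<le> t"
  unfolding dyadic_floor_def by (simp add: divide_le_eq mult.commute)

lemma dyadic_floor_tendsto:
  assumes "0 \<le> t"
  shows "(\<lambda>m. dyadic_floor m t) \<longlonglongrightarrow> t"
proof (rule tendsto_sandwich)
  show "(\<lambda>m. t - 1 / 2 ^ m) \<longlonglongrightarrow> t" by real_asymp
  have "t - 1 / 2 ^ m \<le> dyadic_floor m t" for m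
  proof -
    have "2 ^ m * t \<le> real_of_int \<lfloor>2 ^ m * t\<rfloor> + 1" by linarith
    moreover have "real (nat \<lfloor>2 ^ m * t\<rfloor>) = real_of_int \<lfloor>2 ^ m * t\<rfloor>"
      using assms by simp
    ultimately show ?thesis
      unfolding dyadic_floor_def by (simp add: le_divide_eq right_diff_distrib mult.commute[of t] mult.commute[of _ "2 ^ m"])
  qed
  then show "\<forall>\<^sub>F m in sequentially. t - 1 / 2 ^ m \<le> dyadic_floor m t" by simp
  show "\<forall>\<^sub>F m in sequentially. dyadic_floor m t \<le> t"
    using dyadic_floor_le[OF assms] by simp
qed simp

text \<open>The value of \<open>f\<close> at \<open>t\<close> and its supremum over \<open>[0, t]\<close>, expressed through countably many
  fixed times. For continuous \<open>f\<close> these are the usual quantities, and the formulas remain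
  measurable in the path and in \<open>t\<close> without any exceptional set.\<close>

definition path_end :: "(real \<Rightarrow> real) \<Rightarrow> real \<Rightarrow> real" where
  "path_end f t = lim (\<lambda>m. f (dyadic_floor m t))"

text \<open>Times beyond \<open>t\<close> contribute \<open>f 0\<close>, which takes part in the supremum anyway when \<open>0 \<le> t\<close>.\<close>

definition path_sup :: "(real \<Rightarrow> real) \<Rightarrow> real \<Rightarrow> real" where
  "path_sup f t = real_of_ereal (SUP q\<in>range (\<lambda>(j, m). real j / 2 ^ m).
      if q \<le> t then ereal (f q) else ereal (f 0))"

lemma tendsto_along_dyadic_floor:
  fixes f :: "real \<Rightarrow> real"
  assumes f: "continuous_on {0..} f" and t: "0 \<le> t"
  shows "(\<lambda>m. f (dyadic_floor m t)) \<longlonglongrightarrow> f t"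
  using t by (intro continuous_on_tendsto_compose[OF f dyadic_floor_tendsto])
    (auto simp: dyadic_floor_nonneg)

lemma path_end_eq: "continuous_on {0..} f \<Longrightarrow> 0 \<le> t \<Longrightarrow> path_end f t = f t"
  unfolding path_end_def by (intro limI tendsto_along_dyadic_floor)

lemma
  fixes f :: "real \<Rightarrow> real"
  assumes f: "continuous_on {0..} f" and t: "0 \<le> t"
  shows le_path_sup: "\<And>s. 0 \<le> s \<Longrightarrow> s \<le> t \<Longrightarrow> f s \<le> path_sup f t"
    and less_path_supD: "\<And>a. a < path_sup f t \<Longrightarrow> \<exists>j m. real j / 2 ^ m \<le> t \<and> a < f (real j / 2 ^ m)"
proof -
  let ?Q = "range (\<lambda>(j, m). real j / 2 ^ m)"
  let ?g = "\<lambda>q. if q \<le> t then ereal (f q) else ereal (f 0)"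
  let ?S = "SUP q\<in>?Q. ?g q"
  have "compact (f ` {0..t})"
    by (intro compact_continuous_image continuous_on_subset[OF f]) auto
  then have "bounded (f ` {0..t})" by (rule compact_imp_bounded)
  then obtain b where b: "\<And>s. s \<in> {0..t} \<Longrightarrow> \<bar>f s\<bar> \<le> b"
    unfolding bounded_iff by (auto simp del: atLeastAtMost_iff)
  have 0: "0 \<in> ?Q" by (rule image_eqI[of _ _ "(0, 0)"]) auto
  have Qpos: "0 \<le> q" if "q \<in> ?Q" for q using that by auto
  have "?S \<le> ereal b"
  proof (rule SUP_least)
    fix q assume "q \<in> ?Q"
    then show "?g q \<le> ereal b" using b[of q] b[of 0] t Qpos[of q] by auto
  qed
  moreover have "ereal (f 0) \<le> ?S"
    using t by (intro SUP_upper2[OF 0]) auto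
  ultimately have fin: "ereal (path_sup f t) = ?S"
    unfolding path_sup_def by (cases ?S) auto
  show "f s \<le> path_sup f t" if s: "0 \<le> s" "s \<le> t" for s
  proof (rule LIMSEQ_le_const2[OF tendsto_along_dyadic_floor[OF f s(1)]])
    have "f (dyadic_floor m s) \<le> path_sup f t" for m
    proof -
      have "dyadic_floor m s \<in> ?Q" unfolding dyadic_floor_def
        by (rule image_eqI[where x="(nat \<lfloor>2 ^ m * s\<rfloor>, m)"]) auto
      then have "?g (dyadic_floor m s) \<le> ?S" by (rule SUP_upper)
      moreover have "dyadic_floor m s \<le> t" using dyadic_floor_le[of s m] s by simp
      ultimately show ?thesis unfolding fin[symmetric] by simp
    qed
    then show "\<exists>N. \<forall>n\<ge>N. f (dyadic_floor n s) \<le> path_sup f t" by blast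
  qed
  show "\<exists>j m. real j / 2 ^ m \<le> t \<and> a < f (real j / 2 ^ m)" if "a < path_sup f t" for a
  proof -
    have "ereal a < ?S" using that fin by (metis ereal_less(2) less_ereal.simps(1))
    then obtain q where q: "q \<in> ?Q" "ereal a < ?g q" unfolding less_SUP_iff by blast
    show ?thesis
    proof (cases "q \<le> t")
      case True
      then show ?thesis using q by auto
    next
      case False
      then show ?thesis using q t by (intro exI[of _ 0]) auto
    qed
  qed
qed

lemma measurable_at_dyadic_floor:
  assumes [measurable]: "T \<in> borel_measurable F"
    and y: "\<And>t. 0 \<le> t \<Longrightarrow> (\<lambda>\<omega>. y t \<omega>) \<in> borel_measurable F"
  shows "(\<lambda>\<omega>. y (dyadic_floor m (T \<omega>)) \<omega>) \<in> borel_measurable F"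
  unfolding dyadic_floor_def
proof (rule measurable_compose_countable[where f = "\<lambda>i \<omega>. y (real i / 2 ^ m) \<omega>"])
  show "(\<lambda>\<omega>. y (real i / 2 ^ m) \<omega>) \<in> borel_measurable F" for i :: nat
    by (rule y) simp
qed measurable

lemma measurable_path_end:
  assumes "T \<in> borel_measurable F"
    and "\<And>t. 0 \<le> t \<Longrightarrow> (\<lambda>\<omega>. y t \<omega>) \<in> borel_measurable F"
  shows "(\<lambda>\<omega>. path_end (\<lambda>t. y t \<omega>) (T \<omega>)) \<in> borel_measurable F"
  unfolding path_end_def by (rule borel_measurable_lim_metric, rule measurable_at_dyadic_floor[OF assms])

lemma measurable_path_sup:
  assumes [measurable]: "T \<in> borel_measurable F"
    and y: "\<And>t. 0 \<le> t \<Longrightarrow> (\<lambda>\<omega>. y t \<omega>) \<in> borel_measurable F"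
  shows "(\<lambda>\<omega>. path_sup (\<lambda>t. y t \<omega>) (T \<omega>)) \<in> borel_measurable F"
proof -
  have [measurable]: "(\<lambda>\<omega>. y 0 \<omega>) \<in> borel_measurable F"
    by (rule y) simp
  show ?thesis
    unfolding path_sup_def
  proof (intro borel_measurable_real_of_ereal borel_measurable_SUP)
    show "countable (range (\<lambda>(j::nat, m::nat). real j / 2 ^ m))" by simp
    fix q assume "q \<in> range (\<lambda>(j, m). real j / 2 ^ m)"
    then have "0 \<le> q" by auto
    from y[OF this] have [measurable]: "(\<lambda>\<omega>. y q \<omega>) \<in> borel_measurable F" .
    show "(\<lambda>\<omega>. if q \<le> T \<omega> then ereal (y q \<omega>) else ereal (y 0 \<omega>)) \<in> borel_measurable F"
      by measurable
  qed
qed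

text \<open>An upper bound for \<open>E ((1 + T) ^ k)\<close> with \<open>T\<close> exponential of parameter \<open>V\<close>.\<close>

definition lifetime_moment_bound :: "real \<Rightarrow> nat \<Rightarrow> real" where
  "lifetime_moment_bound V k = 2 ^ k * (1 + fact k / V ^ k)"

lemma (in prob_space) exponential_moment_le:
  assumes T: "distributed M lborel T (\<lambda>x. ennreal (exponential_density V x))" and V: "0 < V"
  shows "AE \<omega> in M. 0 < T \<omega>"
    and "(\<integral>\<^sup>+\<omega>. ennreal ((1 + T \<omega>) ^ k) \<partial>M) \<le> ennreal (lifetime_moment_bound V k)"
proof -
  have [measurable]: "T \<in> borel_measurable M" using distributed_measurable[OF T] by simp
  have "prob {\<omega>\<in>space M. 0 < T \<omega>} = 1"
    using exponential_distributedD_gt[OF T order_refl V] by simp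
  then show pos: "AE \<omega> in M. 0 < T \<omega>" by (subst (asm) prob_Collect_eq_1) auto
  have i: "integrable M (\<lambda>\<omega>. T \<omega> ^ k)" "expectation (\<lambda>\<omega>. T \<omega> ^ k) = fact k / V ^ k"
    using erlang_ith_moment_integrable[OF V T, of k] erlang_ith_moment[OF V T, of k] by simp_all
  have "(\<integral>\<^sup>+\<omega>. ennreal ((1 + T \<omega>) ^ k) \<partial>M) \<le> (\<integral>\<^sup>+\<omega>. ennreal (2 ^ k * (1 + T \<omega> ^ k)) \<partial>M)"
  proof (rule nn_integral_mono_AE, use pos in eventually_elim)
    fix \<omega> assume "0 < T \<omega>"
    then have "(1 + T \<omega>) ^ k \<le> (2 * max 1 (T \<omega>)) ^ k" by (intro power_mono) auto
    also have "\<dots> = 2 ^ k * max 1 (T \<omega>) ^ k" by (rule power_mult_distrib)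
    also have "max 1 (T \<omega>) ^ k \<le> 1 + T \<omega> ^ k" using \<open>0 < T \<omega>\<close> by (auto simp: max_def)
    finally show "ennreal ((1 + T \<omega>) ^ k) \<le> ennreal (2 ^ k * (1 + T \<omega> ^ k))"
      by (intro ennreal_leI) auto
  qed
  also have "\<dots> = ennreal (expectation (\<lambda>\<omega>. 2 ^ k * (1 + T \<omega> ^ k)))"
  proof (rule nn_integral_eq_integral)
    show "AE \<omega> in M. 0 \<le> 2 ^ k * (1 + T \<omega> ^ k)" using pos by eventually_elim auto
  qed (use i in auto)
  also have "expectation (\<lambda>\<omega>. 2 ^ k * (1 + T \<omega> ^ k)) = lifetime_moment_bound V k"
    using i by (simp add: lifetime_moment_bound_def prob_space)
  finally show "(\<integral>\<^sup>+\<omega>. ennreal ((1 + T \<omega>) ^ k) \<partial>M) \<le> ennreal (lifetime_moment_bound V k)" .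
qed

lemma lifetime_moment_bound_pos: "0 < V \<Longrightarrow> 0 < lifetime_moment_bound V k"
  by (simp add: lifetime_moment_bound_def add_pos_pos)

context prob_space
begin

context
  fixes y :: "real \<Rightarrow> 'a \<Rightarrow> real" and T :: "'a \<Rightarrow> real" and V :: real
  assumes y: "stable_process 2 y" and V: "0 < V"
    and T: "distributed M lborel T (\<lambda>x. ennreal (exponential_density V x))"
    and ind: "indep_pair borel T (PiM {0..} (\<lambda>_. borel)) (\<lambda>\<omega>. \<lambda>t\<in>{0..}. y t \<omega>)"
begin

lemma measurable_motion: "0 \<le> t \<Longrightarrow> y t \<in> borel_measurable M"
  using y by (simp add: stable_process_def)

lemma measurable_lifetime: "T \<in> borel_measurable M"
  using distributed_measurable[OF T] by simp

text \<open>Independence of lifetime and motion: at a dyadic approximation of the lifetime, the motion may be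
  replaced by an independent copy with the time held fixed.\<close>

lemma nn_integral_at_dyadic_floor:
  assumes [measurable]: "h \<in> borel_measurable borel"
  shows "(\<integral>\<^sup>+\<omega>. h (y (dyadic_floor m (T \<omega>)) \<omega>) \<partial>M)
    = (\<integral>\<^sup>+\<omega>. \<integral>\<^sup>+\<omega>'. h (y (dyadic_floor m (T \<omega>)) \<omega>') \<partial>M \<partial>M)"
proof -
  let ?f = "\<lambda>(t, \<pi>). h (\<pi> (dyadic_floor m t))"
  have "(\<lambda>z. snd z (dyadic_floor m (fst z))) \<in> borel_measurable (borel \<Otimes>\<^sub>M PiM {0..} (\<lambda>_. borel :: real measure))"
    by (rule measurable_at_dyadic_floor[where y="\<lambda>t z. snd z t"])
      (auto intro: measurable_compose[OF measurable_snd measurable_component_singleton])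
  then have f: "?f \<in> borel_measurable (borel \<Otimes>\<^sub>M PiM {0..} (\<lambda>_. borel))"
    by (simp add: split_beta' measurable_compose[OF _ assms])
  show ?thesis
    using nn_integral_indep_pair[OF ind f] by (simp add: dyadic_floor_nonneg)
qed

lemma lifetime_end_tendsto: "AE \<omega> in M. (\<lambda>m. y (dyadic_floor m (T \<omega>)) \<omega>) \<longlonglongrightarrow> path_end (\<lambda>t. y t \<omega>) (T \<omega>)"
proof -
  have "AE \<omega> in M. continuous_on {0..} (\<lambda>t. y t \<omega>)" using y by (simp add: stable_process_def)
  with exponential_moment_le(1)[OF T V] show ?thesis
    by eventually_elim (simp add: path_end_eq, rule tendsto_along_dyadic_floor[where f="\<lambda>t. y t _"], simp_all)
qed

lemma measurable_lifetime_end: "(\<lambda>\<omega>. path_end (\<lambda>t. y t \<omega>) (T \<omega>)) \<in> borel_measurable M"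
  by (rule measurable_path_end[OF measurable_lifetime measurable_motion])

lemma measurable_lifetime_sup: "(\<lambda>\<omega>. path_sup (\<lambda>t. y t \<omega>) (T \<omega>)) \<in> borel_measurable M"
  by (rule measurable_path_sup[OF measurable_lifetime measurable_motion])

lemma measurable_lifetime_dyadic: "(\<lambda>\<omega>. y (dyadic_floor m (T \<omega>)) \<omega>) \<in> borel_measurable M"
  by (rule measurable_at_dyadic_floor[OF measurable_lifetime measurable_motion])

lemmas lifetime_measurables = measurable_lifetime measurable_lifetime_end
  measurable_lifetime_sup measurable_lifetime_dyadic

text \<open>At a fixed time \<open>t\<close> the moment is a multiple of \<open>t ^ k\<close>. Integrate over the approximated lifetime
  and use Fatou's lemma.\<close>

lemma lifetime_end_moment:
  "(\<integral>\<^sup>+\<omega>. ennreal (path_end (\<lambda>t. y t \<omega>) (T \<omega>) ^ (2 * k)) \<partial>M)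
     \<le> ennreal (gauss_moment k * lifetime_moment_bound V k)"
proof -
  note [measurable] = lifetime_measurables
  let ?D = "\<lambda>m \<omega>. y (dyadic_floor m (T \<omega>)) \<omega>"
  have "(\<integral>\<^sup>+\<omega>. ennreal (path_end (\<lambda>t. y t \<omega>) (T \<omega>) ^ (2 * k)) \<partial>M)
      = (\<integral>\<^sup>+\<omega>. liminf (\<lambda>m. ennreal (?D m \<omega> ^ (2 * k))) \<partial>M)"
  proof (rule nn_integral_cong_AE, use lifetime_end_tendsto in eventually_elim)
    case (elim \<omega>)
    then have "(\<lambda>m. ennreal (?D m \<omega> ^ (2 * k))) \<longlonglongrightarrow> ennreal (path_end (\<lambda>t. y t \<omega>) (T \<omega>) ^ (2 * k))"
      by (intro tendsto_ennrealI tendsto_power)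
    then show ?case by (intro lim_imp_Liminf[symmetric]) auto
  qed
  also have "\<dots> \<le> liminf (\<lambda>m. \<integral>\<^sup>+\<omega>. ennreal (?D m \<omega> ^ (2 * k)) \<partial>M)"
    by (rule nn_integral_liminf) measurable
  also have "\<dots> \<le> ennreal (gauss_moment k * lifetime_moment_bound V k)"
  proof -
    have le: "(\<integral>\<^sup>+\<omega>. ennreal (?D m \<omega> ^ (2 * k)) \<partial>M) \<le> ennreal (gauss_moment k * lifetime_moment_bound V k)" for m
    proof -
      have "(\<integral>\<^sup>+\<omega>. ennreal (?D m \<omega> ^ (2 * k)) \<partial>M)
          = (\<integral>\<^sup>+\<omega>. ennreal (gauss_moment k * dyadic_floor m (T \<omega>) ^ k) \<partial>M)"
        by (subst nn_integral_at_dyadic_floor) (auto simp: brownian_moment[OF y dyadic_floor_nonneg])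
      also have "\<dots> \<le> (\<integral>\<^sup>+\<omega>. ennreal (gauss_moment k) * ennreal ((1 + T \<omega>) ^ k) \<partial>M)"
      proof (rule nn_integral_mono_AE, use exponential_moment_le(1)[OF T V] in eventually_elim)
        case (elim \<omega>)
        then have "dyadic_floor m (T \<omega>) ^ k \<le> (1 + T \<omega>) ^ k"
          using dyadic_floor_le[of "T \<omega>" m] by (intro power_mono dyadic_floor_nonneg) auto
        then show ?case using elim gauss_moment_pos[of k]
          by (auto simp: ennreal_mult[symmetric] intro!: ennreal_leI mult_left_mono)
      qed
      also have "\<dots> = ennreal (gauss_moment k) * (\<integral>\<^sup>+\<omega>. ennreal ((1 + T \<omega>) ^ k) \<partial>M)"
        by (rule nn_integral_cmult) measurable
      also have "\<dots> \<le> ennreal (gauss_moment k) * ennreal (lifetime_moment_bound V k)"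
        by (intro mult_left_mono exponential_moment_le(2)[OF T V]) auto
      finally show ?thesis
        using gauss_moment_pos[of k] lifetime_moment_bound_pos[OF V, of k] by (simp add: ennreal_mult)
    qed
    have "liminf (\<lambda>m. \<integral>\<^sup>+\<omega>. ennreal (?D m \<omega> ^ (2 * k)) \<partial>M)
        \<le> limsup (\<lambda>m. \<integral>\<^sup>+\<omega>. ennreal (?D m \<omega> ^ (2 * k)) \<partial>M)"
      by (intro Liminf_le_Limsup) auto
    also have "\<dots> \<le> ennreal (gauss_moment k * lifetime_moment_bound V k)"
      using le by (intro Limsup_bounded) auto
    finally show ?thesis .
  qed
  finally show ?thesis .
qed

text \<open>At fixed times the sine transforms vanish. Adding 1 makes the integrand nonnegative, so that the
  lifetime can be averaged out with \<open>nn_integral_at_dyadic_floor\<close>.\<close>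

lemma lifetime_end_symmetric:
  "distr M borel (\<lambda>\<omega>. - path_end (\<lambda>t. y t \<omega>) (T \<omega>)) = distr M borel (\<lambda>\<omega>. path_end (\<lambda>t. y t \<omega>) (T \<omega>))"
proof (rule symmetric_law_of_sin)
  note [measurable] = lifetime_measurables
  show "(\<lambda>\<omega>. path_end (\<lambda>t. y t \<omega>) (T \<omega>)) \<in> borel_measurable M" by measurable
  fix z
  have y0: "AE \<omega> in M. y 0 \<omega> = 0" using y by (simp add: stable_process_def)
  \<comment> \<open>Fixed times first; the increment from time 0 is the position itself.\<close>
  have fixed: "(\<integral>\<^sup>+\<omega>. ennreal (1 + sin (z * y t \<omega>)) \<partial>M) = 1" if t: "0 \<le> t" for t
  proof -
    have [measurable]: "y t \<in> borel_measurable M" "y 0 \<in> borel_measurable M"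
      using measurable_motion t by auto
    have "expectation (\<lambda>\<omega>. sin (z * y t \<omega>)) = expectation (\<lambda>\<omega>. sin (z * (y t \<omega> - y 0 \<omega>)))"
      using y0 by (intro integral_cong_AE) auto
    then have 0: "expectation (\<lambda>\<omega>. sin (z * y t \<omega>)) = 0"
      using stable_process_increment_sin[OF y order_refl t] by simp
    have i: "integrable M (\<lambda>\<omega>. sin (z * y t \<omega>))"
      by (intro integrable_const_bound[where B=1]) auto
    have "(\<integral>\<^sup>+\<omega>. ennreal (1 + sin (z * y t \<omega>)) \<partial>M) = ennreal (expectation (\<lambda>\<omega>. 1 + sin (z * y t \<omega>)))"
    proof (rule nn_integral_eq_integral)
      show "AE \<omega> in M. 0 \<le> 1 + sin (z * y t \<omega>)"
        by (intro AE_I2) (smt (verit) sin_ge_minus_one)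
    qed (use i in auto)
    then show ?thesis using i 0 by (simp add: prob_space)
  qed
  have dy: "expectation (\<lambda>\<omega>. sin (z * y (dyadic_floor m (T \<omega>)) \<omega>)) = 0" for m
  proof -
    let ?U = "\<lambda>\<omega>. y (dyadic_floor m (T \<omega>)) \<omega>"
    have i: "integrable M (\<lambda>\<omega>. sin (z * ?U \<omega>))"
      by (intro integrable_const_bound[where B=1]) auto
    have "(\<integral>\<^sup>+\<omega>. ennreal (1 + sin (z * ?U \<omega>)) \<partial>M) = (\<integral>\<^sup>+\<omega>. 1 \<partial>M)"
      by (subst nn_integral_at_dyadic_floor[of "\<lambda>x. ennreal (1 + sin (z * x))"])
        (auto simp: fixed[OF dyadic_floor_nonneg])
    also have "\<dots> = 1" by (simp add: emeasure_space_1)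
    also have "(\<integral>\<^sup>+\<omega>. ennreal (1 + sin (z * ?U \<omega>)) \<partial>M) = ennreal (expectation (\<lambda>\<omega>. 1 + sin (z * ?U \<omega>)))"
    proof (rule nn_integral_eq_integral)
      show "AE \<omega> in M. 0 \<le> 1 + sin (z * ?U \<omega>)"
        by (intro AE_I2) (smt (verit) sin_ge_minus_one)
    qed (use i in auto)
    finally have "expectation (\<lambda>\<omega>. 1 + sin (z * ?U \<omega>)) = 1" by (simp add: ennreal_eq_1)
    then show ?thesis using i by (simp add: prob_space)
  qed
  have "(\<lambda>m. expectation (\<lambda>\<omega>. sin (z * y (dyadic_floor m (T \<omega>)) \<omega>)))
      \<longlonglongrightarrow> expectation (\<lambda>\<omega>. sin (z * path_end (\<lambda>t. y t \<omega>) (T \<omega>)))"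
  proof (rule integral_dominated_convergence[where w="\<lambda>_. 1"])
    show "AE \<omega> in M. (\<lambda>m. sin (z * y (dyadic_floor m (T \<omega>)) \<omega>)) \<longlonglongrightarrow> sin (z * path_end (\<lambda>t. y t \<omega>) (T \<omega>))"
      using lifetime_end_tendsto by eventually_elim (intro tendsto_intros)
  qed auto
  then show "expectation (\<lambda>\<omega>. sin (z * path_end (\<lambda>t. y t \<omega>) (T \<omega>))) = 0"
    unfolding dy by (simp add: LIMSEQ_const_iff)
qed

text \<open>A path whose supremum is at least \<open>x\<close> exceeds \<open>x / 2\<close> at some dyadic time before the end of its
  life. Given the lifetime, that is controlled by \<open>brownian_grid_maximal\<close> on the next integer
  horizon.\<close>

lemma lifetime_sup_tail:
  assumes x: "0 < x"
  shows "prob {\<omega>\<in>space M. x \<le> path_sup (\<lambda>t. y t \<omega>) (T \<omega>)}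
    \<le> 2 * gauss_moment k * lifetime_moment_bound V k * (2 / x) ^ (2 * k)"
proof -
  note [measurable] = lifetime_measurables
  let ?a = "x / 2"
  let ?Q = "{z \<in> space (borel \<Otimes>\<^sub>M PiM {0..} (\<lambda>_. borel :: real measure)).
      \<exists>j m. real j / 2 ^ m \<le> fst z \<and> ?a < snd z (real j / 2 ^ m)}"
  let ?c = "2 * gauss_moment k * (2 / x) ^ (2 * k)"
  have [measurable]: "y (real j / 2 ^ m) \<in> borel_measurable M" for j m :: nat
    by (rule measurable_motion) simp
  have c: "0 \<le> ?c" using x gauss_moment_pos[of k] by simp
  have [measurable]: "(\<lambda>z. snd z (real j / 2 ^ m)) \<in> borel_measurable (borel \<Otimes>\<^sub>M PiM {0..} (\<lambda>_. borel :: real measure))"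
    for j m :: nat
    by (rule measurable_compose[OF measurable_snd measurable_component_singleton]) simp
  have Q[measurable]: "?Q \<in> sets (borel \<Otimes>\<^sub>M PiM {0..} (\<lambda>_. borel :: real measure))"
    by measurable
  have "AE \<omega> in M. continuous_on {0..} (\<lambda>t. y t \<omega>)" using y by (simp add: stable_process_def)
  with exponential_moment_le(1)[OF T V]
  have "AE \<omega> in M. \<omega> \<in> {\<omega>\<in>space M. x \<le> path_sup (\<lambda>t. y t \<omega>) (T \<omega>)} \<longrightarrow>
     \<omega> \<in> {\<omega>\<in>space M. \<exists>j m. real j / 2 ^ m \<le> T \<omega> \<and> ?a < y (real j / 2 ^ m) \<omega>}"
  proof eventually_elim
    case (elim \<omega>)
    then show ?case using x less_path_supD[of "\<lambda>t. y t \<omega>" "T \<omega>" ?a] by auto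
  qed
  then have "ennreal (prob {\<omega>\<in>space M. x \<le> path_sup (\<lambda>t. y t \<omega>) (T \<omega>)})
      \<le> prob {\<omega>\<in>space M. \<exists>j m. real j / 2 ^ m \<le> T \<omega> \<and> ?a < y (real j / 2 ^ m) \<omega>}"
    by (intro ennreal_leI finite_measure_mono_AE) measurable
  also have "\<dots> = (\<integral>\<^sup>+\<omega>. indicator ?Q (T \<omega>, \<lambda>t\<in>{0..}. y t \<omega>) \<partial>M)"
  proof -
    have "(\<integral>\<^sup>+\<omega>. indicator ?Q (T \<omega>, \<lambda>t\<in>{0..}. y t \<omega>) \<partial>M) =
       (\<integral>\<^sup>+\<omega>. indicator {\<omega>\<in>space M. \<exists>j m. real j / 2 ^ m \<le> T \<omega> \<and> ?a < y (real j / 2 ^ m) \<omega>} \<omega> \<partial>M)"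
      by (intro nn_integral_cong) (auto simp: indicator_def space_pair_measure space_PiM)
    then show ?thesis by (simp add: emeasure_eq_measure)
  qed
  also have "\<dots> = (\<integral>\<^sup>+\<omega>. \<integral>\<^sup>+\<omega>'. indicator ?Q (T \<omega>, \<lambda>t\<in>{0..}. y t \<omega>') \<partial>M \<partial>M)"
    by (rule nn_integral_indep_pair[OF ind]) measurable
  also have "\<dots> \<le> (\<integral>\<^sup>+\<omega>. ennreal ?c * ennreal ((1 + T \<omega>) ^ k) \<partial>M)"
  proof (rule nn_integral_mono_AE, use exponential_moment_le(1)[OF T V] in eventually_elim)
    case (elim \<omega>)
    define n where "n = nat \<lceil>T \<omega>\<rceil>"
    have n: "T \<omega> \<le> real n" "real n \<le> 1 + T \<omega>" using elim unfolding n_def by linarith+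
    have "(\<integral>\<^sup>+\<omega>'. indicator ?Q (T \<omega>, \<lambda>t\<in>{0..}. y t \<omega>') \<partial>M) \<le>
        (\<integral>\<^sup>+\<omega>'. indicator {\<omega>'\<in>space M. \<exists>j m. real j / 2 ^ m \<le> real n \<and> ?a < y (real j / 2 ^ m) \<omega>'} \<omega>' \<partial>M)"
      using n(1) by (intro nn_integral_mono) (auto simp: indicator_def intro: order_trans)
    also have "\<dots> = prob {\<omega>'\<in>space M. \<exists>j m. real j / 2 ^ m \<le> real n \<and> ?a < y (real j / 2 ^ m) \<omega>'}"
      by (simp add: emeasure_eq_measure)
    also have "\<dots> \<le> ennreal (2 * gauss_moment k * real n ^ k / ?a ^ (2 * k))"
      using x by (intro ennreal_leI brownian_grid_maximal[OF y]) auto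
    also have "2 * gauss_moment k * real n ^ k / ?a ^ (2 * k) = ?c * real n ^ k"
      by (simp add: power_divide)
    also have "ennreal (?c * real n ^ k) \<le> ennreal (?c * (1 + T \<omega>) ^ k)"
      using n c by (intro ennreal_leI mult_left_mono power_mono) auto
    also have "\<dots> = ennreal ?c * ennreal ((1 + T \<omega>) ^ k)"
      using c elim by (intro ennreal_mult) auto
    finally show ?case .
  qed
  also have "\<dots> = ennreal ?c * (\<integral>\<^sup>+\<omega>. ennreal ((1 + T \<omega>) ^ k) \<partial>M)"
    by (rule nn_integral_cmult) measurable
  also have "\<dots> \<le> ennreal ?c * ennreal (lifetime_moment_bound V k)"
    by (intro mult_left_mono exponential_moment_le(2)[OF T V]) auto
  also have "\<dots> = ennreal (?c * lifetime_moment_bound V k)"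
    using c lifetime_moment_bound_pos[OF V, of k] by (simp add: ennreal_mult)
  finally show ?thesis
    using mult_nonneg_nonneg[OF c less_imp_le[OF lifetime_moment_bound_pos[OF V, of k]]]
    by (subst (asm) ennreal_le_iff) (simp_all add: mult_ac)
qed

end

end

section \<open>Independence and marks in the branching particle system\<close>

text \<open>The case of Brownian motion, with the positivity assumptions that the extinction and
  displacement estimates share.\<close>

locale brownian_branching_system = branching_particle_system M 2 \<beta> \<gamma> V n X T K Y
  for M :: "'w measure" and \<beta> \<gamma> V :: real
    and n :: "'w \<Rightarrow> enat"
    and X :: "nat \<Rightarrow> 'w \<Rightarrow> 'b::euclidean_space"
    and T :: "nat \<Rightarrow> nat list \<Rightarrow> 'w \<Rightarrow> real"
    and K :: "nat \<Rightarrow> nat list \<Rightarrow> 'w \<Rightarrow> nat"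
    and Y :: "nat \<Rightarrow> nat list \<Rightarrow> real \<Rightarrow> 'w \<Rightarrow> 'b" +
  assumes beta: "0 < \<beta>" and V: "0 < V"
begin

text \<open>All independence statements reduce to one: families of sources without common members
  generate independent sigma-algebras.\<close>

definition generated_by :: "randomness_source set \<Rightarrow> 'w measure" where
  "generated_by J = sigma (space M) (\<Union>r\<in>J. sets (source_algebra M n X T K Y r))"

lemma source_sets_subset: "sets (source_algebra M n X T K Y r) \<subseteq> events"
  using independent by (auto simp: indep_sets_def)

lemma sets_generated_by:
  "sets (generated_by J) = sigma_sets (space M) (\<Union>r\<in>J. sets (source_algebra M n X T K Y r))"
  unfolding generated_by_def using source_sets_subset sets.space_closed
  by (intro sets_measure_of) blast

lemma space_generated_by [simp]: "space (generated_by J) = space M"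
  unfolding generated_by_def using source_sets_subset sets.space_closed
  by (intro space_measure_of) blast

lemma sets_generated_by_subset: "sets (generated_by J) \<subseteq> events"
  unfolding sets_generated_by using source_sets_subset
  by (intro sets.sigma_sets_subset) blast

lemma measurable_generated_byD: "f \<in> measurable (generated_by J) N \<Longrightarrow> f \<in> measurable M N"
  using sets_generated_by_subset[of J] by (auto simp: measurable_def)

lemma measurable_from_source:
  assumes "r \<in> J" and "f \<in> measurable (source_algebra M n X T K Y r) N"
    and sp: "space (source_algebra M n X T K Y r) = space M"
  shows "f \<in> measurable (generated_by J) N"
proof -
  have "sets (source_algebra M n X T K Y r) \<subseteq> sets (generated_by J)"
    unfolding sets_generated_by using assms(1) by (auto intro: sigma_sets.Basic)
  then show ?thesis using assms(2) sp by (auto simp: measurable_def)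
qed

lemma measurable_T_generated: "Lifetime i u \<in> J \<Longrightarrow> T i u \<in> borel_measurable (generated_by J)"
  by (erule measurable_from_source) (auto intro!: measurable_vimage_algebra1)

lemma measurable_K_generated: "Offspring i u \<in> J \<Longrightarrow> K i u \<in> measurable (generated_by J) (count_space UNIV)"
  by (erule measurable_from_source) (auto intro!: measurable_vimage_algebra1)

lemma measurable_path_generated:
  "Motion i u \<in> J \<Longrightarrow> (\<lambda>\<omega>. \<lambda>t\<in>{0..}. Y i u t \<omega>) \<in> measurable (generated_by J) (PiM {0..} (\<lambda>_. borel))"
  by (erule measurable_from_source) (auto intro!: measurable_vimage_algebra1 simp: space_PiM)

lemma measurable_Y_generated:
  assumes "Motion i u \<in> J" and "0 \<le> t"
  shows "Y i u t \<in> borel_measurable (generated_by J)"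
  using measurable_compose[OF measurable_path_generated[OF assms(1)] measurable_component_singleton[of t]] assms(2)
  by simp

lemma measurable_initial_generated:
  "Initial \<in> J \<Longrightarrow> (\<lambda>\<omega>. (n \<omega>, \<lambda>i. X i \<omega>)) \<in>
     measurable (generated_by J) (count_space UNIV \<Otimes>\<^sub>M (\<Pi>\<^sub>M i\<in>UNIV. borel))"
  by (erule measurable_from_source) (auto intro!: measurable_vimage_algebra1 simp: space_PiM space_pair_measure)

lemma indep_sets_blocks:
  assumes "disjoint_family_on J L"
  shows "indep_sets (\<lambda>l. sets (generated_by (J l))) L"
  unfolding sets_generated_by
  by (rule indep_sets_collect_sigma)
    (auto intro!: assms sets.Int_stable intro: indep_sets_mono_index[OF _ independent])

lemma indep_vars_blocks:
  assumes J: "disjoint_family_on J L"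
    and f: "\<And>l. l \<in> L \<Longrightarrow> f l \<in> measurable (generated_by (J l)) (N l)"
  shows "indep_vars N f L"
  unfolding indep_vars_def2
proof (intro conjI ballI)
  show "random_variable (N l) (f l)" if "l \<in> L" for l
    by (rule measurable_generated_byD[OF f[OF that]])
  show "indep_sets (\<lambda>l. {f l -` A \<inter> space M |A. A \<in> sets (N l)}) L"
  proof (rule indep_sets_mono_sets[OF indep_sets_blocks[OF J]])
    fix l assume "l \<in> L"
    then show "{f l -` A \<inter> space M |A. A \<in> sets (N l)} \<subseteq> sets (generated_by (J l))"
      using measurable_sets[OF f] by auto
  qed
qed

lemma indep_pair_blocks:
  assumes J: "J1 \<inter> J2 = {}"
    and f: "f \<in> measurable (generated_by J1) N1" and h: "h \<in> measurable (generated_by J2) N2"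
  shows "indep_pair N1 f N2 h"
  unfolding indep_pair_def
proof (intro conjI ballI)
  show "f \<in> measurable M N1" "h \<in> measurable M N2"
    using f h by (auto intro: measurable_generated_byD)
  fix A B assume A: "A \<in> sets N1" and B: "B \<in> sets N2"
  let ?J = "\<lambda>b. if b then J1 else J2" and ?A = "\<lambda>b. if b then f -` A \<inter> space M else h -` B \<inter> space M"
  have "indep_sets (\<lambda>b. sets (generated_by (?J b))) UNIV"
    using J by (intro indep_sets_blocks) (auto simp: disjoint_family_on_def)
  then have "prob (\<Inter>b\<in>UNIV. ?A b) = (\<Prod>b\<in>UNIV. prob (?A b))"
    using measurable_sets[OF f A] measurable_sets[OF h B] by (intro indep_setsD) auto
  then show "prob ((f -` A \<inter> space M) \<inter> (h -` B \<inter> space M))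
      = prob (f -` A \<inter> space M) * prob (h -` B \<inter> space M)"
    by (simp add: UNIV_bool Int_commute mult.commute)
qed

definition label_sources :: "nat \<Rightarrow> nat list \<Rightarrow> randomness_source set" where
  "label_sources i u = {Lifetime i u, Offspring i u, Motion i u}"

text \<open>The mark of a particle in direction \<open>e\<close>; see \<open>subtree_max\<close> for the meaning of its components.\<close>

definition mark :: "'b \<Rightarrow> nat \<Rightarrow> nat list \<Rightarrow> 'w \<Rightarrow> nat \<times> real \<times> real" where
  "mark e i u \<omega> = (K i u \<omega>, path_sup (\<lambda>t. e \<bullet> Y i u t \<omega>) (T i u \<omega>),
     path_end (\<lambda>t. e \<bullet> Y i u t \<omega>) (T i u \<omega>))"

lemma measurable_displacement_generated:
  assumes "Lifetime i u \<in> J" "Motion i u \<in> J"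
  shows "(\<lambda>\<omega>. snd (mark e i u \<omega>)) \<in> measurable (generated_by J) (borel \<Otimes>\<^sub>M borel)"
proof -
  have "(\<lambda>\<omega>. e \<bullet> Y i u t \<omega>) \<in> borel_measurable (generated_by J)" if "0 \<le> t" for t
    using measurable_Y_generated[OF assms(2) that] by measurable
  then show ?thesis unfolding mark_def snd_conv
    by (intro measurable_Pair measurable_path_sup measurable_path_end measurable_T_generated assms) auto
qed

lemma measurable_mark_generated:
  assumes "label_sources i u \<subseteq> J"
  shows "mark e i u \<in> measurable (generated_by J) mark_space"
proof -
  have "(\<lambda>\<omega>. (K i u \<omega>, snd (mark e i u \<omega>))) \<in> measurable (generated_by J) mark_space"
    using assms unfolding label_sources_def
    by (intro measurable_Pair measurable_K_generated measurable_displacement_generated) auto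
  then show ?thesis by (simp add: mark_def[abs_def])
qed

lemma indep_marks: "indep_vars (\<lambda>_. mark_space) (mark e i) UNIV"
  by (rule indep_vars_blocks[where J="label_sources i"])
    (auto simp: disjoint_family_on_def label_sources_def intro!: measurable_mark_generated)

lemma indep_mark_components:
  "indep_pair (borel \<Otimes>\<^sub>M borel) (\<lambda>\<omega>. snd (mark e i u \<omega>)) (count_space UNIV) (\<lambda>\<omega>. fst (mark e i u \<omega>))"
proof (rule indep_pair_blocks[where ?J1.0="{Lifetime i u, Motion i u}" and ?J2.0="{Offspring i u}"])
  show "(\<lambda>\<omega>. snd (mark e i u \<omega>)) \<in> measurable (generated_by {Lifetime i u, Motion i u}) (borel \<Otimes>\<^sub>M borel)"
    by (rule measurable_displacement_generated) auto
  show "(\<lambda>\<omega>. fst (mark e i u \<omega>)) \<in> measurable (generated_by {Offspring i u}) (count_space UNIV)"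
    by (simp add: mark_def measurable_K_generated)
qed simp

lemma offspring_thinning:
  "0 \<le> q \<Longrightarrow> q \<le> 1 \<Longrightarrow> expectation (\<lambda>\<omega>. (1 - q) ^ K i u \<omega>) = 1 - some_child_prob \<beta> q"
  by (rule expectation_thinning[OF measurable_K beta offspring])

lemma motion_inner: "norm e = 1 \<Longrightarrow> stable_process 2 (\<lambda>t \<omega>. e \<bullet> Y i u t \<omega>)"
  by (rule stable_process_inner[OF motion])

lemma indep_lifetime_motion:
  "indep_pair borel (T i u) (PiM {0..} (\<lambda>_. borel)) (\<lambda>\<omega>. \<lambda>t\<in>{0..}. e \<bullet> Y i u t \<omega>)"
proof (rule indep_pair_blocks[where ?J1.0="{Lifetime i u}" and ?J2.0="{Motion i u}"])
  show "(\<lambda>\<omega>. \<lambda>t\<in>{0..}. e \<bullet> Y i u t \<omega>) \<in> measurable (generated_by {Motion i u}) (PiM {0..} (\<lambda>_. borel))"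
  proof (rule measurable_restrict)
    fix t :: real assume "t \<in> {0..}"
    then have "Y i u t \<in> borel_measurable (generated_by {Motion i u})"
      by (intro measurable_Y_generated) auto
    then show "(\<lambda>\<omega>. e \<bullet> Y i u t \<omega>) \<in> borel_measurable (generated_by {Motion i u})"
      by measurable
  qed
qed (auto intro!: measurable_T_generated)

text \<open>The comparison principle with the power-law supersolution. One constant \<open>a\<close> serves all ancestors,
  directions and depths, because the laws of lifetimes and motions do not depend on the label.\<close>

lemma tree_displacement_tail_uniform:
  obtains a where "1 \<le> a" "\<And>e i w m x. norm e = 1 \<Longrightarrow>
    prob {\<omega>\<in>space M. x \<le> subtree_max m w (\<lambda>u. mark e i u \<omega>)} \<le> power_tail (2 / \<beta>) a x"
proof -
  define p where "p = 2 / \<beta>"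
  have p: "0 < p" using beta by (simp add: p_def)
  \<comment> \<open>Moments of order \<open>2 * r\<close> produce tails at least as thin as \<open>x powr (- p - 2)\<close>.\<close>
  define r where "r = nat \<lceil>p + 2\<rceil>"
  have r: "p + 2 \<le> 2 * real r" "1 \<le> r" using p unfolding r_def by linarith+
  define c0 where "c0 = gauss_moment r * lifetime_moment_bound V r"
  define c where "c = 1 + gauss_moment 1 * lifetime_moment_bound V 1 + c0 + 2 * c0 * 2 ^ (2 * r)"
  have pos: "0 < gauss_moment k * lifetime_moment_bound V k" for k
    using gauss_moment_pos lifetime_moment_bound_pos[OF V] by (intro mult_pos_pos)
  have c0: "0 < c0" unfolding c0_def by (rule pos)
  have c: "1 \<le> c" "gauss_moment 1 * lifetime_moment_bound V 1 \<le> c" "c0 \<le> c" "2 * c0 * 2 ^ (2 * r) \<le> c"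
    unfolding c_def using c0 pos[of 1] by (auto intro: add_increasing)
  \<comment> \<open>For \<open>x \<le> 1\<close> the power is at least 1 and the bound is trivial; this is why \<open>c\<close> is at least 1.\<close>
  have to_powr: "q \<le> c * x powr (- p - 2)"
    if "q \<le> 1" "q \<le> c' / x ^ (2 * r)" "c' \<le> c" "0 < x" for q x c'
  proof (cases "x \<le> 1")
    case True
    have "1 powr (- p - 2) \<le> x powr (- p - 2)" using True that p by (intro powr_mono2') auto
    then have "1 * 1 \<le> c * x powr (- p - 2)" using c by (intro mult_mono) auto
    then show ?thesis using that by simp
  next
    case False
    have "q \<le> c' * x powr (- real (2 * r))"
      using that powr_realpow[of x "2 * r"] by (simp only: powr_minus divide_inverse)
    also have "\<dots> \<le> c * x powr (- real (2 * r))" using that by (intro mult_right_mono) auto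
    also have "\<dots> \<le> c * x powr (- p - 2)"
      using False r c by (intro mult_left_mono powr_mono) auto
    finally show ?thesis .
  qed
  define B where "B = 2 * (1 + \<beta>) * c * (p * (p + 1) * 2 powr (p + 2) + 2 powr (p + 2) + 1)"
  define a where "a = max 1 (sqrt B)"
  have a: "1 \<le> a" "B \<le> a\<^sup>2"
  proof -
    show "1 \<le> a" by (simp add: a_def)
    have "0 \<le> B" unfolding B_def using beta c p by (intro mult_nonneg_nonneg add_nonneg_nonneg) auto
    then have "B = (sqrt B)\<^sup>2" by simp
    also have "\<dots> \<le> a\<^sup>2" using \<open>0 \<le> B\<close> by (intro power_mono) (auto simp: a_def)
    finally show "B \<le> a\<^sup>2" .
  qed
  have "prob {\<omega>\<in>space M. x \<le> subtree_max m w (\<lambda>u. mark e i u \<omega>)} \<le> power_tail p a x"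
    if e: "norm e = 1" for e i w m x
  proof (rule subtree_max_tail_le[OF indep_marks indep_mark_components, where g="some_child_prob \<beta>"])
    show "expectation (\<lambda>\<omega>. (1 - q) ^ fst (mark e i u \<omega>)) = 1 - some_child_prob \<beta> q" if "0 \<le> q" "q \<le> 1" for u q
      using offspring_thinning[OF that] by (simp add: mark_def)
    show "0 \<le> power_tail p a x" "power_tail p a x \<le> 1" for x
      using power_tail_pos[of p a x] power_tail_le_1[of p a x] p by auto
    fix u x assume x: "power_tail p a x < 1"
    note prems = motion_inner[OF e, of i u] V lifetime[of i u] indep_lifetime_motion[of i u e]
    let ?S = "\<lambda>\<omega>. path_sup (\<lambda>t. e \<bullet> Y i u t \<omega>) (T i u \<omega>)"
    let ?D = "\<lambda>\<omega>. path_end (\<lambda>t. e \<bullet> Y i u t \<omega>) (T i u \<omega>)"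
    have D[measurable]: "?D \<in> borel_measurable M" by (rule measurable_lifetime_end[OF prems])
    have sym: "distr M borel (\<lambda>\<omega>. - ?D \<omega>) = distr M borel ?D" by (rule lifetime_end_symmetric[OF prems])
    have m2: "(\<integral>\<^sup>+\<omega>. ennreal ((?D \<omega>)\<^sup>2) \<partial>M) \<le> ennreal (gauss_moment 1 * lifetime_moment_bound V 1)"
      using lifetime_end_moment[OF prems, of 1] by simp
    have D2: "integrable M (\<lambda>\<omega>. (?D \<omega>)\<^sup>2)"
      using m2 by (intro integrableI_nonneg) (auto simp: less_top[symmetric] top_unique)
    have "ennreal (expectation (\<lambda>\<omega>. (?D \<omega>)\<^sup>2)) \<le> ennreal (gauss_moment 1 * lifetime_moment_bound V 1)"
      using m2 by (subst nn_integral_eq_integral[symmetric, OF D2]) auto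
    then have ED2: "expectation (\<lambda>\<omega>. (?D \<omega>)\<^sup>2) \<le> c"
      using pos[of 1] c by (subst (asm) ennreal_le_iff) auto
    have D1: "integrable M ?D" by (rule square_integrable_imp_integrable[OF D D2])
    have "prob {\<omega>\<in>space M. x \<le> ?S \<omega>}
       + expectation (\<lambda>\<omega>. some_child_prob \<beta> (power_tail p a (x - ?D \<omega>))) \<le> power_tail p a x"
    proof (rule power_tail_supersolution[OF beta p_def _ D D2 ED2 D1 symmetric_law_mean[OF D sym]
          symmetric_law_half[OF D sym]])
      show "0 \<le> c" using c by simp
      fix x :: real assume x: "0 < x"
      have "prob {\<omega>\<in>space M. x \<le> ?S \<omega>} \<le> (2 * c0 * 2 ^ (2 * r)) / x ^ (2 * r)"
        using lifetime_sup_tail[OF prems x, of r] by (simp add: c0_def power_divide mult_ac)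
      then show "prob {\<omega>\<in>space M. x \<le> ?S \<omega>} \<le> c * x powr (- p - 2)"
        using c x by (intro to_powr[OF prob_le_1])
      have "prob {\<omega>\<in>space M. x \<le> ?D \<omega>} \<le> c0 / x ^ (2 * r)"
        using lifetime_end_moment[OF prems, of r] c0 x
        by (intro even_moment_tail) (auto simp: c0_def)
      then show "prob {\<omega>\<in>space M. x \<le> ?D \<omega>} \<le> c * x powr (- p - 2)"
        using c x by (intro to_powr[OF prob_le_1])
    qed (use a x in \<open>auto simp: B_def\<close>)
    then show "prob {\<omega>\<in>space M. x \<le> fst (snd (mark e i u \<omega>))}
       + expectation (\<lambda>\<omega>. some_child_prob \<beta> (power_tail p a (x - snd (snd (mark e i u \<omega>))))) \<le> power_tail p a x"
      by (simp add: mark_def)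
  qed measurable
  then show ?thesis using a(1) that by (auto simp: p_def)
qed

end

section \<open>Extinction and positions of particles\<close>

text \<open>The condition on the index is common to all particles of a family; the rest depends only on the
  offspring numbers, so the marks may carry arbitrary displacements \<open>f\<close>.\<close>

lemma exists_label_iff_in_tree:
  "exists_label n K i u \<omega> \<longleftrightarrow> enat i < n \<omega> \<and> in_tree (\<lambda>u. (K i u \<omega>, f u)) u"
  by (induction u) auto

context brownian_branching_system
begin

lemma measurable_subtree_max_marks:
  assumes "range (\<lambda>u. u @ w) \<subseteq> L" and "(\<Union>u\<in>L. label_sources i u) \<subseteq> J"
  shows "(\<lambda>\<omega>. subtree_max m w (\<lambda>u. mark e i u \<omega>)) \<in> borel_measurable (generated_by J)"
proof -
  have "(\<lambda>\<omega>. \<lambda>u\<in>L. mark e i u \<omega>) \<in> measurable (generated_by J) (PiM L (\<lambda>_. mark_space))"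
    using assms(2) by (intro measurable_restrict measurable_mark_generated) auto
  from measurable_compose[OF this measurable_subtree_max[OF assms(1)]]
  have "(\<lambda>\<omega>. subtree_max m w (\<lambda>u\<in>L. mark e i u \<omega>)) \<in> borel_measurable (generated_by J)" .
  moreover have "subtree_max m w (\<lambda>u\<in>L. mark e i u \<omega>) = subtree_max m w (\<lambda>u. mark e i u \<omega>)" for \<omega>
    using assms(1) by (intro subtree_max_cong) auto
  ultimately show ?thesis by simp
qed

text \<open>Give every particle the displacement 1. Then \<open>subtree_max\<close> measures the height of the tree, and the
  comparison principle with \<open>v x = survival_bound \<beta> (nat \<lceil>x\<rceil>)\<close> bounds the probability that the family
  lives for \<open>h\<close> generations by \<open>survival_bound \<beta> h\<close>. As this tends to 0, the height is almost surely
  finite.\<close>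

lemma extinction: "AE \<omega> in M. \<forall>i. finite {u. exists_label n K i u \<omega>}"
proof (subst AE_all_countable, intro allI)
  fix i
  define Z where "Z = (\<lambda>u \<omega>. (K i u \<omega>, 0::real, 1::real))"
  define v where "v x = survival_bound \<beta> (nat \<lceil>x\<rceil>)" for x :: real
  have mZ: "Z u \<in> measurable (generated_by (label_sources i u)) mark_space" for u
    unfolding Z_def by (intro measurable_Pair measurable_K_generated) (auto simp: label_sources_def)
  have ind: "indep_vars (\<lambda>_. mark_space) Z UNIV"
    by (rule indep_vars_blocks[where J="label_sources i"])
      (auto simp: disjoint_family_on_def label_sources_def intro!: mZ[unfolded label_sources_def])
  have [measurable]: "K i u \<in> measurable M (count_space UNIV)" for u by (rule measurable_K)
  have [measurable]: "(\<lambda>\<omega>. subtree_max m [] (\<lambda>u. Z u \<omega>)) \<in> borel_measurable M" for m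
  proof -
    have "(\<lambda>\<omega>. \<lambda>u\<in>UNIV. Z u \<omega>) \<in> measurable M (PiM UNIV (\<lambda>_. mark_space))"
      using measurable_generated_byD[OF mZ] by (intro measurable_restrict) auto
    from measurable_compose[OF this measurable_subtree_max[of "[]" UNIV m]] show ?thesis
      by (simp add: restrict_def)
  qed
  have depth: "prob {\<omega>\<in>space M. \<exists>m. x \<le> subtree_max m [] (\<lambda>u. Z u \<omega>)} \<le> v x" for x
  proof (rule prob_some_depth_le)
    fix m
    show "prob {\<omega>\<in>space M. x \<le> subtree_max m [] (\<lambda>u. Z u \<omega>)} \<le> v x"
    proof (rule subtree_max_tail_le[OF ind, where g="some_child_prob \<beta>"])
      show "indep_pair (borel \<Otimes>\<^sub>M borel) (\<lambda>\<omega>. snd (Z u \<omega>)) (count_space UNIV) (\<lambda>\<omega>. fst (Z u \<omega>))" for u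
        unfolding Z_def
        by (rule indep_pair_blocks[where ?J1.0="{}" and ?J2.0="{Offspring i u}"])
          (auto intro: measurable_K_generated)
      show "expectation (\<lambda>\<omega>. (1 - q) ^ fst (Z u \<omega>)) = 1 - some_child_prob \<beta> q"
        if "0 \<le> q" "q \<le> 1" for u q
        using offspring_thinning[OF that] by (simp add: Z_def)
      show "v \<in> borel_measurable borel" unfolding v_def by measurable
      show "0 \<le> v x" "v x \<le> 1" for x
        using survival_bound_01[OF beta] by (auto simp: v_def)
      fix u x assume "v x < 1"
      then have x: "0 < x" by (cases "0 < x") (auto simp: v_def not_less)
      then have "nat \<lceil>x\<rceil> = Suc (nat \<lceil>x - 1\<rceil>)" by linarith
      then have "v x = some_child_prob \<beta> (v (x - 1))" by (simp add: v_def)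
      then show "prob {\<omega>\<in>space M. x \<le> fst (snd (Z u \<omega>))}
          + expectation (\<lambda>\<omega>. some_child_prob \<beta> (v (x - snd (snd (Z u \<omega>))))) \<le> v x"
        using x by (simp add: Z_def prob_space)
    qed measurable
  next
    show "subtree_max m [] (\<lambda>u. Z u \<omega>) \<le> subtree_max (Suc m) [] (\<lambda>u. Z u \<omega>)" for m \<omega>
      by (rule subtree_max_mono_Suc)
  qed measurable
  define E where "E h = {\<omega>\<in>space M. \<exists>m. real h \<le> subtree_max m [] (\<lambda>u. Z u \<omega>)}" for h :: nat
  have [measurable]: "E h \<in> events" for h unfolding E_def by measurable
  have "prob (\<Inter>h. E h) \<le> survival_bound \<beta> h" for h
  proof -
    have "prob (\<Inter>h. E h) \<le> prob (E h)" by (intro finite_measure_mono) auto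
    also have "\<dots> \<le> survival_bound \<beta> h" using depth[of "real h"] by (simp add: E_def v_def)
    finally show ?thesis .
  qed
  then have "prob (\<Inter>h. E h) \<le> 0"
    by (intro LIMSEQ_le_const[OF survival_bound_tendsto_0[OF beta]]) auto
  then have "prob (\<Inter>h. E h) = 0" using measure_nonneg[of M "\<Inter>h. E h"] by linarith
  then have "AE \<omega> in M. \<omega> \<notin> (\<Inter>h. E h)"
    by (intro AE_not_in) (auto simp: null_sets_def emeasure_eq_measure)
  then show "AE \<omega> in M. finite {u. exists_label n K i u \<omega>}"
  proof (rule AE_mp, intro AE_I2 impI)
    fix \<omega> assume "\<omega> \<in> space M" "\<omega> \<notin> (\<Inter>h. E h)"
    then obtain h where h: "\<And>m. subtree_max m [] (\<lambda>u. Z u \<omega>) < real h"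
      by (auto simp: E_def not_le)
    have "displacement (\<lambda>u. Z u \<omega>) u = real (length u)" for u
      by (induction u) (auto simp: Z_def)
    then have "length u < h" if "in_tree (\<lambda>u. Z u \<omega>) u" for u
      using displacement_le_subtree_max[OF that, of 0] h[of "length u"] by (simp add: Z_def)
    then have "finite {u. in_tree (\<lambda>u. Z u \<omega>) u}" by (rule finite_in_tree)
    then show "finite {u. exists_label n K i u \<omega>}"
      unfolding Z_def exists_label_iff_in_tree[where f="\<lambda>_. (0, 1)"]
      by (rule rev_finite_subset) auto
  qed
qed

text \<open>The almost sure properties of lifetimes and paths on which the path-by-path arguments rest.\<close>

definition regular :: "nat \<Rightarrow> 'w \<Rightarrow> bool" where
  "regular i \<omega> \<longleftrightarrow> (\<forall>u. 0 < T i u \<omega> \<and> continuous_on {0..} (\<lambda>t. Y i u t \<omega>))"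

lemma AE_regular: "AE \<omega> in M. \<forall>i. regular i \<omega>"
proof -
  have "AE \<omega> in M. 0 < T i u \<omega> \<and> continuous_on {0..} (\<lambda>t. Y i u t \<omega>)" for i u
  proof -
    have "AE \<omega> in M. continuous_on {0..} (\<lambda>t. Y i u t \<omega>)"
      using motion[of i u] by (simp add: stable_process_def)
    with exponential_moment_le(1)[OF lifetime V] show ?thesis by eventually_elim blast
  qed
  then show ?thesis unfolding regular_def by (simp add: AE_all_countable)
qed

lemma inner_birth_place:
  assumes "regular i \<omega>"
  shows "e \<bullet> birth_place X T Y i u \<omega> = e \<bullet> X i \<omega> + displacement (\<lambda>u. mark e i u \<omega>) u"
proof (induction u)
  case (Cons k u)
  have "path_end (\<lambda>t. e \<bullet> Y i u t \<omega>) (T i u \<omega>) = e \<bullet> Y i u (T i u \<omega>) \<omega>"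
    using assms by (intro path_end_eq continuous_intros) (auto simp: regular_def less_imp_le)
  then show ?case using Cons by (simp add: inner_add_right mark_def)
qed simp

text \<open>Along the line of descent the displacements at death add up to the birth place, and the
  displacement since birth is at most the maximum recorded in the mark.\<close>

lemma inner_position_le:
  assumes reg: "regular i \<omega>" and alive: "(i, u) \<in> alive n T K t \<omega>"
  shows "e \<bullet> (particle_position X T Y t \<omega> (i, u) - X i \<omega>)
      \<le> subtree_max (length u) [] (\<lambda>u. mark e i u \<omega>)"
proof -
  define s where "s = t - birth_time T i u \<omega>"
  have s: "0 \<le> s" "s \<le> T i u \<omega>" and ex: "exists_label n K i u \<omega>"
    using alive by (auto simp: alive_def s_def)
  have "in_tree (\<lambda>u. mark e i u \<omega>) u"
    using ex unfolding exists_label_iff_in_tree[where f="\<lambda>u. snd (mark e i u \<omega>)"]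
    by (simp add: mark_def)
  note bound = displacement_le_subtree_max[OF this, of 0]
  have "e \<bullet> Y i u s \<omega> \<le> path_sup (\<lambda>t. e \<bullet> Y i u t \<omega>) (T i u \<omega>)"
    using s reg by (intro le_path_sup continuous_intros) (auto simp: regular_def less_imp_le)
  then have "e \<bullet> Y i u s \<omega> \<le> subtree_max 0 u (\<lambda>u. mark e i u \<omega>)"
    by (simp add: mark_def)
  then show ?thesis
    using bound inner_birth_place[OF reg, of e u]
    by (simp add: particle_position_def s_def[symmetric] inner_diff_right inner_add_right)
qed

end

section \<open>The Poisson configuration in dyadic shells\<close>

lemma poisson_weights_sums:
  fixes m :: real
  shows "(\<lambda>k. exp (- m) * m ^ k / fact k) sums 1"
    and "(\<lambda>k. real k * (exp (- m) * m ^ k / fact k)) sums m"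
proof -
  have "(\<lambda>k. exp (- m) * (m ^ k /\<^sub>R fact k)) sums (exp (- m) * exp m)"
    by (intro sums_mult exp_converges)
  then show 1: "(\<lambda>k. exp (- m) * m ^ k / fact k) sums 1"
    by (simp add: exp_minus divide_inverse mult_ac)
  have "(\<lambda>k. m * (exp (- m) * m ^ k / fact k)) sums (m * 1)"
    using 1 by (rule sums_mult)
  also have "(\<lambda>k. m * (exp (- m) * m ^ k / fact k))
      = (\<lambda>k. real (Suc k) * (exp (- m) * m ^ Suc k / fact (Suc k)))"
    unfolding fact_Suc power_Suc of_nat_mult by (auto simp: fun_eq_iff simp del: of_nat_Suc)
  finally show "(\<lambda>k. real k * (exp (- m) * m ^ k / fact k)) sums m"
    using sums_Suc[of "\<lambda>k. real k * (exp (- m) * m ^ k / fact k)"] by simp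
qed

text \<open>The prescribed probabilities of the values \<open>k\<close> add up to 1, so the count is almost surely a natural number
  and its mean can be summed over \<open>k\<close>.\<close>

lemma (in prob_space) poisson_mean:
  assumes N: "poisson_random_measure N \<mu>" and A: "A \<in> sets \<mu>" "emeasure \<mu> A < \<infinity>"
    and [measurable]: "(\<lambda>\<omega>. emeasure (N \<omega>) A) \<in> borel_measurable M"
  shows "(\<integral>\<^sup>+\<omega>. emeasure (N \<omega>) A \<partial>M) = emeasure \<mu> A"
proof -
  define m where "m = measure \<mu> A"
  define E where "E k = {\<omega>\<in>space M. emeasure (N \<omega>) A = of_nat k}" for k :: nat
  have [measurable]: "E k \<in> events" for k unfolding E_def by measurable
  have E: "prob (E k) = exp (- m) * m ^ k / fact k" for k
    using N A unfolding poisson_random_measure_def E_def m_def by blast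
  have disj: "disjoint_family E" by (auto simp: disjoint_family_on_def E_def)
  have "(\<lambda>k. prob (E k)) sums prob (\<Union>k. E k)"
    by (rule finite_measure_UNION) (use disj in auto)
  moreover have "(\<lambda>k. prob (E k)) sums 1"
    unfolding E by (rule poisson_weights_sums)
  ultimately have "prob (\<Union>k. E k) = 1" by (rule sums_unique2)
  then have ae: "AE \<omega> in M. \<omega> \<in> (\<Union>k. E k)" by (intro AE_prob_1)
  have "(\<integral>\<^sup>+\<omega>. emeasure (N \<omega>) A \<partial>M) = (\<integral>\<^sup>+\<omega>. (\<Sum>k. of_nat k * indicator (E k) \<omega>) \<partial>M)"
  proof (rule nn_integral_cong_AE, use ae in eventually_elim)
    case (elim \<omega>)
    then obtain k where k: "\<omega> \<in> E k" by auto
    have "(\<Sum>l. of_nat l * indicator (E l) \<omega> :: ennreal) = (\<Sum>l. if l = k then of_nat k else 0)"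
      using k by (intro arg_cong[where f=suminf]) (auto simp: fun_eq_iff indicator_def E_def)
    also have "\<dots> = of_nat k" by (rule sums_unique[OF sums_single, symmetric])
    finally show ?case using k by (simp add: E_def)
  qed
  also have "\<dots> = (\<Sum>k. of_nat k * emeasure M (E k))"
    by (subst nn_integral_suminf) (auto simp: nn_integral_cmult)
  also have "\<dots> = (\<Sum>k. ennreal (real k * (exp (- m) * m ^ k / fact k)))"
    by (simp add: emeasure_eq_measure E[symmetric] ennreal_mult' ennreal_of_nat_eq_real_of_nat)
  also have "\<dots> = ennreal m"
    by (rule suminf_ennreal_eq[OF _ poisson_weights_sums(2)]) (simp add: m_def)
  also have "\<dots> = emeasure \<mu> A"
    using A by (simp add: m_def emeasure_eq_ennreal_measure)
  finally show ?thesis .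
qed

text \<open>The space is divided into the ball of radius 2 and the dyadic shells outside it; \<open>shell_radius k\<close> is
  the inner radius, hence the value 0 for \<open>k = 0\<close>.\<close>

definition shell_radius :: "nat \<Rightarrow> real" where
  "shell_radius k = (if k = 0 then 0 else 2 ^ k)"

definition shell :: "nat \<Rightarrow> 'b::euclidean_space set" where
  "shell k = {x. shell_radius k \<le> norm x \<and> norm x < 2 ^ Suc k}"

lemma sets_shell [measurable]: "shell k \<in> sets borel"
  unfolding shell_def by measurable

lemma ex_shell: "\<exists>k. x \<in> shell k"
proof -
  obtain l where l: "norm x < 2 ^ l" using real_arch_pow[of 2 "norm x"] by auto
  define k where "k = (LEAST l. norm x < 2 ^ Suc l)"
  have ex: "norm x < 2 ^ Suc l" using l by (simp add: less_le_trans)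
  have 1: "norm x < 2 ^ Suc k" unfolding k_def by (rule LeastI[of _ l]) (rule ex)
  have "2 ^ k \<le> norm x" if "k \<noteq> 0"
  proof -
    obtain k' where k': "k = Suc k'" using \<open>k \<noteq> 0\<close> by (cases k) auto
    then have "\<not> norm x < 2 ^ Suc k'" using not_less_Least[of k' "\<lambda>l. norm x < 2 ^ Suc l"] by (simp add: k_def)
    then show ?thesis by (simp add: k')
  qed
  then show ?thesis using 1 by (auto simp: shell_def shell_radius_def intro!: exI[of _ k])
qed

lemma emeasure_initial_intensity_shell:
  fixes \<gamma> :: real
  assumes g: "0 \<le> \<gamma>"
  shows "emeasure (initial_intensity \<gamma>) (shell k :: 'b::euclidean_space set)
    \<le> ennreal (unit_ball_vol (DIM('b)) * 2 ^ DIM('b) * 2 powr (real k * (real DIM('b) - \<gamma>)))"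
proof -
  let ?d = "DIM('b)"
  have "emeasure (initial_intensity \<gamma>) (shell k :: 'b set)
      = (\<integral>\<^sup>+x. ennreal (1 / (1 + norm x powr \<gamma>)) * indicator (shell k) (x :: 'b) \<partial>lborel)"
    unfolding initial_intensity_def by (subst emeasure_density) auto
  also have "\<dots> \<le> (\<integral>\<^sup>+x. ennreal (2 powr (- \<gamma> * real k)) * indicator (ball 0 (2 ^ Suc k)) (x :: 'b) \<partial>lborel)"
  proof (rule nn_integral_mono)
    fix x :: 'b
    show "ennreal (1 / (1 + norm x powr \<gamma>)) * indicator (shell k) x
        \<le> ennreal (2 powr (- \<gamma> * real k)) * indicator (ball 0 (2 ^ Suc k)) x"
    proof (cases "x \<in> shell k")
      case True
      then have x: "norm x < 2 ^ Suc k" "shell_radius k \<le> norm x" by (auto simp: shell_def)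
      have "1 / (1 + norm x powr \<gamma>) \<le> 2 powr (- \<gamma> * real k)"
      proof (cases "k = 0")
        case True
        then show ?thesis by (simp add: divide_le_eq add_pos_nonneg)
      next
        case False
        have "2 powr (\<gamma> * real k) = (2 ^ k) powr \<gamma>"
          by (simp add: powr_powr powr_realpow[symmetric] mult.commute)
        also have "\<dots> \<le> norm x powr \<gamma>"
          using x False g by (intro powr_mono2) (auto simp: shell_radius_def)
        also have "\<dots> \<le> 1 + norm x powr \<gamma>" by simp
        finally have "1 / (1 + norm x powr \<gamma>) \<le> 1 / 2 powr (\<gamma> * real k)"
          by (intro divide_left_mono mult_pos_pos) (auto intro: add_pos_nonneg)
        then show ?thesis by (simp add: powr_minus_divide)
      qed
      then show ?thesis using True x by (auto intro!: ennreal_leI)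
    qed simp
  qed
  also have "\<dots> = ennreal (2 powr (- \<gamma> * real k)) * emeasure lborel (ball (0::'b) (2 ^ Suc k))"
    by (rule nn_integral_cmult_indicator) simp
  also have "emeasure lborel (ball (0::'b) (2 ^ Suc k)) = ennreal (unit_ball_vol ?d * (2 ^ Suc k) ^ ?d)"
    by (rule emeasure_ball) simp
  also have "ennreal (2 powr (- \<gamma> * real k)) * \<dots>
      = ennreal (2 powr (- \<gamma> * real k) * (unit_ball_vol ?d * (2 ^ Suc k) ^ ?d))"
    by (subst ennreal_mult) auto
  also have "2 powr (- \<gamma> * real k) * (unit_ball_vol ?d * (2 ^ Suc k) ^ ?d)
      = unit_ball_vol ?d * 2 ^ ?d * 2 powr (real k * (real ?d - \<gamma>))"
  proof -
    have "((2::real) ^ Suc k) ^ ?d = 2 ^ ?d * 2 powr (real k * ?d)"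
      by (simp add: power_mult_distrib powr_realpow[symmetric] powr_powr)
    moreover have "(2::real) powr (real k * (real ?d - \<gamma>)) = 2 powr (- \<gamma> * real k) * 2 powr (real k * real ?d)"
      by (simp only: powr_add[symmetric]) (simp add: algebra_simps)
    ultimately show ?thesis by (simp only: mult_ac)
  qed
  finally show ?thesis .
qed

text \<open>The shell of index \<open>k\<close> has mass of order \<open>2 powr (k * (e - \<gamma>))\<close> in dimension \<open>e\<close>, and a family started there
  travels back with probability at most of order \<open>2 powr (- k * p)\<close>. The product is geometric with
  ratio \<open>2 powr (e - \<gamma> - p)\<close>, which is below 1 exactly under the dimension condition.\<close>

lemma summable_shell_series:
  fixes a R p d \<gamma> :: real
  assumes p: "0 < p" and a: "1 \<le> a" and d: "0 < d" and dp: "e < p + \<gamma>"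
  shows "summable (\<lambda>k. 2 powr (real k * (e - \<gamma>)) * power_tail p a ((shell_radius k - R) / d))"
proof (rule summable_comparison_test_ev)
  let ?q = "2 powr (e - \<gamma> - p)"
  have "filterlim (\<lambda>k::nat. (2::real) ^ k) at_top sequentially" by real_asymp
  then have "\<forall>\<^sub>F k::nat in sequentially. 2 * R \<le> 2 ^ k" by (simp add: filterlim_at_top)
  with eventually_gt_at_top[of "0::nat"]
  have ev: "\<forall>\<^sub>F k::nat in sequentially. 2 * R \<le> 2 ^ k \<and> k \<noteq> 0"
    by eventually_elim simp
  show "\<forall>\<^sub>F k in sequentially.
     norm (2 powr (real k * (e - \<gamma>)) * power_tail p a ((shell_radius k - R) / d)) \<le> (2 * d * a) powr p * ?q ^ k"
    using ev
  proof eventually_elim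
    case (elim k)
    have "2 ^ k / (2 * d * a) \<le> (shell_radius k - R) / d / a"
      using elim a d by (simp add: shell_radius_def field_simps)
    also have "\<dots> \<le> max 1 ((shell_radius k - R) / d / a)" by simp
    finally have "power_tail p a ((shell_radius k - R) / d) \<le> (2 ^ k / (2 * d * a)) powr (- p)"
      unfolding power_tail_def using p a d by (intro powr_mono2') auto
    also have "\<dots> = (2 * d * a) powr p * 2 powr (- real k * p)"
      using a d by (simp add: powr_divide powr_minus powr_realpow[symmetric] powr_powr field_simps)
    finally have "2 powr (real k * (e - \<gamma>)) * power_tail p a ((shell_radius k - R) / d)
        \<le> 2 powr (real k * (e - \<gamma>)) * ((2 * d * a) powr p * 2 powr (- real k * p))"
      by (intro mult_left_mono) auto
    also have "\<dots> = (2 * d * a) powr p * 2 powr (real k * (e - \<gamma>) + (- real k * p))"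
      by (simp only: powr_add mult_ac)
    also have "real k * (e - \<gamma>) + (- real k * p) = (e - \<gamma> - p) * real k" by (simp add: algebra_simps)
    also have "2 powr ((e - \<gamma> - p) * real k) = ?q ^ k"
      by (simp add: powr_powr[symmetric] powr_realpow)
    finally show ?case using power_tail_pos[of p a "(shell_radius k - R) / d"] by simp
  qed
  show "summable (\<lambda>k. (2 * d * a) powr p * ?q ^ k)"
    using dp by (intro summable_mult summable_geometric) (auto simp: powr_less_one)
qed

text \<open>Since the length is at most the sum of the absolute coordinates, the largest of these has at
  least the fraction \<open>1 / d\<close> of it. This is how estimates in single directions control the
  displacement in space.\<close>

lemma large_coordinate:
  fixes x :: "'b::euclidean_space"
  shows "\<exists>e \<in> Basis \<union> uminus ` Basis. norm x / real DIM('b) \<le> e \<bullet> x"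
proof (rule ccontr)
  assume "\<not> ?thesis"
  then have *: "e \<bullet> x < norm x / real DIM('b)" if "e \<in> Basis \<union> uminus ` Basis" for e
    using that by (auto simp: not_le)
  have "norm x \<le> (\<Sum>b\<in>Basis. \<bar>x \<bullet> b\<bar>)" by (rule norm_le_l1)
  also have "\<dots> < (\<Sum>b\<in>(Basis :: 'b set). norm x / real DIM('b))"
  proof (rule sum_strict_mono)
    fix b :: 'b assume "b \<in> Basis"
    then show "\<bar>x \<bullet> b\<bar> < norm x / real DIM('b)"
      using *[of b] *[of "- b"] by (auto simp: abs_if inner_commute)
  qed auto
  also have "\<dots> = norm x" by simp
  finally show False by simp
qed

section \<open>Families that visit a bounded set\<close>

context brownian_branching_system
begin

lemma initial_count:
  assumes [measurable]: "A \<in> sets borel"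
  shows "emeasure (initial_configuration n X \<omega>) A = (\<Sum>i. indicator {\<omega>. enat i < n \<omega> \<and> X i \<omega> \<in> A} \<omega>)"
proof -
  let ?S = "{i. enat i < n \<omega>}"
  have "emeasure (initial_configuration n X \<omega>) A = emeasure (count_space ?S) {i \<in> ?S. X i \<omega> \<in> A}"
    unfolding initial_configuration_def by (subst emeasure_distr) (auto intro!: arg_cong2[where f=emeasure])
  also have "\<dots> = (\<integral>\<^sup>+i. indicator {i \<in> ?S. X i \<omega> \<in> A} i \<partial>count_space ?S)"
    by (subst nn_integral_indicator) auto
  also have "\<dots> = (\<integral>\<^sup>+i. indicator {i \<in> ?S. X i \<omega> \<in> A} i * indicator ?S i \<partial>count_space UNIV)"
    by (rule nn_integral_count_space_indicator) simp
  also have "\<dots> = (\<integral>\<^sup>+i. indicator {i \<in> ?S. X i \<omega> \<in> A} i \<partial>count_space UNIV)"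
    by (intro nn_integral_cong) (auto simp: indicator_def)
  also have "\<dots> = (\<Sum>i. indicator {i \<in> ?S. X i \<omega> \<in> A} i)"
    by (rule nn_integral_count_space_nat)
  also have "\<dots> = (\<Sum>i. indicator {\<omega>. enat i < n \<omega> \<and> X i \<omega> \<in> A} \<omega>)"
    by (intro arg_cong[where f=suminf]) (auto simp: fun_eq_iff indicator_def)
  finally show ?thesis .
qed

text \<open>Events for single ancestors. \<open>starts_in\<close> depends on the initial configuration, \<open>spreads\<close> (below)
  on the family tree alone, so the two are independent.\<close>

definition starts_in :: "nat \<Rightarrow> 'b set \<Rightarrow> 'w set" where
  "starts_in i A = {\<omega>\<in>space M. enat i < n \<omega> \<and> X i \<omega> \<in> A}"

lemma sets_starts_in_generated:
  assumes A: "A \<in> sets borel"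
  shows "starts_in i A \<in> sets (generated_by {Initial})"
proof -
  let ?f = "\<lambda>\<omega>. (n \<omega>, \<lambda>i. X i \<omega>)" and ?N = "count_space UNIV \<Otimes>\<^sub>M (\<Pi>\<^sub>M i\<in>UNIV. borel :: 'b measure)"
  have f: "?f \<in> measurable (generated_by {Initial}) ?N" by (rule measurable_initial_generated) simp
  have "n \<in> measurable (generated_by {Initial}) (count_space UNIV)"
    using measurable_compose[OF f measurable_fst] by simp
  moreover have "X i \<in> borel_measurable (generated_by {Initial})"
    using measurable_compose[OF measurable_compose[OF f measurable_snd] measurable_component_singleton[of i]] by simp
  ultimately have "{\<omega>\<in>space (generated_by {Initial}). enat i < n \<omega> \<and> X i \<omega> \<in> A} \<in> sets (generated_by {Initial})"
    using A by measurable
  then show ?thesis by (simp add: starts_in_def)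
qed

lemma sets_starts_in [measurable]: "A \<in> sets borel \<Longrightarrow> starts_in i A \<in> events"
  using sets_starts_in_generated sets_generated_by_subset by blast

text \<open>The mean of the Poisson configuration, distributed over the individual ancestors.\<close>

lemma expected_initial_count:
  assumes A: "A \<in> sets borel" and fin: "emeasure (initial_intensity \<gamma>) A < \<infinity>"
  shows "(\<Sum>i. emeasure M (starts_in i A)) = emeasure (initial_intensity \<gamma>) A"
proof -
  have eq: "emeasure (initial_configuration n X \<omega>) A = (\<Sum>i. indicator (starts_in i A) \<omega>)" if "\<omega> \<in> space M" for \<omega>
    unfolding initial_count[OF A] using that
    by (intro arg_cong[where f=suminf]) (auto simp: fun_eq_iff indicator_def starts_in_def)
  have m: "(\<lambda>\<omega>. emeasure (initial_configuration n X \<omega>) A) \<in> borel_measurable M"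
    by (subst measurable_cong[OF eq]) (use A in measurable)
  have "(\<Sum>i. emeasure M (starts_in i A)) = (\<integral>\<^sup>+\<omega>. (\<Sum>i. indicator (starts_in i A) \<omega>) \<partial>M)"
    using A by (subst nn_integral_suminf) auto
  also have "\<dots> = (\<integral>\<^sup>+\<omega>. emeasure (initial_configuration n X \<omega>) A \<partial>M)"
    by (intro nn_integral_cong) (simp add: eq)
  also have "\<dots> = emeasure (initial_intensity \<gamma>) A"
    using A by (intro poisson_mean initial fin m) (simp add: initial_intensity_def)
  finally show ?thesis .
qed

definition spreads :: "nat \<Rightarrow> real \<Rightarrow> 'w set" where
  "spreads i r = {\<omega>\<in>space M. \<exists>e\<in>Basis \<union> uminus ` Basis. \<exists>m. r \<le> subtree_max m [] (\<lambda>u. mark e i u \<omega>)}"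

lemma sets_spreads_generated: "spreads i r \<in> sets (generated_by (\<Union>u. label_sources i u))"
proof -
  let ?F = "generated_by (\<Union>u. label_sources i u)"
  have m: "(\<lambda>\<omega>. subtree_max m [] (\<lambda>u. mark e i u \<omega>)) \<in> borel_measurable ?F" for m e
    by (rule measurable_subtree_max_marks[where L=UNIV]) auto
  have "(\<Union>e\<in>Basis \<union> uminus ` Basis. \<Union>m. (\<lambda>\<omega>. subtree_max m [] (\<lambda>u. mark e i u \<omega>)) -` {r..} \<inter> space ?F) \<in> sets ?F"
  proof (rule sets.finite_UN)
    fix e :: 'b
    show "(\<Union>m. (\<lambda>\<omega>. subtree_max m [] (\<lambda>u. mark e i u \<omega>)) -` {r..} \<inter> space ?F) \<in> sets ?F"
      using measurable_sets[OF m, of "{r..}"] by (intro sets.countable_UN) auto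
  qed simp
  also have "(\<Union>e\<in>Basis \<union> uminus ` Basis. \<Union>m. (\<lambda>\<omega>. subtree_max m [] (\<lambda>u. mark e i u \<omega>)) -` {r..} \<inter> space ?F)
      = spreads i r"
    by (auto simp: spreads_def)
  finally show ?thesis .
qed

lemma spreads_tail:
  assumes a: "\<And>e i w m x. norm e = 1 \<Longrightarrow>
    prob {\<omega>\<in>space M. x \<le> subtree_max m w (\<lambda>u. mark e i u \<omega>)} \<le> power_tail p a x"
  shows "prob (spreads i r) \<le> 2 * real DIM('b) * power_tail p a r"
proof -
  let ?D = "Basis \<union> uminus ` Basis :: 'b set"
  let ?E = "\<lambda>e. {\<omega>\<in>space M. \<exists>m. r \<le> subtree_max m [] (\<lambda>u. mark e i u \<omega>)}"
  have [measurable]: "(\<lambda>\<omega>. subtree_max m [] (\<lambda>u. mark e i u \<omega>)) \<in> borel_measurable M" for m e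
    by (rule measurable_generated_byD[OF measurable_subtree_max_marks[where L=UNIV]]) auto
  have "spreads i r = (\<Union>e\<in>?D. ?E e)" by (auto simp: spreads_def)
  then have "prob (spreads i r) \<le> (\<Sum>e\<in>?D. prob (?E e))"
    by (simp only:) (intro finite_measure_subadditive_finite, auto)
  also have "\<dots> \<le> (\<Sum>e\<in>?D. power_tail p a r)"
    by (intro sum_mono prob_some_depth_le a subtree_max_mono_Suc) auto
  also have "\<dots> = real (card ?D) * power_tail p a r" by simp
  also have "real (card ?D) \<le> 2 * real DIM('b)"
    using card_Un_le[of Basis "uminus ` Basis :: 'b set"] card_image_le[of "Basis :: 'b set" uminus] by simp
  finally show ?thesis using power_tail_pos[of p a r] by (simp add: mult_right_mono)
qed

text \<open>An ancestor in the shell \<open>k\<close> can only be counted if its family spreads at least by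
  \<open>r k = (shell_radius k - R) / d\<close>, and by independence the expected number of such ancestors is at most the mass of the
  shell times the tail bound. The sum over all shells is finite, and the Borel--Cantelli lemma applies to the
  ancestors.\<close>

lemma finitely_many_visitors:
  assumes gamma: "0 \<le> \<gamma>" and dim: "real DIM('b) < 2 / \<beta> + \<gamma>"
  shows "AE \<omega> in M. finite {i. enat i < n \<omega> \<and> \<omega> \<in> spreads i ((norm (X i \<omega>) - R) / real DIM('b))}"
proof -
  let ?d = "DIM('b)"
  obtain a where a: "1 \<le> a" "\<And>e i w m x. norm e = 1 \<Longrightarrow>
      prob {\<omega>\<in>space M. x \<le> subtree_max m w (\<lambda>u. mark e i u \<omega>)} \<le> power_tail (2 / \<beta>) a x"
    using tree_displacement_tail_uniform by blast
  define r where "r k = (shell_radius k - R) / real ?d" for k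
  define C where "C = unit_ball_vol (real ?d) * 2 ^ ?d * (2 * real ?d)"
  define t where "t k = 2 powr (real k * (real ?d - \<gamma>)) * power_tail (2 / \<beta>) a (r k)" for k
  \<comment> \<open>The event that the ancestor \<open>i\<close> lies in some shell and its family spreads enough to return from its inner radius.\<close>
  define W where "W i = (\<Union>k. starts_in i (shell k) \<inter> spreads i (r k))" for i
  have spreads_ev: "spreads i x \<in> events" for i x
    using sets_spreads_generated sets_generated_by_subset by blast
  have G_ev: "starts_in i (shell k) \<inter> spreads i (r k) \<in> events" for i k
    by (rule sets.Int[OF sets_starts_in[OF sets_shell] spreads_ev])
  have W_ev: "W i \<in> events" for i
    unfolding W_def using G_ev by (intro sets.countable_UN) auto
  have t0: "0 \<le> t k" for k
    unfolding t_def using power_tail_pos[of "2 / \<beta>" a "r k"] by simp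
  have C0: "0 \<le> C" unfolding C_def by simp
  have t_summable: "summable t"
    unfolding t_def r_def using beta a(1) dim by (intro summable_shell_series) auto
  have single: "emeasure M (starts_in i (shell k) \<inter> spreads i (r k))
      \<le> emeasure M (starts_in i (shell k)) * ennreal (2 * real ?d * power_tail (2 / \<beta>) a (r k))" for i k
  proof -
    have "indep_pair (generated_by {Initial}) (\<lambda>\<omega>. \<omega>) (generated_by (\<Union>u. label_sources i u)) (\<lambda>\<omega>. \<omega>)"
      by (rule indep_pair_blocks[where ?J1.0="{Initial}" and ?J2.0="\<Union>u. label_sources i u"])
        (auto simp: label_sources_def)
    from indep_pairD[OF this sets_starts_in_generated[OF sets_shell] sets_spreads_generated, of i k "r k"]
    have "prob (starts_in i (shell k) \<inter> spreads i (r k)) = prob (starts_in i (shell k)) * prob (spreads i (r k))"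
      by (simp add: Int_absorb2 starts_in_def spreads_def Int_def conj_ac)
    also have "\<dots> \<le> prob (starts_in i (shell k)) * (2 * real ?d * power_tail (2 / \<beta>) a (r k))"
      by (intro mult_left_mono spreads_tail a(2)) auto
    finally show ?thesis
      using power_tail_pos[of "2 / \<beta>" a "r k"]
      by (simp add: emeasure_eq_measure ennreal_mult[symmetric] ennreal_leI)
  qed
  have "(\<Sum>i. emeasure M (W i)) \<le> (\<Sum>i. \<Sum>k. emeasure M (starts_in i (shell k) \<inter> spreads i (r k)))"
    unfolding W_def by (intro suminf_le emeasure_subadditive_countably)
      (use G_ev in auto)
  also have "\<dots> \<le> (\<Sum>i. \<Sum>k. emeasure M (starts_in i (shell k)) * ennreal (2 * real ?d * power_tail (2 / \<beta>) a (r k)))"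
    by (intro suminf_le single) auto
  also have "\<dots> = (\<Sum>k. \<Sum>i. emeasure M (starts_in i (shell k)) * ennreal (2 * real ?d * power_tail (2 / \<beta>) a (r k)))"
    by (simp only: nn_integral_count_space_nat[symmetric])
      (rule nn_integral_count_space_nn_integral, auto)
  also have "\<dots> = (\<Sum>k. emeasure (initial_intensity \<gamma>) (shell k :: 'b set) * ennreal (2 * real ?d * power_tail (2 / \<beta>) a (r k)))"
  proof (intro arg_cong[where f=suminf] ext)
    fix k
    have "emeasure (initial_intensity \<gamma>) (shell k :: 'b set) < \<infinity>"
      using emeasure_initial_intensity_shell[OF gamma, of k, where 'b='b] by (auto simp: top_unique less_top[symmetric])
    then show "(\<Sum>i. emeasure M (starts_in i (shell k)) * ennreal (2 * real ?d * power_tail (2 / \<beta>) a (r k)))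
        = emeasure (initial_intensity \<gamma>) (shell k :: 'b set) * ennreal (2 * real ?d * power_tail (2 / \<beta>) a (r k))"
      by (simp add: expected_initial_count)
  qed
  also have "\<dots> \<le> (\<Sum>k. ennreal (C * t k))"
  proof (rule suminf_le)
    fix k
    have "emeasure (initial_intensity \<gamma>) (shell k :: 'b set) * ennreal (2 * real ?d * power_tail (2 / \<beta>) a (r k))
        \<le> ennreal (unit_ball_vol ?d * 2 ^ ?d * 2 powr (real k * (real ?d - \<gamma>))) * ennreal (2 * real ?d * power_tail (2 / \<beta>) a (r k))"
      by (intro mult_right_mono emeasure_initial_intensity_shell gamma) simp
    also have "\<dots> = ennreal (C * t k)"
      using power_tail_pos[of "2 / \<beta>" a "r k"]
      by (subst ennreal_mult[symmetric]) (auto simp: C_def t_def mult_ac)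
    finally show "emeasure (initial_intensity \<gamma>) (shell k :: 'b set) * ennreal (2 * real ?d * power_tail (2 / \<beta>) a (r k))
        \<le> ennreal (C * t k)" .
  qed auto
  also have "\<dots> = ennreal (\<Sum>k. C * t k)"
    using t0 C0 t_summable by (intro suminf_ennreal2 summable_mult) auto
  also have "\<dots> < \<infinity>" by simp
  finally have fin: "(\<Sum>i. emeasure M (W i)) < \<infinity>" .
  have "AE \<omega> in M. finite {i. \<omega> \<in> W i}"
  proof -
    have "summable (\<lambda>i. prob (W i))"
      using fin by (intro summable_suminf_not_top) (auto simp: emeasure_eq_measure)
    then have "AE \<omega> in M. \<forall>\<^sub>F i in sequentially. \<omega> \<in> space M - W i"
      by (intro borel_cantelli_AE1 W_ev) (auto simp: emeasure_eq_measure)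
    then show ?thesis
    proof eventually_elim
      case (elim \<omega>)
      then obtain N where "\<And>i. N \<le> i \<Longrightarrow> \<omega> \<notin> W i" by (auto simp: eventually_sequentially)
      then have "{i. \<omega> \<in> W i} \<subseteq> {..<N}" by (auto simp: not_le[symmetric])
      then show ?case by (rule finite_subset) simp
    qed
  qed
  then show ?thesis
  proof (rule AE_mp, intro AE_I2 impI)
    fix \<omega> assume \<omega>: "\<omega> \<in> space M" and fin: "finite {i. \<omega> \<in> W i}"
    have "i \<in> {i. \<omega> \<in> W i}"
      if i: "enat i < n \<omega>" "\<omega> \<in> spreads i ((norm (X i \<omega>) - R) / real ?d)" for i
    proof -
      obtain k where k: "X i \<omega> \<in> shell k" using ex_shell by blast
      then have "r k \<le> (norm (X i \<omega>) - R) / real ?d"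
        unfolding r_def by (intro divide_right_mono) (auto simp: shell_def)
      then have "\<omega> \<in> spreads i (r k)"
        using i(2) unfolding spreads_def by (auto intro: order_trans)
      moreover have "\<omega> \<in> starts_in i (shell k)" using \<omega> i k by (simp add: starts_in_def)
      ultimately show ?thesis by (auto simp: W_def)
    qed
    then show "finite {i. enat i < n \<omega> \<and> \<omega> \<in> spreads i ((norm (X i \<omega>) - R) / real ?d)}"
      by (intro finite_subset[OF _ fin]) blast
  qed
qed

text \<open>To reach the ball of radius \<open>R\<close> from \<open>X i\<close> a particle must be displaced by \<open>norm (X i) - R\<close>, and one signed
  coordinate has to account for the fraction \<open>1 / d\<close> of it.\<close>

lemma visitor_spreads:
  assumes \<omega>: "\<omega> \<in> space M" and reg: "regular i \<omega>" and alive: "(i, u) \<in> alive n T K t \<omega>"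
    and pos: "norm (particle_position X T Y t \<omega> (i, u)) \<le> R"
  shows "\<omega> \<in> spreads i ((norm (X i \<omega>) - R) / real DIM('b))"
proof -
  let ?x = "particle_position X T Y t \<omega> (i, u) - X i \<omega>"
  obtain e where e: "e \<in> Basis \<union> uminus ` Basis" "norm ?x / real DIM('b) \<le> e \<bullet> ?x"
    using large_coordinate by blast
  have "norm (X i \<omega>) - R \<le> norm ?x"
    using pos norm_triangle_ineq2[of "X i \<omega>" "particle_position X T Y t \<omega> (i, u)"] by (simp add: norm_minus_commute)
  then have "(norm (X i \<omega>) - R) / real DIM('b) \<le> norm ?x / real DIM('b)" by (rule divide_right_mono) simp
  also have "\<dots> \<le> e \<bullet> ?x" by (rule e)
  also have "\<dots> \<le> subtree_max (length u) [] (\<lambda>u. mark e i u \<omega>)"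
    by (rule inner_position_le[OF reg alive])
  finally show ?thesis using \<omega> e(1) by (auto simp: spreads_def)
qed

end

theorem theorem2p8:
  fixes M :: "'w measure"
    and \<beta> \<gamma> V :: real
    and n :: "'w \<Rightarrow> enat"
    and X :: "nat \<Rightarrow> 'w \<Rightarrow> 'b::euclidean_space"
    and T :: "nat \<Rightarrow> nat list \<Rightarrow> 'w \<Rightarrow> real"
    and K :: "nat \<Rightarrow> nat list \<Rightarrow> 'w \<Rightarrow> nat"
    and Y :: "nat \<Rightarrow> nat list \<Rightarrow> real \<Rightarrow> 'w \<Rightarrow> 'b"
    and A :: "'b set"
  assumes "0 < \<beta>" and "\<beta> \<le> 1" and "0 \<le> \<gamma>" and "0 < V"
    and "branching_particle_system M 2 \<beta> \<gamma> V n X T K Y"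
    and "real DIM('b) < 2 / \<beta> + \<gamma>"
    and "A \<in> sets borel" and "bounded A"
  shows "AE \<omega> in M. \<exists>\<tau>::real. \<forall>t\<ge>\<tau>. emeasure (empirical_measure n X T K Y t \<omega>) A = 0"
proof -
  interpret branching_particle_system M 2 \<beta> \<gamma> V n X T K Y by fact
  interpret brownian_branching_system M \<beta> \<gamma> V n X T K Y by unfold_locales fact+
  obtain R where R: "\<And>x. x \<in> A \<Longrightarrow> norm x \<le> R" using \<open>bounded A\<close> by (auto simp: bounded_iff)
  have "AE \<omega> in M. \<omega> \<in> space M" by (rule AE_space)
  with finitely_many_visitors[OF \<open>0 \<le> \<gamma>\<close> \<open>real DIM('b) < 2 / \<beta> + \<gamma>\<close>, of R] extinction AE_regular
  show ?thesis
  proof eventually_elim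
    case (elim \<omega>)
    define I where "I = {i. enat i < n \<omega> \<and> \<omega> \<in> spreads i ((norm (X i \<omega>) - R) / real DIM('b))}"
    \<comment> \<open>The finitely many visiting families consist of finitely many particles. After the last of their
      deaths the set is empty, since no other family ever enters it.\<close>
    define deaths where "deaths = (\<lambda>(i, u). birth_time T i u \<omega> + T i u \<omega>) ` (SIGMA i:I. {u. exists_label n K i u \<omega>})"
    have "finite deaths"
      unfolding deaths_def using elim by (intro finite_imageI finite_SigmaI) (auto simp: I_def)
    then have "bdd_above deaths" by (rule bdd_above_finite)
    then obtain \<tau> where \<tau>: "\<And>s. s \<in> deaths \<Longrightarrow> s \<le> \<tau>" unfolding bdd_above_def by auto
    have "emeasure (empirical_measure n X T K Y t \<omega>) A = 0" if t: "\<tau> \<le> t" for t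
    proof -
      have "l \<notin> alive n T K t \<omega>" if pos: "particle_position X T Y t \<omega> l \<in> A" for l
      proof
        obtain i u where l: "l = (i, u)" by (cases l)
        assume "l \<in> alive n T K t \<omega>"
        then have alive: "(i, u) \<in> alive n T K t \<omega>" by (simp add: l)
        then have ex: "exists_label n K i u \<omega>" and lt: "t < birth_time T i u \<omega> + T i u \<omega>"
          by (auto simp: alive_def)
        have "\<omega> \<in> spreads i ((norm (X i \<omega>) - R) / real DIM('b))"
          using visitor_spreads[OF _ _ alive] R[OF pos] elim by (simp add: l)
        moreover have "enat i < n \<omega>" using ex by (simp add: exists_label_iff_in_tree[where f="\<lambda>_. (0, 0)"])
        ultimately have "birth_time T i u \<omega> + T i u \<omega> \<in> deaths"
          using ex by (force simp: deaths_def I_def)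
        from \<tau>[OF this] t lt show False by simp
      qed
      then have none: "{l \<in> alive n T K t \<omega>. particle_position X T Y t \<omega> l \<in> A} = {}" by blast
      show ?thesis unfolding emeasure_empirical_measure[OF \<open>A \<in> sets borel\<close>] none by simp
    qed
    then show ?case by blast
  qed
qed

end
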